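(* Let $\mathcal{D},\mathcal{S}$ be symmetric 2-multicategories in which all 2-morphisms are invertible, let $\mathcal{D}\to\mathcal{S}$ be a symmetric 1-bifibered and 2-isofibered 2-multicategory such that also $\mathcal{S}\to\{\cdot\}$ is 1-bifibered, and let $s:\{\cdot\}\to\mathcal{S}$ be a pseudo-functor of 2-multicategories with value $S$. Then for objects $\mathcal{E},\mathcal{F}$ of $\mathcal{D}_S$ there are equivalences $$\mathcal{E}\otimes\mathcal{F}\cong\Delta_\bullet(\mathcal{E}\boxtimes\mathcal{F}),\qquad \mathcal{HOM}(\mathcal{E},\mathcal{F})\cong(\Delta')^\bullet(\mathbf{HOM}(\mathcal{E},\mathcal{F})),$$ where $\otimes,\mathcal{HOM}$ are the internal product on $\mathcal{D}_S$ and its adjoint, $\boxtimes,\mathbf{HOM}$ are the external product on $\mathcal{D}$ and its adjoint, and $\Delta:S\otimes S\to S$ and $\Delta':S\to\mathcal{HOM}(S,S)$ are the 1-morphisms of $\mathcal{S}$ determined by $s$.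
   Context: A 2-multicategory has objects, categories $\mathrm{Hom}(X_1,\dots,X_n;Y)$ for $n\ge0$ (objects: 1-morphisms; morphisms: 2-morphisms), composition functors $(f,g)\mapsto g\circ_if$ inserting $f$ in the $i$-th slot of $g$, and identities; strictly associative and unital, compositions in different slots commuting. It is symmetric if the symmetric groups act, by isomorphisms of Hom categories permuting the sources, strictly compatibly with composition. Pseudo-functors preserve composition and identities up to coherent natural isomorphisms; strict functors preserve them strictly. $\{\cdot\}$ is the 2-multicategory with one object and all Hom categories terminal. For a strict functor $p:\mathcal{D}\to\mathcal{S}$, $\mathrm{Hom}_f$ is the category of 1-morphisms over $f$ and 2-morphisms over $\mathrm{id}_f$; $\mathcal{D}_S$ is the 2-category of objects, unary 1-morphisms and 2-morphisms mapped to $S,\mathrm{id}_S,\mathrm{id}_{\mathrm{id}_S}$. A strictly commutative square of categories with functors $\mathcal{A}\to\mathcal{B}\xrightarrow{\beta}\mathcal{C}'$, $\mathcal{A}\to\mathcal{C}\xrightarrow{\gamma}\mathcal{C}'$ is 2-Cartesian if the functor from $\mathcal{A}$ to the category of triples $(b,c,\nu:\beta(b)\xrightarrow{\sim}\gamma(c))$ is an equivalence. A 1-morphism $\xi\in\mathrm{Hom}_f(\mathcal{E}_1,\dots,\mathcal{E}_n;\mathcal{F})$ is coCartesian if for all $m,i$ and objects $\mathcal{F}_1,\dots,\mathcal{F}_m,\mathcal{G}$ with $\mathcal{F}_i=\mathcal{F}$ the square formed by $\circ_i\xi$ on $\mathrm{Hom}_{\mathcal{D}}(\mathcal{F}_1,\dots,\mathcal{F}_m;\mathcal{G})$,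 $\circ_if$ and the functors induced by $p$ is 2-Cartesian; Cartesian w.r.t. the $i$-th slot if for all $\mathcal{G}_1,\dots,\mathcal{G}_m$ the square formed by $\xi\circ_i$ on $\mathrm{Hom}_{\mathcal{D}}(\mathcal{G}_1,\dots,\mathcal{G}_m;\mathcal{E}_i)$, $f\circ_i$ and the functors induced by $p$ is 2-Cartesian. $p$ is 1-opfibered (1-fibered) if coCartesian 1-morphisms with given sources (Cartesian 1-morphisms w.r.t. each slot with given target and other sources) exist over each 1-morphism; 1-bifibered if both. $p$ is 2-isofibered if the functors $\mathrm{Hom}_{\mathcal{D}}\to\mathrm{Hom}_{\mathcal{S}}$, restricted to 2-isomorphisms, form a 2-fibration. $f_\bullet(\mathcal{E}_1,\dots,\mathcal{E}_n)$ denotes the target of a coCartesian 1-morphism over $f$ with sources $\mathcal{E}_i$; $f^{\bullet,i}$ denotes the $i$-th source of a Cartesian 1-morphism w.r.t. the $i$-th slot ($f^\bullet$ for unary $f$); both are unique up to equivalence. The pseudo-functor $s$ specifies a distinguished 1-morphism $\Delta\in\mathrm{Hom}(S,S;S)$ and makes $\mathcal{D}_S$ a symmetric closed monoidal 2-category: the internal product $\mathcal{E}\otimes\mathcal{F}$ is the push-forward of $(\mathcal{E},\mathcal{F})$ along $\Delta\in\mathrm{Hom}(S,S;S)$ and $\mathcal{HOM}(\mathcal{E},\mathcal{F})$ is the pull-back of $\mathcal{F}$ along $\Delta$ with $\mathcal{E}$ in the other slot. The 1-bifibration $\mathcal{S}\to\{\cdot\}$ gives a closed monoidal structure on $\mathcal{S}$,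 also denoted $\otimes$, $\mathcal{HOM}$. By transitivity $\mathcal{D}\to\{\cdot\}$ is also 1-bifibered, so $\mathcal{D}$ carries a closed monoidal structure $\boxtimes$ (external product) with adjoint $\mathbf{HOM}$, where $\mathcal{E}\boxtimes\mathcal{F}$ is the push-forward and $\mathbf{HOM}(\mathcal{E},\mathcal{F})$ the pull-back along the 2-ary morphism of $\{\cdot\}$; these objects are taken to lie over $S\otimes S$, resp. $\mathcal{HOM}(S,S)$, for $\mathcal{E},\mathcal{F}$ over $S$. The 1-morphisms $\Delta:S\otimes S\to S$ and $\Delta':S\to\mathcal{HOM}(S,S)$ are those corresponding to $\Delta\in\mathrm{Hom}(S,S;S)$ under the universal properties of $\otimes$ and $\mathcal{HOM}$ in $\mathcal{S}$. *)

theory Defs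
  imports "HOL-Combinatorics.Permutations"
begin

section \<open>Categories, functors, equivalences\<close>

record ('a, 'b) cat =
  Ob :: "'a set"
  Ar :: "'b set"
  Dom :: "'b \<Rightarrow> 'a"
  Cod :: "'b \<Rightarrow> 'a"
  Id :: "'a \<Rightarrow> 'b"
  Comp :: "'b \<Rightarrow> 'b \<Rightarrow> 'b"  \<comment> \<open>\<open>Comp C v u\<close> is \<open>v\<close> after \<open>u\<close>\<close>

definition hom :: "('a, 'b) cat \<Rightarrow> 'a \<Rightarrow> 'a \<Rightarrow> 'b set" where
  "hom C x y = {u \<in> Ar C. Dom C u = x \<and> Cod C u = y}"

locale category =
  fixes C :: "('a, 'b) cat"
  assumes dom_cod: "u \<in> Ar C \<Longrightarrow> Dom C u \<in> Ob C \<and> Cod C u \<in> Ob C"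
    and id_hom: "x \<in> Ob C \<Longrightarrow> Id C x \<in> hom C x x"
    and comp_hom: "u \<in> hom C x y \<Longrightarrow> v \<in> hom C y z \<Longrightarrow> Comp C v u \<in> hom C x z"
    and comp_id: "u \<in> hom C x y \<Longrightarrow> Comp C u (Id C x) = u"
    and id_comp: "u \<in> hom C x y \<Longrightarrow> Comp C (Id C y) u = u"
    and comp_assoc: "u \<in> hom C x y \<Longrightarrow> v \<in> hom C y z \<Longrightarrow> w \<in> hom C z t \<Longrightarrow>
      Comp C w (Comp C v u) = Comp C (Comp C w v) u"

definition is_iso :: "('a, 'b) cat \<Rightarrow> 'b \<Rightarrow> bool" where
  "is_iso C u \<longleftrightarrow> u \<in> Ar C \<and>
    (\<exists>v \<in> hom C (Cod C u) (Dom C u).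
      Comp C v u = Id C (Dom C u) \<and> Comp C u v = Id C (Cod C u))"

definition isos :: "('a, 'b) cat \<Rightarrow> 'a \<Rightarrow> 'a \<Rightarrow> 'b set" where
  "isos C x y = {u \<in> hom C x y. is_iso C u}"

definition isomorphic :: "('a, 'b) cat \<Rightarrow> 'a \<Rightarrow> 'a \<Rightarrow> bool" where
  "isomorphic C x y \<longleftrightarrow> isos C x y \<noteq> {}"

definition prod_cat :: "('a, 'b) cat \<Rightarrow> ('c, 'd) cat \<Rightarrow> ('a \<times> 'c, 'b \<times> 'd) cat" where
  "prod_cat C D =
    \<lparr>Ob = Ob C \<times> Ob D, Ar = Ar C \<times> Ar D,
     Dom = map_prod (Dom C) (Dom D), Cod = map_prod (Cod C) (Cod D),
     Id = map_prod (Id C) (Id D),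
     Comp = (\<lambda>(v, v') (u, u'). (Comp C v u, Comp D v' u'))\<rparr>"

record ('a, 'b, 'c, 'd) functor_data =
  FOb :: "'a \<Rightarrow> 'c"
  FAr :: "'b \<Rightarrow> 'd"

definition is_functor ::
    "('a, 'b) cat \<Rightarrow> ('c, 'd) cat \<Rightarrow> ('a, 'b, 'c, 'd) functor_data \<Rightarrow> bool" where
  "is_functor C D F \<longleftrightarrow>
    (\<forall>x \<in> Ob C. FOb F x \<in> Ob D) \<and>
    (\<forall>u \<in> Ar C. FAr F u \<in> hom D (FOb F (Dom C u)) (FOb F (Cod C u))) \<and>
    (\<forall>x \<in> Ob C. FAr F (Id C x) = Id D (FOb F x)) \<and>
    (\<forall>u \<in> Ar C. \<forall>v \<in> Ar C. Cod C u = Dom C v \<longrightarrow>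
      FAr F (Comp C v u) = Comp D (FAr F v) (FAr F u))"

definition id_functor :: "('a, 'b, 'a, 'b) functor_data" where
  "id_functor = \<lparr>FOb = id, FAr = id\<rparr>"

definition comp_functor ::
    "('c, 'd, 'e, 'f) functor_data \<Rightarrow> ('a, 'b, 'c, 'd) functor_data \<Rightarrow> ('a, 'b, 'e, 'f) functor_data"
  where "comp_functor G F = \<lparr>FOb = FOb G \<circ> FOb F, FAr = FAr G \<circ> FAr F\<rparr>"

definition natural_iso ::
    "('a, 'b) cat \<Rightarrow> ('c, 'd) cat \<Rightarrow> ('a, 'b, 'c, 'd) functor_data \<Rightarrow> ('a, 'b, 'c, 'd) functor_data
      \<Rightarrow> ('a \<Rightarrow> 'd) \<Rightarrow> bool" where
  "natural_iso C D F G \<eta> \<longleftrightarrow>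
    (\<forall>x \<in> Ob C. \<eta> x \<in> isos D (FOb F x) (FOb G x)) \<and>
    (\<forall>u \<in> Ar C. Comp D (FAr G u) (\<eta> (Dom C u)) = Comp D (\<eta> (Cod C u)) (FAr F u))"

definition is_equivalence ::
    "('a, 'b) cat \<Rightarrow> ('c, 'd) cat \<Rightarrow> ('a, 'b, 'c, 'd) functor_data \<Rightarrow> bool" where
  "is_equivalence C D F \<longleftrightarrow> is_functor C D F \<and>
    (\<exists>G. is_functor D C G \<and>
      (\<exists>\<eta>. natural_iso C C id_functor (comp_functor G F) \<eta>) \<and>
      (\<exists>\<epsilon>. natural_iso D D (comp_functor F G) id_functor \<epsilon>))"

text \<open>The category of triples \<open>(b, c, \<nu> : \<beta> b \<cong> \<gamma> c)\<close>. A morphism is a pair \<open>(u, v)\<close> with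
  \<open>\<gamma> v \<circ> \<nu> = \<nu>' \<circ> \<beta> u\<close>, stored together with its source and target.\<close>

definition triple_cat ::
    "('a, 'b) cat \<Rightarrow> ('c, 'd) cat \<Rightarrow> ('e, 'f) cat
      \<Rightarrow> ('a, 'b, 'e, 'f) functor_data \<Rightarrow> ('c, 'd, 'e, 'f) functor_data
      \<Rightarrow> ('a \<times> 'c \<times> 'f, ('a \<times> 'c \<times> 'f) \<times> ('a \<times> 'c \<times> 'f) \<times> 'b \<times> 'd) cat" where
  "triple_cat B C C' \<beta> \<gamma> =
    \<lparr>Ob = {(b, c, \<nu>). b \<in> Ob B \<and> c \<in> Ob C \<and> \<nu> \<in> isos C' (FOb \<beta> b) (FOb \<gamma> c)},
     Ar = {((b, c, \<nu>), (b', c', \<nu>'), u, v).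
       b \<in> Ob B \<and> c \<in> Ob C \<and> \<nu> \<in> isos C' (FOb \<beta> b) (FOb \<gamma> c) \<and>
       b' \<in> Ob B \<and> c' \<in> Ob C \<and> \<nu>' \<in> isos C' (FOb \<beta> b') (FOb \<gamma> c') \<and>
       u \<in> hom B b b' \<and> v \<in> hom C c c' \<and>
       Comp C' (FAr \<gamma> v) \<nu> = Comp C' \<nu>' (FAr \<beta> u)},
     Dom = (\<lambda>(X, X', u, v). X),
     Cod = (\<lambda>(X, X', u, v). X'),
     Id = (\<lambda>(b, c, \<nu>). ((b, c, \<nu>), (b, c, \<nu>), Id B b, Id C c)),
     Comp = (\<lambda>(X', X'', u', v') (X, X', u, v). (X, X'', Comp B u' u, Comp C v' v))\<rparr>"

text \<open>The square \<open>A \<rightarrow> B \<rightarrow> C'\<close>, \<open>A \<rightarrow> C \<rightarrow> C'\<close> with functors \<open>\<alpha>, \<beta>\<close> resp. \<open>\<delta>, \<gamma>\<close>.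
  Its strict commutativity is implied: otherwise the identities below do not define a functor
  into the category of triples.\<close>

definition comparison ::
    "('a, 'b) cat \<Rightarrow> ('g, 'h) cat
      \<Rightarrow> ('a, 'b, 'c, 'd) functor_data \<Rightarrow> ('c, 'd, 'g, 'h) functor_data \<Rightarrow> ('a, 'b, 'e, 'f) functor_data
      \<Rightarrow> ('a, 'b, 'c \<times> 'e \<times> 'h, ('c \<times> 'e \<times> 'h) \<times> ('c \<times> 'e \<times> 'h) \<times> 'd \<times> 'f) functor_data" where
  "comparison A C' \<alpha> \<beta> \<delta> =
    (let K = (\<lambda>a. (FOb \<alpha> a, FOb \<delta> a, Id C' (FOb \<beta> (FOb \<alpha> a)))) in
     \<lparr>FOb = K, FAr = (\<lambda>u. (K (Dom A u), K (Cod A u), FAr \<alpha> u, FAr \<delta> u))\<rparr>)"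

definition two_cartesian ::
    "('a, 'b) cat \<Rightarrow> ('c, 'd) cat \<Rightarrow> ('e, 'f) cat \<Rightarrow> ('g, 'h) cat
      \<Rightarrow> ('a, 'b, 'c, 'd) functor_data \<Rightarrow> ('c, 'd, 'g, 'h) functor_data
      \<Rightarrow> ('a, 'b, 'e, 'f) functor_data \<Rightarrow> ('e, 'f, 'g, 'h) functor_data \<Rightarrow> bool" where
  "two_cartesian A B C C' \<alpha> \<beta> \<delta> \<gamma> \<longleftrightarrow>
    is_equivalence A (triple_cat B C C' \<beta> \<gamma>) (comparison A C' \<alpha> \<beta> \<delta>)"

definition cartesian_arrow ::
    "('a, 'b) cat \<Rightarrow> ('c, 'd) cat \<Rightarrow> ('a, 'b, 'c, 'd) functor_data \<Rightarrow> 'b \<Rightarrow> bool" where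
  "cartesian_arrow C D F u \<longleftrightarrow> u \<in> Ar C \<and>
    (\<forall>w \<in> Ar C. \<forall>v \<in> hom D (FOb F (Dom C w)) (FOb F (Dom C u)).
      Cod C w = Cod C u \<and> Comp D (FAr F u) v = FAr F w \<longrightarrow>
      (\<exists>!t. t \<in> hom C (Dom C w) (Dom C u) \<and> FAr F t = v \<and> Comp C u t = w))"

definition fibration ::
    "('a, 'b) cat \<Rightarrow> ('c, 'd) cat \<Rightarrow> ('a, 'b, 'c, 'd) functor_data \<Rightarrow> bool" where
  "fibration C D F \<longleftrightarrow> is_functor C D F \<and>
    (\<forall>y \<in> Ob C. \<forall>v \<in> Ar D. Cod D v = FOb F y \<longrightarrow>
      (\<exists>u. cartesian_arrow C D F u \<and> Cod C u = y \<and> FAr F u = v))"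


section \<open>2-multicategories\<close>

text \<open>Slots are numbered from 0. Each 1-morphism determines its sources and target, and each
  2-morphism its source and target 1-morphism (i.e. distinct Hom categories are disjoint).
  \<open>comp1 M i g f\<close> is \<open>g \<circ>\<^sub>i f\<close>, \<open>comp2\<close> is its effect on 2-morphisms, and \<open>vcomp M \<nu> \<mu>\<close> is the
  composition \<open>\<nu>\<close> after \<open>\<mu>\<close> inside a Hom category.\<close>

record ('o, 'm, 'c) two_multicat =
  Obj :: "'o set"
  Mor :: "'m set"
  Cell :: "'c set"
  src :: "'m \<Rightarrow> 'o list"
  tgt :: "'m \<Rightarrow> 'o"
  dom2 :: "'c \<Rightarrow> 'm"
  cod2 :: "'c \<Rightarrow> 'm"
  id2 :: "'m \<Rightarrow> 'c"
  vcomp :: "'c \<Rightarrow> 'c \<Rightarrow> 'c"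
  id1 :: "'o \<Rightarrow> 'm"
  comp1 :: "nat \<Rightarrow> 'm \<Rightarrow> 'm \<Rightarrow> 'm"
  comp2 :: "nat \<Rightarrow> 'c \<Rightarrow> 'c \<Rightarrow> 'c"

definition Hom :: "('o, 'm, 'c, 'x) two_multicat_scheme \<Rightarrow> 'o list \<Rightarrow> 'o \<Rightarrow> ('m, 'c) cat" where
  "Hom M Xs Y =
    \<lparr>Ob = {f \<in> Mor M. src M f = Xs \<and> tgt M f = Y},
     Ar = {\<mu> \<in> Cell M. src M (dom2 M \<mu>) = Xs \<and> tgt M (dom2 M \<mu>) = Y},
     Dom = dom2 M, Cod = cod2 M, Id = id2 M, Comp = vcomp M\<rparr>"

abbreviation Hom_of :: "('o, 'm, 'c, 'x) two_multicat_scheme \<Rightarrow> 'm \<Rightarrow> ('m, 'c) cat" where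
  "Hom_of M f \<equiv> Hom M (src M f) (tgt M f)"

definition arity :: "('o, 'm, 'c, 'x) two_multicat_scheme \<Rightarrow> 'm \<Rightarrow> nat" where
  "arity M f = length (src M f)"

definition arity2 :: "('o, 'm, 'c, 'x) two_multicat_scheme \<Rightarrow> 'c \<Rightarrow> nat" where
  "arity2 M \<mu> = arity M (dom2 M \<mu>)"

definition subst_slot :: "nat \<Rightarrow> 'o list \<Rightarrow> 'o list \<Rightarrow> 'o list" where
  "subst_slot i Xs Ys = take i Ys @ Xs @ drop (Suc i) Ys"

definition composable :: "('o, 'm, 'c, 'x) two_multicat_scheme \<Rightarrow> nat \<Rightarrow> 'm \<Rightarrow> 'm \<Rightarrow> bool" where
  "composable M i g f \<longleftrightarrow> g \<in> Mor M \<and> f \<in> Mor M \<and> i < arity M g \<and> src M g ! i = tgt M f"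

definition composable2 :: "('o, 'm, 'c, 'x) two_multicat_scheme \<Rightarrow> nat \<Rightarrow> 'c \<Rightarrow> 'c \<Rightarrow> bool" where
  "composable2 M i \<nu> \<mu> \<longleftrightarrow> \<nu> \<in> Cell M \<and> \<mu> \<in> Cell M \<and> composable M i (dom2 M \<nu>) (dom2 M \<mu>)"

locale two_multicategory =
  fixes M :: "('o, 'm, 'c, 'x) two_multicat_scheme"
  assumes mor: "f \<in> Mor M \<Longrightarrow> set (src M f) \<subseteq> Obj M \<and> tgt M f \<in> Obj M"
    and cell: "\<mu> \<in> Cell M \<Longrightarrow> dom2 M \<mu> \<in> Mor M \<and> cod2 M \<mu> \<in> Mor M \<and>
      src M (cod2 M \<mu>) = src M (dom2 M \<mu>) \<and> tgt M (cod2 M \<mu>) = tgt M (dom2 M \<mu>)"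
    and Hom_category: "set Xs \<subseteq> Obj M \<Longrightarrow> Y \<in> Obj M \<Longrightarrow> category (Hom M Xs Y)"
    and comp_functor: "set Xs \<subseteq> Obj M \<Longrightarrow> set Ys \<subseteq> Obj M \<Longrightarrow> Z \<in> Obj M \<Longrightarrow> i < length Ys \<Longrightarrow>
      is_functor (prod_cat (Hom M Xs (Ys ! i)) (Hom M Ys Z)) (Hom M (subst_slot i Xs Ys) Z)
        \<lparr>FOb = (\<lambda>(f, g). comp1 M i g f), FAr = (\<lambda>(\<mu>, \<nu>). comp2 M i \<nu> \<mu>)\<rparr>"
    and id1: "X \<in> Obj M \<Longrightarrow> id1 M X \<in> Mor M \<and> src M (id1 M X) = [X] \<and> tgt M (id1 M X) = X"
    and assoc1: "composable M j h g \<Longrightarrow> composable M i g f \<Longrightarrow>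
      comp1 M j h (comp1 M i g f) = comp1 M (j + i) (comp1 M j h g) f"
    and assoc2: "composable2 M j \<rho> \<nu> \<Longrightarrow> composable2 M i \<nu> \<mu> \<Longrightarrow>
      comp2 M j \<rho> (comp2 M i \<nu> \<mu>) = comp2 M (j + i) (comp2 M j \<rho> \<nu>) \<mu>"
    and slots1: "i < j \<Longrightarrow> composable M i h f \<Longrightarrow> composable M j h g \<Longrightarrow>
      comp1 M i (comp1 M j h g) f = comp1 M (j + arity M f - 1) (comp1 M i h f) g"
    and slots2: "i < j \<Longrightarrow> composable2 M i \<rho> \<mu> \<Longrightarrow> composable2 M j \<rho> \<nu> \<Longrightarrow>
      comp2 M i (comp2 M j \<rho> \<nu>) \<mu> = comp2 M (j + arity2 M \<mu> - 1) (comp2 M i \<rho> \<mu>) \<nu>"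
    and left_unit1: "f \<in> Mor M \<Longrightarrow> comp1 M 0 (id1 M (tgt M f)) f = f"
    and left_unit2: "\<mu> \<in> Cell M \<Longrightarrow> comp2 M 0 (id2 M (id1 M (tgt M (dom2 M \<mu>)))) \<mu> = \<mu>"
    and right_unit1: "f \<in> Mor M \<Longrightarrow> i < arity M f \<Longrightarrow> comp1 M i f (id1 M (src M f ! i)) = f"
    and right_unit2: "\<mu> \<in> Cell M \<Longrightarrow> i < arity2 M \<mu> \<Longrightarrow>
      comp2 M i \<mu> (id2 M (id1 M (src M (dom2 M \<mu>) ! i))) = \<mu>"

text \<open>A permutation \<open>\<alpha>\<close> acts as \<open>Hom(X\<^sub>0, \<dots>; Y) \<rightarrow> Hom(X\<^bsub>\<alpha> 0\<^esub>, \<dots>; Y)\<close>; this is a right action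
  with respect to \<open>\<circ>\<close>. Slot \<open>j\<close> of \<open>\<alpha>\<cdot>g\<close> is slot \<open>\<alpha> j\<close> of \<open>g\<close>.

  \<open>outer_perm m n j \<alpha>\<close> is the permutation obtained from \<open>\<alpha>\<close> on \<open>m\<close> letters by replacing the letter
  \<open>\<alpha> j\<close> with a string of \<open>n\<close> letters, and \<open>inner_perm i n \<beta>\<close> is \<open>\<beta>\<close> applied to the string of \<open>n\<close>
  letters starting at \<open>i\<close>.\<close>

record ('o, 'm, 'c) sym_two_multicat = "('o, 'm, 'c) two_multicat" +
  act1 :: "(nat \<Rightarrow> nat) \<Rightarrow> 'm \<Rightarrow> 'm"
  act2 :: "(nat \<Rightarrow> nat) \<Rightarrow> 'c \<Rightarrow> 'c"

definition string_at :: "nat \<Rightarrow> nat \<Rightarrow> nat \<Rightarrow> nat list" where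
  "string_at i n k = (if k < i then [k] else if k = i then [i..<i + n] else [k + n - 1])"

definition outer_perm :: "nat \<Rightarrow> nat \<Rightarrow> nat \<Rightarrow> (nat \<Rightarrow> nat) \<Rightarrow> nat \<Rightarrow> nat" where
  "outer_perm m n j \<alpha> =
    (let ks = concat (map (\<lambda>k. string_at (\<alpha> j) n (\<alpha> k)) [0..<m])
     in (\<lambda>k. if k < length ks then ks ! k else k))"

definition inner_perm :: "nat \<Rightarrow> nat \<Rightarrow> (nat \<Rightarrow> nat) \<Rightarrow> nat \<Rightarrow> nat" where
  "inner_perm i n \<beta> = (\<lambda>k. if i \<le> k \<and> k < i + n then i + \<beta> (k - i) else k)"

locale symmetric_two_multicategory = two_multicategory M
  for M :: "('o, 'm, 'c, 'x) sym_two_multicat_scheme" +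
  assumes act_functor: "set Xs \<subseteq> Obj M \<Longrightarrow> Y \<in> Obj M \<Longrightarrow> \<alpha> permutes {..<length Xs} \<Longrightarrow>
      is_functor (Hom M Xs Y) (Hom M (permute_list \<alpha> Xs) Y) \<lparr>FOb = act1 M \<alpha>, FAr = act2 M \<alpha>\<rparr>"
    and act1_id: "f \<in> Mor M \<Longrightarrow> act1 M id f = f"
    and act2_id: "\<mu> \<in> Cell M \<Longrightarrow> act2 M id \<mu> = \<mu>"
    and act1_comp: "f \<in> Mor M \<Longrightarrow> \<alpha> permutes {..<arity M f} \<Longrightarrow> \<beta> permutes {..<arity M f} \<Longrightarrow>
      act1 M \<beta> (act1 M \<alpha> f) = act1 M (\<alpha> \<circ> \<beta>) f"
    and act2_comp: "\<mu> \<in> Cell M \<Longrightarrow> \<alpha> permutes {..<arity2 M \<mu>} \<Longrightarrow> \<beta> permutes {..<arity2 M \<mu>} \<Longrightarrow>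
      act2 M \<beta> (act2 M \<alpha> \<mu>) = act2 M (\<alpha> \<circ> \<beta>) \<mu>"
    and outer1: "\<alpha> permutes {..<arity M g} \<Longrightarrow> j < arity M g \<Longrightarrow> composable M (\<alpha> j) g f \<Longrightarrow>
      comp1 M j (act1 M \<alpha> g) f =
        act1 M (outer_perm (arity M g) (arity M f) j \<alpha>) (comp1 M (\<alpha> j) g f)"
    and outer2: "\<alpha> permutes {..<arity2 M \<nu>} \<Longrightarrow> j < arity2 M \<nu> \<Longrightarrow> composable2 M (\<alpha> j) \<nu> \<mu> \<Longrightarrow>
      comp2 M j (act2 M \<alpha> \<nu>) \<mu> =
        act2 M (outer_perm (arity2 M \<nu>) (arity2 M \<mu>) j \<alpha>) (comp2 M (\<alpha> j) \<nu> \<mu>)"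
    and inner1: "\<beta> permutes {..<arity M f} \<Longrightarrow> composable M i g f \<Longrightarrow>
      comp1 M i g (act1 M \<beta> f) = act1 M (inner_perm i (arity M f) \<beta>) (comp1 M i g f)"
    and inner2: "\<beta> permutes {..<arity2 M \<mu>} \<Longrightarrow> composable2 M i \<nu> \<mu> \<Longrightarrow>
      comp2 M i \<nu> (act2 M \<beta> \<mu>) = act2 M (inner_perm i (arity2 M \<mu>) \<beta>) (comp2 M i \<nu> \<mu>)"

definition all_cells_invertible :: "('o, 'm, 'c, 'x) two_multicat_scheme \<Rightarrow> bool" where
  "all_cells_invertible M \<longleftrightarrow> (\<forall>\<mu> \<in> Cell M. is_iso (Hom_of M (dom2 M \<mu>)) \<mu>)"

definition core :: "('o, 'm, 'c, 'x) two_multicat_scheme \<Rightarrow> ('o, 'm, 'c, 'x) two_multicat_scheme" where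
  "core M = M\<lparr>Cell := {\<mu> \<in> Cell M. is_iso (Hom_of M (dom2 M \<mu>)) \<mu>}\<rparr>"

definition equivalent :: "('o, 'm, 'c, 'x) two_multicat_scheme \<Rightarrow> 'o \<Rightarrow> 'o \<Rightarrow> bool" where
  "equivalent M X Y \<longleftrightarrow> X \<in> Obj M \<and> Y \<in> Obj M \<and>
    (\<exists>e \<in> Ob (Hom M [X] Y). \<exists>e' \<in> Ob (Hom M [Y] X).
      isomorphic (Hom M [X] X) (comp1 M 0 e' e) (id1 M X) \<and>
      isomorphic (Hom M [Y] Y) (comp1 M 0 e e') (id1 M Y))"


section \<open>Strict functors and pseudo-functors\<close>

record ('o, 'm, 'c, 'o1, 'm1, 'c1) mfunctor_data =
  on_obj :: "'o \<Rightarrow> 'o1"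
  on_mor :: "'m \<Rightarrow> 'm1"
  on_cell :: "'c \<Rightarrow> 'c1"

definition hom_functor ::
    "('o, 'm, 'c, 'o1, 'm1, 'c1, 'z) mfunctor_data_scheme \<Rightarrow> ('m, 'c, 'm1, 'c1) functor_data" where
  "hom_functor F = \<lparr>FOb = on_mor F, FAr = on_cell F\<rparr>"

locale strict_functor =
  fixes M :: "('o, 'm, 'c, 'x) two_multicat_scheme"
    and N :: "('o1, 'm1, 'c1, 'y) two_multicat_scheme"
    and F :: "('o, 'm, 'c, 'o1, 'm1, 'c1) mfunctor_data"
  assumes obj: "X \<in> Obj M \<Longrightarrow> on_obj F X \<in> Obj N"
    and hom: "set Xs \<subseteq> Obj M \<Longrightarrow> Y \<in> Obj M \<Longrightarrow>
      is_functor (Hom M Xs Y) (Hom N (map (on_obj F) Xs) (on_obj F Y)) (hom_functor F)"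
    and id: "X \<in> Obj M \<Longrightarrow> on_mor F (id1 M X) = id1 N (on_obj F X)"
    and comp1: "composable M i g f \<Longrightarrow>
      on_mor F (comp1 M i g f) = comp1 N i (on_mor F g) (on_mor F f)"
    and comp2: "composable2 M i \<nu> \<mu> \<Longrightarrow>
      on_cell F (comp2 M i \<nu> \<mu>) = comp2 N i (on_cell F \<nu>) (on_cell F \<mu>)"

locale symmetric_strict_functor = strict_functor M N F
  for M :: "('o, 'm, 'c, 'x) sym_two_multicat_scheme"
    and N :: "('o1, 'm1, 'c1, 'y) sym_two_multicat_scheme"
    and F :: "('o, 'm, 'c, 'o1, 'm1, 'c1) mfunctor_data" +
  assumes act1: "f \<in> Mor M \<Longrightarrow> \<alpha> permutes {..<arity M f} \<Longrightarrow>
      on_mor F (act1 M \<alpha> f) = act1 N \<alpha> (on_mor F f)"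
    and act2: "\<mu> \<in> Cell M \<Longrightarrow> \<alpha> permutes {..<arity2 M \<mu>} \<Longrightarrow>
      on_cell F (act2 M \<alpha> \<mu>) = act2 N \<alpha> (on_cell F \<mu>)"

text \<open>Structure isomorphisms of a pseudo-functor: \<open>unit_iso F X : F(id\<^sub>X) \<rightarrow> id\<^bsub>F X\<^esub>\<close> and
  \<open>comp_iso F i g f : F g \<circ>\<^sub>i F f \<rightarrow> F (g \<circ>\<^sub>i f)\<close>.\<close>

record ('o, 'm, 'c, 'o1, 'm1, 'c1) pseudo_functor_data = "('o, 'm, 'c, 'o1, 'm1, 'c1) mfunctor_data" +
  unit_iso :: "'o \<Rightarrow> 'c1"
  comp_iso :: "nat \<Rightarrow> 'm \<Rightarrow> 'm \<Rightarrow> 'c1"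

locale pseudo_functor =
  fixes M :: "('o, 'm, 'c, 'x) two_multicat_scheme"
    and N :: "('o1, 'm1, 'c1, 'y) two_multicat_scheme"
    and F :: "('o, 'm, 'c, 'o1, 'm1, 'c1) pseudo_functor_data"
  assumes obj: "X \<in> Obj M \<Longrightarrow> on_obj F X \<in> Obj N"
    and hom: "set Xs \<subseteq> Obj M \<Longrightarrow> Y \<in> Obj M \<Longrightarrow>
      is_functor (Hom M Xs Y) (Hom N (map (on_obj F) Xs) (on_obj F Y)) (hom_functor F)"
    and unit_iso: "X \<in> Obj M \<Longrightarrow>
      unit_iso F X \<in> isos (Hom N [on_obj F X] (on_obj F X)) (on_mor F (id1 M X)) (id1 N (on_obj F X))"
    and comp_iso: "composable M i g f \<Longrightarrow>
      comp_iso F i g f \<in> isos (Hom_of N (on_mor F (comp1 M i g f)))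
        (comp1 N i (on_mor F g) (on_mor F f)) (on_mor F (comp1 M i g f))"
    and natural: "composable2 M i \<nu> \<mu> \<Longrightarrow>
      vcomp N (on_cell F (comp2 M i \<nu> \<mu>)) (comp_iso F i (dom2 M \<nu>) (dom2 M \<mu>)) =
      vcomp N (comp_iso F i (cod2 M \<nu>) (cod2 M \<mu>)) (comp2 N i (on_cell F \<nu>) (on_cell F \<mu>))"
    and assoc: "composable M j h g \<Longrightarrow> composable M i g f \<Longrightarrow>
      vcomp N (comp_iso F j h (comp1 M i g f)) (comp2 N j (id2 N (on_mor F h)) (comp_iso F i g f)) =
      vcomp N (comp_iso F (j + i) (comp1 M j h g) f)
        (comp2 N (j + i) (comp_iso F j h g) (id2 N (on_mor F f)))"
    and slots: "i < j \<Longrightarrow> composable M i h f \<Longrightarrow> composable M j h g \<Longrightarrow>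
      vcomp N (comp_iso F i (comp1 M j h g) f)
        (comp2 N i (comp_iso F j h g) (id2 N (on_mor F f))) =
      vcomp N (comp_iso F (j + arity M f - 1) (comp1 M i h f) g)
        (comp2 N (j + arity M f - 1) (comp_iso F i h f) (id2 N (on_mor F g)))"
    and left_unit: "f \<in> Mor M \<Longrightarrow>
      comp_iso F 0 (id1 M (tgt M f)) f = comp2 N 0 (unit_iso F (tgt M f)) (id2 N (on_mor F f))"
    and right_unit: "f \<in> Mor M \<Longrightarrow> i < arity M f \<Longrightarrow>
      comp_iso F i f (id1 M (src M f ! i)) =
        comp2 N i (id2 N (on_mor F f)) (unit_iso F (src M f ! i))"


section \<open>The final 2-multicategory\<close>

text \<open>Its unique \<open>n\<close>-ary 1-morphism and the identity of the latter are both represented by \<open>n\<close>.\<close>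

definition point :: "(unit, nat, nat) two_multicat" where
  "point =
    \<lparr>Obj = UNIV, Mor = UNIV, Cell = UNIV,
     src = (\<lambda>n. replicate n ()), tgt = (\<lambda>n. ()),
     dom2 = (\<lambda>n. n), cod2 = (\<lambda>n. n), id2 = (\<lambda>n. n), vcomp = (\<lambda>n m. m),
     id1 = (\<lambda>x. 1), comp1 = (\<lambda>i n m. n + m - 1), comp2 = (\<lambda>i n m. n + m - 1)\<rparr>"

definition to_point ::
    "('o, 'm, 'c, 'x) two_multicat_scheme \<Rightarrow> ('o, 'm, 'c, unit, nat, nat) mfunctor_data" where
  "to_point M = \<lparr>on_obj = (\<lambda>X. ()), on_mor = arity M, on_cell = arity2 M\<rparr>"


section \<open>Fibrations of 2-multicategories\<close>

definition precomp ::
    "('o, 'm, 'c, 'x) two_multicat_scheme \<Rightarrow> nat \<Rightarrow> 'm \<Rightarrow> ('m, 'c, 'm, 'c) functor_data" where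
  "precomp M i f = \<lparr>FOb = (\<lambda>g. comp1 M i g f), FAr = (\<lambda>\<nu>. comp2 M i \<nu> (id2 M f))\<rparr>"

definition postcomp ::
    "('o, 'm, 'c, 'x) two_multicat_scheme \<Rightarrow> nat \<Rightarrow> 'm \<Rightarrow> ('m, 'c, 'm, 'c) functor_data" where
  "postcomp M i g = \<lparr>FOb = (\<lambda>f. comp1 M i g f), FAr = (\<lambda>\<mu>. comp2 M i (id2 M g) \<mu>)\<rparr>"

definition cocartesian ::
    "('o, 'm, 'c, 'x) two_multicat_scheme \<Rightarrow> ('o1, 'm1, 'c1, 'y) two_multicat_scheme
      \<Rightarrow> ('o, 'm, 'c, 'o1, 'm1, 'c1) mfunctor_data \<Rightarrow> 'm \<Rightarrow> bool" where
  "cocartesian D S p \<xi> \<longleftrightarrow> \<xi> \<in> Mor D \<and>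
    (\<forall>i Fs G. set Fs \<subseteq> Obj D \<and> G \<in> Obj D \<and> i < length Fs \<and> Fs ! i = tgt D \<xi> \<longrightarrow>
      two_cartesian
        (Hom D Fs G)
        (Hom D (subst_slot i (src D \<xi>) Fs) G)
        (Hom S (map (on_obj p) Fs) (on_obj p G))
        (Hom S (map (on_obj p) (subst_slot i (src D \<xi>) Fs)) (on_obj p G))
        (precomp D i \<xi>) (hom_functor p) (hom_functor p) (precomp S i (on_mor p \<xi>)))"

definition cartesian ::
    "('o, 'm, 'c, 'x) two_multicat_scheme \<Rightarrow> ('o1, 'm1, 'c1, 'y) two_multicat_scheme
      \<Rightarrow> ('o, 'm, 'c, 'o1, 'm1, 'c1) mfunctor_data \<Rightarrow> nat \<Rightarrow> 'm \<Rightarrow> bool" where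
  "cartesian D S p i \<xi> \<longleftrightarrow> \<xi> \<in> Mor D \<and> i < arity D \<xi> \<and>
    (\<forall>Gs. set Gs \<subseteq> Obj D \<longrightarrow>
      two_cartesian
        (Hom D Gs (src D \<xi> ! i))
        (Hom D (subst_slot i Gs (src D \<xi>)) (tgt D \<xi>))
        (Hom S (map (on_obj p) Gs) (on_obj p (src D \<xi> ! i)))
        (Hom S (map (on_obj p) (subst_slot i Gs (src D \<xi>))) (on_obj p (tgt D \<xi>)))
        (postcomp D i \<xi>) (hom_functor p) (hom_functor p) (postcomp S i (on_mor p \<xi>)))"

definition cocartesian_lift ::
    "('o, 'm, 'c, 'x) two_multicat_scheme \<Rightarrow> ('o1, 'm1, 'c1, 'y) two_multicat_scheme
      \<Rightarrow> ('o, 'm, 'c, 'o1, 'm1, 'c1) mfunctor_data \<Rightarrow> 'm1 \<Rightarrow> 'o list \<Rightarrow> 'm \<Rightarrow> bool" where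
  "cocartesian_lift D S p f Es \<xi> \<longleftrightarrow>
    cocartesian D S p \<xi> \<and> on_mor p \<xi> = f \<and> src D \<xi> = Es"

text \<open>\<open>Es j\<close> prescribes the source in the slots \<open>j \<noteq> i\<close>.\<close>

definition cartesian_lift ::
    "('o, 'm, 'c, 'x) two_multicat_scheme \<Rightarrow> ('o1, 'm1, 'c1, 'y) two_multicat_scheme
      \<Rightarrow> ('o, 'm, 'c, 'o1, 'm1, 'c1) mfunctor_data \<Rightarrow> nat \<Rightarrow> 'm1 \<Rightarrow> (nat \<Rightarrow> 'o) \<Rightarrow> 'o \<Rightarrow> 'm \<Rightarrow> bool" where
  "cartesian_lift D S p i f Es F \<xi> \<longleftrightarrow>
    cartesian D S p i \<xi> \<and> on_mor p \<xi> = f \<and> tgt D \<xi> = F \<and>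
    (\<forall>j < arity D \<xi>. j \<noteq> i \<longrightarrow> src D \<xi> ! j = Es j)"

definition one_opfibered ::
    "('o, 'm, 'c, 'x) two_multicat_scheme \<Rightarrow> ('o1, 'm1, 'c1, 'y) two_multicat_scheme
      \<Rightarrow> ('o, 'm, 'c, 'o1, 'm1, 'c1) mfunctor_data \<Rightarrow> bool" where
  "one_opfibered D S p \<longleftrightarrow>
    (\<forall>f \<in> Mor S. \<forall>Es. set Es \<subseteq> Obj D \<and> map (on_obj p) Es = src S f \<longrightarrow>
      (\<exists>\<xi>. cocartesian_lift D S p f Es \<xi>))"

definition one_fibered ::
    "('o, 'm, 'c, 'x) two_multicat_scheme \<Rightarrow> ('o1, 'm1, 'c1, 'y) two_multicat_scheme
      \<Rightarrow> ('o, 'm, 'c, 'o1, 'm1, 'c1) mfunctor_data \<Rightarrow> bool" where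
  "one_fibered D S p \<longleftrightarrow>
    (\<forall>f \<in> Mor S. \<forall>i < arity S f. \<forall>Es. \<forall>F \<in> Obj D. on_obj p F = tgt S f \<and>
      (\<forall>j < arity S f. j \<noteq> i \<longrightarrow> Es j \<in> Obj D \<and> on_obj p (Es j) = src S f ! j) \<longrightarrow>
      (\<exists>\<xi>. cartesian_lift D S p i f Es F \<xi>))"

definition one_bifibered ::
    "('o, 'm, 'c, 'x) two_multicat_scheme \<Rightarrow> ('o1, 'm1, 'c1, 'y) two_multicat_scheme
      \<Rightarrow> ('o, 'm, 'c, 'o1, 'm1, 'c1) mfunctor_data \<Rightarrow> bool" where
  "one_bifibered D S p \<longleftrightarrow> one_opfibered D S p \<and> one_fibered D S p"

definition two_fibered ::
    "('o, 'm, 'c, 'x) two_multicat_scheme \<Rightarrow> ('o1, 'm1, 'c1, 'y) two_multicat_scheme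
      \<Rightarrow> ('o, 'm, 'c, 'o1, 'm1, 'c1) mfunctor_data \<Rightarrow> bool" where
  "two_fibered D S p \<longleftrightarrow>
    (\<forall>Es F. set Es \<subseteq> Obj D \<and> F \<in> Obj D \<longrightarrow>
      fibration (Hom D Es F) (Hom S (map (on_obj p) Es) (on_obj p F)) (hom_functor p)) \<and>
    (\<forall>i \<nu> \<mu>. composable2 D i \<nu> \<mu> \<and>
      cartesian_arrow (Hom_of D (dom2 D \<nu>)) (Hom_of S (on_mor p (dom2 D \<nu>))) (hom_functor p) \<nu> \<and>
      cartesian_arrow (Hom_of D (dom2 D \<mu>)) (Hom_of S (on_mor p (dom2 D \<mu>))) (hom_functor p) \<mu> \<longrightarrow>
      cartesian_arrow (Hom_of D (dom2 D (comp2 D i \<nu> \<mu>)))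
        (Hom_of S (on_mor p (dom2 D (comp2 D i \<nu> \<mu>)))) (hom_functor p) (comp2 D i \<nu> \<mu>))"

text \<open>Since every arrow of a groupoid is Cartesian, the second clause of \<open>two_fibered\<close> is automatic
  for the cores of 2-multicategories.\<close>

definition two_isofibered ::
    "('o, 'm, 'c, 'x) two_multicat_scheme \<Rightarrow> ('o1, 'm1, 'c1, 'y) two_multicat_scheme
      \<Rightarrow> ('o, 'm, 'c, 'o1, 'm1, 'c1) mfunctor_data \<Rightarrow> bool" where
  "two_isofibered D S p \<longleftrightarrow> two_fibered (core D) (core S) p"

definition fiber ::
    "('o, 'm, 'c, 'x) two_multicat_scheme \<Rightarrow> ('o1, 'm1, 'c1, 'y) two_multicat_scheme
      \<Rightarrow> ('o, 'm, 'c, 'o1, 'm1, 'c1) mfunctor_data \<Rightarrow> 'o1 \<Rightarrow> ('o, 'm, 'c, 'x) two_multicat_scheme" where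
  "fiber D S p S0 = D
    \<lparr>Obj := {X \<in> Obj D. on_obj p X = S0},
     Mor := {f \<in> Mor D. arity D f = 1 \<and> on_mor p f = id1 S S0},
     Cell := {\<mu> \<in> Cell D. arity2 D \<mu> = 1 \<and> on_cell p \<mu> = id2 S (id1 S S0)}\<rparr>"

definition is_pushforward ::
    "('o, 'm, 'c, 'x) two_multicat_scheme \<Rightarrow> ('o1, 'm1, 'c1, 'y) two_multicat_scheme
      \<Rightarrow> ('o, 'm, 'c, 'o1, 'm1, 'c1) mfunctor_data \<Rightarrow> 'm1 \<Rightarrow> 'o list \<Rightarrow> 'o \<Rightarrow> bool" where
  "is_pushforward D S p f Es X \<longleftrightarrow> (\<exists>\<xi>. cocartesian_lift D S p f Es \<xi> \<and> tgt D \<xi> = X)"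

definition is_pullback ::
    "('o, 'm, 'c, 'x) two_multicat_scheme \<Rightarrow> ('o1, 'm1, 'c1, 'y) two_multicat_scheme
      \<Rightarrow> ('o, 'm, 'c, 'o1, 'm1, 'c1) mfunctor_data \<Rightarrow> nat \<Rightarrow> 'm1 \<Rightarrow> (nat \<Rightarrow> 'o) \<Rightarrow> 'o \<Rightarrow> 'o \<Rightarrow> bool" where
  "is_pullback D S p i f Es F X \<longleftrightarrow>
    (\<exists>\<xi>. cartesian_lift D S p i f Es F \<xi> \<and> src D \<xi> ! i = X)"


lemma two_multicategory_point: "two_multicategory point"
proof
  fix Xs Ys :: "unit list" and Z :: unit and i :: nat
  assume "i < length Ys"
  then show "is_functor (prod_cat (Hom point Xs (Ys ! i)) (Hom point Ys Z))
    (Hom point (subst_slot i Xs Ys) Z)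
    \<lparr>FOb = (\<lambda>(f, g). comp1 point i g f), FAr = (\<lambda>(\<mu>, \<nu>). comp2 point i \<nu> \<mu>)\<rparr>"
    by (auto simp: is_functor_def prod_cat_def Hom_def hom_def point_def subst_slot_def
        list_eq_iff_nth_eq)
qed (auto simp: point_def Hom_def hom_def category_def composable_def composable2_def
    arity_def arity2_def)

lemma (in two_multicategory) src_comp1:
  assumes "composable M i g f"
  shows "src M (comp1 M i g f) = subst_slot i (src M f) (src M g)"
    and "tgt M (comp1 M i g f) = tgt M g" and "comp1 M i g f \<in> Mor M"
proof -
  have *: "set (src M f) \<subseteq> Obj M" "set (src M g) \<subseteq> Obj M" "tgt M g \<in> Obj M" "i < length (src M g)"
    using assms mor by (auto simp: composable_def arity_def)
  show "src M (comp1 M i g f) = subst_slot i (src M f) (src M g)"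
    and "tgt M (comp1 M i g f) = tgt M g" and "comp1 M i g f \<in> Mor M"
    using comp_functor[OF *] assms by (auto simp: composable_def is_functor_def prod_cat_def Hom_def)
qed

lemma (in two_multicategory) dom2_comp2:
  assumes "composable2 M i \<nu> \<mu>"
  shows "dom2 M (comp2 M i \<nu> \<mu>) = comp1 M i (dom2 M \<nu>) (dom2 M \<mu>)"
proof -
  have *: "set (src M (dom2 M \<mu>)) \<subseteq> Obj M" "set (src M (dom2 M \<nu>)) \<subseteq> Obj M"
    "tgt M (dom2 M \<nu>) \<in> Obj M" "i < length (src M (dom2 M \<nu>))"
    using assms mor by (auto simp: composable_def composable2_def arity_def)
  show ?thesis
    using comp_functor[OF *] assms
    by (auto simp: composable_def composable2_def is_functor_def prod_cat_def Hom_def hom_def)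
qed

lemma (in two_multicategory) strict_functor_to_point: "strict_functor M point (to_point M)"
proof
  fix Xs Y assume "set Xs \<subseteq> Obj M" "Y \<in> Obj M"
  then interpret category "Hom M Xs Y" by (rule Hom_category)
  show "is_functor (Hom M Xs Y) (Hom point (map (on_obj (to_point M)) Xs) (on_obj (to_point M) Y))
      (hom_functor (to_point M))"
    unfolding is_functor_def
  proof (intro conjI ballI impI)
    fix u v assume "u \<in> Ar (Hom M Xs Y)" "v \<in> Ar (Hom M Xs Y)" "Cod (Hom M Xs Y) u = Dom (Hom M Xs Y) v"
    then have "Comp (Hom M Xs Y) v u \<in> hom (Hom M Xs Y) (Dom (Hom M Xs Y) u) (Cod (Hom M Xs Y) v)"
      by (intro comp_hom) (auto simp: hom_def)
    then show "FAr (hom_functor (to_point M)) (Comp (Hom M Xs Y) v u) =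
        Comp (Hom point (map (on_obj (to_point M)) Xs) (on_obj (to_point M) Y))
          (FAr (hom_functor (to_point M)) v) (FAr (hom_functor (to_point M)) u)"
      by (auto simp: hom_functor_def to_point_def point_def Hom_def hom_def arity2_def)
  next
    fix x assume "x \<in> Ob (Hom M Xs Y)"
    then have "Id (Hom M Xs Y) x \<in> hom (Hom M Xs Y) x x" by (rule id_hom)
    then show "FAr (hom_functor (to_point M)) (Id (Hom M Xs Y) x) =
        Id (Hom point (map (on_obj (to_point M)) Xs) (on_obj (to_point M) Y))
          (FOb (hom_functor (to_point M)) x)"
      by (auto simp: hom_functor_def to_point_def point_def Hom_def hom_def arity2_def)
  qed (auto simp: hom_functor_def to_point_def point_def Hom_def hom_def arity2_def arity_def
      map_replicate_const dest: cell)
qed (use id1 in \<open>auto simp: to_point_def point_def arity_def arity2_def src_comp1 dom2_comp2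
    subst_slot_def composable_def composable2_def\<close>)

end

theory Submission
  imports Defs
begin

text \<open>If \<open>\<xi>\<close> and \<open>p \<xi> = \<tau>\<close> are both coCartesian over \<open>{\<cdot>}\<close>, then both horizontal functors in the
  squares of \<open>\<xi>\<close> over \<open>p\<close> are equivalences, so \<open>\<xi>\<close> is coCartesian over \<open>\<tau>\<close>. Pasting with a
  coCartesian 1-morphism over \<open>\<Delta>\<close> shows that \<open>(\<E>, \<F>) \<rightarrow> \<E> \<boxtimes> \<F> \<rightarrow> \<Delta>\<^sub>\<bullet>(\<E> \<boxtimes> \<F>)\<close> is
  coCartesian over \<open>\<Delta> \<circ> \<tau>\<close>, which is isomorphic to the 1-morphism defining \<open>\<otimes>\<close>. Targets of
  coCartesian 1-morphisms with equal sources over isomorphic 1-morphisms are equivalent, and the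
  isofibration condition moves the equivalence strictly into the fiber. The statement for
  \<open>\<H>\<O>\<M>\<close> is dual.\<close>

section \<open>Weak equivalences and 2-pullbacks of categories\<close>

text \<open>Two strictness problems shape the proof. The equivalence must live in
  \<open>fiber D S p S0\<close>, whose 1-morphisms and 2-morphisms lie over identities on the nose,
  while a 2-Cartesian square returns data only up to isomorphism. Moreover the composite through the
  external product and the 1-morphism defining the internal one lie over different, merely
  isomorphic 1-morphisms of \<open>S\<close>. The first problem is solved by lifting 2-isomorphisms
  along \<open>p\<close>; this works in all Hom categories because invertibility of 2-morphisms
  makes \<open>D\<close> and \<open>S\<close> equal to their cores. The second is solved by choosing
  the two comparison 1-morphisms together with 2-isomorphisms over mutually inverse \<nu> and
  \<nu>', so that the base components of both round trips cancel to an identity. CoCartesian and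
  Cartesian 1-morphisms enter only as given data, so their squares are exploited solely through
  objects found up to isomorphism and through unique fillers of arrows; no quasi-inverse functor has
  to be constructed.\<close>

context category
begin

lemma hom_Ob: "u \<in> hom C x y \<Longrightarrow> x \<in> Ob C" "u \<in> hom C x y \<Longrightarrow> y \<in> Ob C"
  using dom_cod by (auto simp: hom_def)

lemma isosI:
  assumes "u \<in> hom C x y" "v \<in> hom C y x" "Comp C v u = Id C x" "Comp C u v = Id C y"
  shows "u \<in> isos C x y"
  using assms by (auto simp: isos_def is_iso_def hom_def)

lemma isosE:
  assumes "u \<in> isos C x y"
  obtains v where "v \<in> isos C y x" "Comp C v u = Id C x" "Comp C u v = Id C y"
proof -
  obtain v where v: "v \<in> hom C y x" "Comp C v u = Id C x" "Comp C u v = Id C y"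
    using assms by (auto simp: isos_def is_iso_def hom_def)
  moreover have "u \<in> hom C x y" using assms by (simp add: isos_def)
  ultimately show ?thesis using that isosI by blast
qed

lemma isos_hom: "u \<in> isos C x y \<Longrightarrow> u \<in> hom C x y"
  by (auto simp: isos_def)

lemma isos_id: "x \<in> Ob C \<Longrightarrow> Id C x \<in> isos C x x"
  by (metis isosI id_hom comp_id)

lemma isos_comp:
  assumes "u \<in> isos C x y" "v \<in> isos C y z"
  shows "Comp C v u \<in> isos C x z"
proof -
  obtain u' where u': "u' \<in> isos C y x" "Comp C u' u = Id C x" "Comp C u u' = Id C y"
    using isosE[OF assms(1)] .
  obtain v' where v': "v' \<in> isos C z y" "Comp C v' v = Id C y" "Comp C v v' = Id C z"
    using isosE[OF assms(2)] .
  note h = isos_hom[OF assms(1)] isos_hom[OF assms(2)] isos_hom[OF u'(1)] isos_hom[OF v'(1)]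
  show ?thesis
  proof (rule isosI)
    show "Comp C v u \<in> hom C x z" "Comp C u' v' \<in> hom C z x" using h comp_hom by blast+
    have "Comp C v' (Comp C v u) = u"
      using comp_assoc[OF h(1,2,4)] v'(2) id_comp[OF h(1)] by simp
    then show "Comp C (Comp C u' v') (Comp C v u) = Id C x"
      using comp_assoc[OF comp_hom[OF h(1,2)] h(4,3)] u'(2) by simp
    have "Comp C u (Comp C u' v') = v'"
      using comp_assoc[OF h(4,3,1)] u'(3) id_comp[OF h(4)] by simp
    then show "Comp C (Comp C v u) (Comp C u' v') = Id C z"
      using comp_assoc[OF comp_hom[OF h(4,3)] h(1,2)] v'(3) by simp
  qed
qed

lemma isos_cancel_left:
  assumes "w \<in> isos C y z" "u \<in> hom C x y" "v \<in> hom C x y" "Comp C w u = Comp C w v"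
  shows "u = v"
proof -
  obtain w' where w': "w' \<in> isos C z y" "Comp C w' w = Id C y" using isosE[OF assms(1)] .
  have "u = Comp C w' (Comp C w u)" "v = Comp C w' (Comp C w v)"
    using comp_assoc[OF assms(2) isos_hom[OF assms(1)] isos_hom[OF w'(1)]]
      comp_assoc[OF assms(3) isos_hom[OF assms(1)] isos_hom[OF w'(1)]]
      w'(2) id_comp[OF assms(2)] id_comp[OF assms(3)] by simp_all
  then show ?thesis using assms(4) by simp
qed

lemma isos_cancel_right:
  assumes "w \<in> isos C x y" "u \<in> hom C y z" "v \<in> hom C y z" "Comp C u w = Comp C v w"
  shows "u = v"
proof -
  obtain w' where w': "w' \<in> isos C y x" "Comp C w w' = Id C y" using isosE[OF assms(1)] .
  have "u = Comp C (Comp C u w) w'" "v = Comp C (Comp C v w) w'"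
    using comp_assoc[OF isos_hom[OF w'(1)] isos_hom[OF assms(1)] assms(2)]
      comp_assoc[OF isos_hom[OF w'(1)] isos_hom[OF assms(1)] assms(3)]
      w'(2) comp_id[OF assms(2)] comp_id[OF assms(3)] by simp_all
  then show ?thesis using assms(4) by simp
qed

end

lemma functor_Ob: "is_functor C D F \<Longrightarrow> x \<in> Ob C \<Longrightarrow> FOb F x \<in> Ob D"
  by (auto simp: is_functor_def)

lemma functor_hom:
  "is_functor C D F \<Longrightarrow> u \<in> hom C x y \<Longrightarrow> FAr F u \<in> hom D (FOb F x) (FOb F y)"
  by (auto simp: is_functor_def hom_def)

lemma functor_Id: "is_functor C D F \<Longrightarrow> x \<in> Ob C \<Longrightarrow> FAr F (Id C x) = Id D (FOb F x)"
  by (auto simp: is_functor_def)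

lemma functor_Comp:
  "is_functor C D F \<Longrightarrow> u \<in> hom C x y \<Longrightarrow> v \<in> hom C y z \<Longrightarrow>
    FAr F (Comp C v u) = Comp D (FAr F v) (FAr F u)"
  by (auto simp: is_functor_def hom_def)

lemma functor_isos:
  assumes "is_functor C D F" "category C" "category D" "u \<in> isos C x y"
  shows "FAr F u \<in> isos D (FOb F x) (FOb F y)"
proof -
  interpret C: category C by fact
  interpret D: category D by fact
  obtain v where v: "v \<in> isos C y x" "Comp C v u = Id C x" "Comp C u v = Id C y"
    using C.isosE[OF assms(4)] .
  note h = C.isos_hom[OF assms(4)] C.isos_hom[OF v(1)]
  show ?thesis
    using functor_hom[OF assms(1) h(1)] functor_hom[OF assms(1) h(2)]
      functor_Comp[OF assms(1) h(1,2)] functor_Comp[OF assms(1) h(2,1)]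
      functor_Id[OF assms(1)] C.hom_Ob[OF h(1)] v
    by (intro D.isosI[where v = "FAr F v"]) auto
qed

text \<open>The choice-free content of \<open>is_equivalence\<close>. Functoriality of
  \<open>F\<close> is kept apart, and unique existence packs fullness and faithfulness into the form
  in which fillers are consumed later.\<close>

definition weak_equivalence ::
    "('a, 'b) cat \<Rightarrow> ('c, 'd) cat \<Rightarrow> ('a, 'b, 'c, 'd) functor_data \<Rightarrow> bool" where
  "weak_equivalence A B F \<longleftrightarrow>
    (\<forall>b \<in> Ob B. \<exists>a \<in> Ob A. isomorphic B (FOb F a) b) \<and>
    (\<forall>a \<in> Ob A. \<forall>a' \<in> Ob A. \<forall>u \<in> hom B (FOb F a) (FOb F a').
      \<exists>!t. t \<in> hom A a a' \<and> FAr F t = u)"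

lemma weak_equivalence_ex1:
  assumes "weak_equivalence A B F" "a \<in> Ob A" "a' \<in> Ob A" "u \<in> hom B (FOb F a) (FOb F a')"
  shows "\<exists>!t. t \<in> hom A a a' \<and> FAr F t = u"
  using assms by (simp add: weak_equivalence_def)

text \<open>Naturality ties \<open>t\<close> to its image under \<open>G\<close> after
  \<open>F\<close> by composition with invertible components, so equal images force equal arrows.
  The disjunction serves two uses: in an equivalence, \<open>F\<close> is faithful by the unit and
  \<open>G\<close> by the counit.\<close>

lemma faithful_of_retraction:
  assumes "category A" "category B" "is_functor A B F" "is_functor B A G"
    and "natural_iso A A id_functor (comp_functor G F) \<eta> \<or> natural_iso A A (comp_functor G F) id_functor \<eta>"
    and "t \<in> hom A a a'" "t' \<in> hom A a a'" "FAr F t = FAr F t'"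
  shows "t = t'"
proof -
  interpret A: category A by fact
  have ob: "a \<in> Ob A" "a' \<in> Ob A" using A.hom_Ob assms(6) by auto
  show ?thesis
    using assms(5)
  proof
    assume n: "natural_iso A A id_functor (comp_functor G F) \<eta>"
    have "Comp A (FAr G (FAr F x)) (\<eta> a) = Comp A (\<eta> a') x" if "x \<in> hom A a a'" for x
      using n that by (auto simp: natural_iso_def id_functor_def comp_functor_def hom_def)
    then have "Comp A (\<eta> a') t = Comp A (\<eta> a') t'" using assms(6-8) by metis
    moreover have "\<eta> a' \<in> isos A a' (FOb G (FOb F a'))"
      using n ob(2) by (auto simp: natural_iso_def id_functor_def comp_functor_def)
    ultimately show ?thesis using A.isos_cancel_left assms(6,7) by blast
  next
    assume n: "natural_iso A A (comp_functor G F) id_functor \<eta>"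
    have "Comp A x (\<eta> a) = Comp A (\<eta> a') (FAr G (FAr F x))" if "x \<in> hom A a a'" for x
      using n that by (auto simp: natural_iso_def id_functor_def comp_functor_def hom_def)
    then have "Comp A t (\<eta> a) = Comp A t' (\<eta> a)" using assms(6-8) by metis
    moreover have "\<eta> a \<in> isos A (FOb G (FOb F a)) a"
      using n ob(1) by (auto simp: natural_iso_def id_functor_def comp_functor_def)
    ultimately show ?thesis using A.isos_cancel_right assms(6,7) by blast
  qed
qed

lemma equivalence_imp_weak_equivalence:
  assumes "category A" "category B" "is_equivalence A B F"
  shows "weak_equivalence A B F"
proof -
  interpret A: category A by fact
  interpret B: category B by fact
  obtain G \<eta> \<epsilon> where F: "is_functor A B F" and G: "is_functor B A G"
    and \<eta>: "natural_iso A A id_functor (comp_functor G F) \<eta>"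
    and \<epsilon>: "natural_iso B B (comp_functor F G) id_functor \<epsilon>"
    using assms(3) unfolding is_equivalence_def by blast
  have \<eta>_iso: "\<eta> a \<in> isos A a (FOb G (FOb F a))" if "a \<in> Ob A" for a
    using \<eta> that by (auto simp: natural_iso_def id_functor_def comp_functor_def)
  have \<eta>_nat: "Comp A (FAr G (FAr F t)) (\<eta> a) = Comp A (\<eta> a') t" if "t \<in> hom A a a'" for t a a'
    using \<eta> that by (auto simp: natural_iso_def id_functor_def comp_functor_def hom_def)
  show ?thesis
    unfolding weak_equivalence_def
  proof (intro conjI ballI)
    fix b assume b: "b \<in> Ob B"
    then have "\<epsilon> b \<in> isos B (FOb F (FOb G b)) b"
      using \<epsilon> by (auto simp: natural_iso_def id_functor_def comp_functor_def)
    then show "\<exists>a\<in>Ob A. isomorphic B (FOb F a) b"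
      using functor_Ob[OF G b] by (auto simp: isomorphic_def)
  next
    fix a a' u assume a: "a \<in> Ob A" "a' \<in> Ob A" and u: "u \<in> hom B (FOb F a) (FOb F a')"
    obtain k where k: "k \<in> isos A (FOb G (FOb F a')) a'" "Comp A k (\<eta> a') = Id A a'"
        "Comp A (\<eta> a') k = Id A (FOb G (FOb F a'))"
      using A.isosE[OF \<eta>_iso[OF a(2)]] .
    note h = A.isos_hom[OF \<eta>_iso[OF a(1)]] A.isos_hom[OF \<eta>_iso[OF a(2)]] A.isos_hom[OF k(1)]
      functor_hom[OF G u]
    \<comment> \<open>Naturality of \<eta> leaves no other candidate for a preimage of
      \<open>u\<close>: it has to be \<open>FAr G u\<close> conjugated with \<eta>, where
      \<open>k\<close> inverts \<open>\<eta> a'\<close>.\<close>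
    define t where "t = Comp A k (Comp A (FAr G u) (\<eta> a))"
    have t: "t \<in> hom A a a'" unfolding t_def using h A.comp_hom by blast
    note Ft = functor_hom[OF F t]
    note GFt = functor_hom[OF G Ft]
    have "Comp A (FAr G (FAr F t)) (\<eta> a) = Comp A (\<eta> a') t" by (rule \<eta>_nat[OF t])
    also have "\<dots> = Comp A (FAr G u) (\<eta> a)"
      unfolding t_def using k(3) A.comp_assoc[OF A.comp_hom[OF h(1) h(4)] h(3,2)]
        A.id_comp[OF A.comp_hom[OF h(1) h(4)]] by simp
    finally have "FAr G (FAr F t) = FAr G u"
      using A.isos_cancel_right[OF \<eta>_iso[OF a(1)] GFt h(4)] by simp
    \<comment> \<open>\<open>G\<close> is faithful by \<epsilon>, so it can be cancelled on both
      sides.\<close>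
    then have "FAr F t = u"
      using faithful_of_retraction[OF assms(2,1) G F _ Ft u] \<epsilon> by blast
    then show "\<exists>!t. t \<in> hom A a a' \<and> FAr F t = u"
      using t faithful_of_retraction[OF assms(1,2) F G] \<eta> by blast
  qed
qed

text \<open>Fullness lifts the inverse of the image, and faithfulness turns the two inverse laws in
  \<open>B\<close> into inverse laws in \<open>A\<close>.\<close>

lemma weak_equivalence_reflects_isos:
  assumes "category A" "category B" "is_functor A B F" "weak_equivalence A B F"
    and t: "t \<in> hom A a a'" and Ft: "FAr F t \<in> isos B (FOb F a) (FOb F a')"
  shows "t \<in> isos A a a'"
proof -
  interpret A: category A by fact
  interpret B: category B by fact
  have a: "a \<in> Ob A" "a' \<in> Ob A" using A.hom_Ob t by auto
  obtain u where u: "u \<in> isos B (FOb F a') (FOb F a)" "Comp B u (FAr F t) = Id B (FOb F a)"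
      "Comp B (FAr F t) u = Id B (FOb F a')"
    using B.isosE[OF Ft] .
  obtain r where r: "r \<in> hom A a' a" "FAr F r = u"
    using weak_equivalence_ex1[OF assms(4) a(2,1) B.isos_hom[OF u(1)]] by blast
  have faithful: "x = y" if "x \<in> hom A c d" "y \<in> hom A c d" "FAr F x = FAr F y" for x y c d
    using weak_equivalence_ex1[OF assms(4) A.hom_Ob[OF that(1)] functor_hom[OF assms(3) that(2)]] that
    by blast
  show ?thesis
  proof (rule A.isosI[OF t r(1)])
    show "Comp A r t = Id A a"
      using faithful[OF A.comp_hom[OF t r(1)] A.id_hom[OF a(1)]] functor_Comp[OF assms(3) t r(1)]
        functor_Id[OF assms(3) a(1)] r(2) u by simp
    show "Comp A t r = Id A a'"
      using faithful[OF A.comp_hom[OF r(1) t] A.id_hom[OF a(2)]] functor_Comp[OF assms(3) r(1) t]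
        functor_Id[OF assms(3) a(2)] r(2) u by simp
  qed
qed

section \<open>Triples and squares of functors\<close>

lemma triple_cat_Ob:
  "(b, c, \<nu>) \<in> Ob (triple_cat B C C' \<beta> \<gamma>) \<longleftrightarrow>
    b \<in> Ob B \<and> c \<in> Ob C \<and> \<nu> \<in> isos C' (FOb \<beta> b) (FOb \<gamma> c)"
  by (simp add: triple_cat_def)

lemma triple_cat_hom:
  "x \<in> hom (triple_cat B C C' \<beta> \<gamma>) (b, c, \<nu>) (b', c', \<nu>') \<longleftrightarrow>
    (b, c, \<nu>) \<in> Ob (triple_cat B C C' \<beta> \<gamma>) \<and> (b', c', \<nu>') \<in> Ob (triple_cat B C C' \<beta> \<gamma>) \<and>
    (\<exists>u v. x = ((b, c, \<nu>), (b', c', \<nu>'), u, v) \<and> u \<in> hom B b b' \<and> v \<in> hom C c c' \<and>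
      Comp C' (FAr \<gamma> v) \<nu> = Comp C' \<nu>' (FAr \<beta> u))"
  unfolding hom_def[of "triple_cat B C C' \<beta> \<gamma>"] by (auto simp: triple_cat_def)

text \<open>Required before \<open>equivalence_imp_weak_equivalence\<close> can be applied to the
  comparison functor. The condition with content is closure under composition, where two
  compatibility squares are pasted.\<close>

lemma category_triple_cat:
  assumes "category B" "category C" "category C'" "is_functor B C' \<beta>" "is_functor C C' \<gamma>"
  shows "category (triple_cat B C C' \<beta> \<gamma>)" (is "category ?T")
proof -
  interpret B: category B by fact
  interpret C: category C by fact
  interpret C': category C' by fact
  have T_Comp: "Comp ?T (X', X'', u', v') (X, X', u, v) = (X, X'', Comp B u' u, Comp C v' v)"
    for X X' X'' u u' v v' by (simp add: triple_cat_def)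
  have T_Id: "Id ?T (b, c, \<nu>) = ((b, c, \<nu>), (b, c, \<nu>), Id B b, Id C c)" for b c \<nu>
    by (simp add: triple_cat_def)
  show ?thesis
  proof
    show "Dom ?T x \<in> Ob ?T \<and> Cod ?T x \<in> Ob ?T" if "x \<in> Ar ?T" for x
      using that by (auto simp: triple_cat_def)
    show "Id ?T X \<in> hom ?T X X" if "X \<in> Ob ?T" for X
    proof -
      obtain b c \<nu> where X: "X = (b, c, \<nu>)" by (cases X)
      then have "b \<in> Ob B" "c \<in> Ob C" "\<nu> \<in> hom C' (FOb \<beta> b) (FOb \<gamma> c)"
        using that by (simp_all add: triple_cat_Ob isos_def)
      then show ?thesis
        using that functor_Id[OF assms(4)] functor_Id[OF assms(5)]
        unfolding X T_Id triple_cat_hom by (simp add: C'.id_comp C'.comp_id B.id_hom C.id_hom)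
    qed
  next
    fix x y X Y Z assume x: "x \<in> hom ?T X Y" and y: "y \<in> hom ?T Y Z"
    obtain b c \<nu> b' c' \<nu>' b'' c'' \<nu>'' where X: "X = (b, c, \<nu>)" and Y: "Y = (b', c', \<nu>')"
      and Z: "Z = (b'', c'', \<nu>'')" by (cases X, cases Y, cases Z)
    obtain u v where u: "u \<in> hom B b b'" and v: "v \<in> hom C c c'" and xe: "x = (X, Y, u, v)"
      and uv: "Comp C' (FAr \<gamma> v) \<nu> = Comp C' \<nu>' (FAr \<beta> u)"
      using x unfolding X Y triple_cat_hom by blast
    obtain u' v' where u': "u' \<in> hom B b' b''" and v': "v' \<in> hom C c' c''" and ye: "y = (Y, Z, u', v')"
      and uv': "Comp C' (FAr \<gamma> v') \<nu>' = Comp C' \<nu>'' (FAr \<beta> u')"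
      using y unfolding Y Z triple_cat_hom by blast
    have ob: "X \<in> Ob ?T" "Y \<in> Ob ?T" "Z \<in> Ob ?T"
      using x y unfolding X Y Z triple_cat_hom by blast+
    then have \<nu>: "\<nu> \<in> hom C' (FOb \<beta> b) (FOb \<gamma> c)" "\<nu>' \<in> hom C' (FOb \<beta> b') (FOb \<gamma> c')"
      "\<nu>'' \<in> hom C' (FOb \<beta> b'') (FOb \<gamma> c'')"
      unfolding X Y Z triple_cat_Ob by (auto simp: isos_def)
    note h = functor_hom[OF assms(4) u] functor_hom[OF assms(4) u']
      functor_hom[OF assms(5) v] functor_hom[OF assms(5) v']
    have "Comp C' (FAr \<gamma> (Comp C v' v)) \<nu> = Comp C' (FAr \<gamma> v') (Comp C' \<nu>' (FAr \<beta> u))"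
      using functor_Comp[OF assms(5) v v'] C'.comp_assoc[OF \<nu>(1) h(3,4)] uv by simp
    also have "\<dots> = Comp C' \<nu>'' (FAr \<beta> (Comp B u' u))"
      using functor_Comp[OF assms(4) u u'] C'.comp_assoc[OF h(1) \<nu>(2) h(4)]
        C'.comp_assoc[OF h(1,2) \<nu>(3)] uv' by simp
    finally show "Comp ?T y x \<in> hom ?T X Z"
      using ob B.comp_hom[OF u u'] C.comp_hom[OF v v'] unfolding xe ye T_Comp unfolding X Y Z triple_cat_hom
      by blast
  next
    fix x X Y assume x: "x \<in> hom ?T X Y"
    show "Comp ?T x (Id ?T X) = x" "Comp ?T (Id ?T Y) x = x"
      using x by (cases X; cases Y; auto simp: triple_cat_hom T_Id T_Comp
          B.comp_id B.id_comp C.comp_id C.id_comp)+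
  next
    fix x y z X Y Z W assume "x \<in> hom ?T X Y" "y \<in> hom ?T Y Z" "z \<in> hom ?T Z W"
    then show "Comp ?T z (Comp ?T y x) = Comp ?T (Comp ?T z y) x"
      by (cases X; cases Y; cases Z; cases W; auto simp: triple_cat_hom T_Comp B.comp_assoc C.comp_assoc)
  qed
qed

text \<open>The projections to \<open>B\<close> and \<open>C\<close> respect composition and
  identities, so they carry an inverse of the triple arrow to inverses of its components.\<close>

lemma triple_cat_isosD:
  assumes "((b, c, \<nu>), (b', c', \<nu>'), u, v) \<in> isos (triple_cat B C C' \<beta> \<gamma>) (b, c, \<nu>) (b', c', \<nu>')"
  shows "u \<in> isos B b b'" "v \<in> isos C c c'"
proof -
  let ?x = "((b, c, \<nu>), (b', c', \<nu>'), u, v)" and ?T = "triple_cat B C C' \<beta> \<gamma>"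
  have x: "?x \<in> hom ?T (b, c, \<nu>) (b', c', \<nu>')" using assms by (simp add: isos_def)
  obtain y where y: "y \<in> hom ?T (b', c', \<nu>') (b, c, \<nu>)"
      "Comp ?T y ?x = Id ?T (b, c, \<nu>)" "Comp ?T ?x y = Id ?T (b', c', \<nu>')"
    using assms by (auto simp: isos_def is_iso_def hom_def)
  then obtain u' v' where "y = ((b', c', \<nu>'), (b, c, \<nu>), u', v')" "u' \<in> hom B b' b" "v' \<in> hom C c' c"
    by (auto simp: triple_cat_hom)
  with x y(2,3) show "u \<in> isos B b b'" "v \<in> isos C c c'"
    unfolding triple_cat_hom
    by (auto simp: isos_def is_iso_def hom_def) (auto simp: triple_cat_def)
qed

text \<open>The consequence of \<open>two_cartesian\<close> used here: the comparison functor is essentially surjective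
  and fully faithful.\<close>

definition two_pullback ::
    "('a, 'b) cat \<Rightarrow> ('c, 'd) cat \<Rightarrow> ('e, 'f) cat \<Rightarrow> ('g, 'h) cat
      \<Rightarrow> ('a, 'b, 'c, 'd) functor_data \<Rightarrow> ('c, 'd, 'g, 'h) functor_data
      \<Rightarrow> ('a, 'b, 'e, 'f) functor_data \<Rightarrow> ('e, 'f, 'g, 'h) functor_data \<Rightarrow> bool" where
  "two_pullback A B C C' \<alpha> \<beta> \<delta> \<gamma> \<longleftrightarrow>
    (\<forall>b \<in> Ob B. \<forall>c \<in> Ob C. \<forall>\<nu> \<in> isos C' (FOb \<beta> b) (FOb \<gamma> c).
      \<exists>a \<in> Ob A. \<exists>u \<in> isos B (FOb \<alpha> a) b. \<exists>v \<in> isos C (FOb \<delta> a) c.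
        FAr \<gamma> v = Comp C' \<nu> (FAr \<beta> u)) \<and>
    (\<forall>a \<in> Ob A. \<forall>a' \<in> Ob A.
      \<forall>u \<in> hom B (FOb \<alpha> a) (FOb \<alpha> a'). \<forall>v \<in> hom C (FOb \<delta> a) (FOb \<delta> a').
        FAr \<gamma> v = FAr \<beta> u \<longrightarrow> (\<exists>!t. t \<in> hom A a a' \<and> FAr \<alpha> t = u \<and> FAr \<delta> t = v))"

lemma two_pullback_surj:
  assumes "two_pullback A B C C' \<alpha> \<beta> \<delta> \<gamma>" "b \<in> Ob B" "c \<in> Ob C" "\<nu> \<in> isos C' (FOb \<beta> b) (FOb \<gamma> c)"
  obtains a u v where "a \<in> Ob A" "u \<in> isos B (FOb \<alpha> a) b" "v \<in> isos C (FOb \<delta> a) c"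
    "FAr \<gamma> v = Comp C' \<nu> (FAr \<beta> u)"
  using assms unfolding two_pullback_def by meson

lemma two_pullback_ex1:
  assumes "two_pullback A B C C' \<alpha> \<beta> \<delta> \<gamma>" "a \<in> Ob A" "a' \<in> Ob A"
    "u \<in> hom B (FOb \<alpha> a) (FOb \<alpha> a')" "v \<in> hom C (FOb \<delta> a) (FOb \<delta> a')" "FAr \<gamma> v = FAr \<beta> u"
  shows "\<exists>!t. t \<in> hom A a a' \<and> FAr \<alpha> t = u \<and> FAr \<delta> t = v"
  using assms(1)[unfolded two_pullback_def, THEN conjunct2, rule_format, OF assms(2-6)] .

locale functor_square = A: category A + B: category B + C: category C + C': category C'
  for A :: "('a, 'b) cat" and B :: "('c, 'd) cat" and C :: "('e, 'f) cat" and C' :: "('g, 'h) cat" +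
  fixes \<alpha> \<beta> \<delta> \<gamma>
  assumes \<alpha>: "is_functor A B \<alpha>" and \<beta>: "is_functor B C' \<beta>"
    and \<delta>: "is_functor A C \<delta>" and \<gamma>: "is_functor C C' \<gamma>"
    and square_Ob: "a \<in> Ob A \<Longrightarrow> FOb \<beta> (FOb \<alpha> a) = FOb \<gamma> (FOb \<delta> a)"
    and square_Ar: "t \<in> Ar A \<Longrightarrow> FAr \<beta> (FAr \<alpha> t) = FAr \<gamma> (FAr \<delta> t)"
begin

text \<open>Objects in the image of the comparison functor have an identity as third component.
  Compatibility of an arrow out of such an object therefore loses one factor, and between two of
  them it becomes \<open>FAr \<gamma> v = FAr \<beta> u\<close>.\<close>

lemma two_cartesian_imp_two_pullback:
  assumes "two_cartesian A B C C' \<alpha> \<beta> \<delta> \<gamma>"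
  shows "two_pullback A B C C' \<alpha> \<beta> \<delta> \<gamma>"
proof -
  let ?T = "triple_cat B C C' \<beta> \<gamma>" and ?K = "comparison A C' \<alpha> \<beta> \<delta>"
  have T: "category ?T"
    by (rule category_triple_cat[OF B.category_axioms C.category_axioms C'.category_axioms \<beta> \<gamma>])
  have w: "weak_equivalence A ?T ?K"
    using equivalence_imp_weak_equivalence[OF A.category_axioms T] assms
    by (simp add: two_cartesian_def)
  have K_Ob: "FOb ?K a = (FOb \<alpha> a, FOb \<delta> a, Id C' (FOb \<beta> (FOb \<alpha> a)))" for a
    by (simp add: comparison_def Let_def)
  have K_Ar: "FAr ?K t = (FOb ?K a, FOb ?K a', FAr \<alpha> t, FAr \<delta> t)" if "t \<in> hom A a a'" for t a a'
    using that by (auto simp: comparison_def Let_def hom_def)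
  have \<beta>\<alpha>: "FOb \<beta> (FOb \<alpha> a) \<in> Ob C'" if "a \<in> Ob A" for a
    using that functor_Ob[OF \<beta>] functor_Ob[OF \<alpha>] by blast
  show ?thesis
    unfolding two_pullback_def
  proof (intro conjI ballI impI)
    fix b c \<nu> assume "b \<in> Ob B" "c \<in> Ob C" and \<nu>: "\<nu> \<in> isos C' (FOb \<beta> b) (FOb \<gamma> c)"
    then have "(b, c, \<nu>) \<in> Ob ?T" by (simp add: triple_cat_def)
    then obtain a x where a: "a \<in> Ob A" and x: "x \<in> isos ?T (FOb ?K a) (b, c, \<nu>)"
      using w unfolding weak_equivalence_def isomorphic_def by blast
    then have "x \<in> hom ?T (FOb ?K a) (b, c, \<nu>)" by (simp add: isos_def)
    then obtain u v where xuv: "x = (FOb ?K a, (b, c, \<nu>), u, v)"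
        and uv: "u \<in> hom B (FOb \<alpha> a) b" "v \<in> hom C (FOb \<delta> a) c"
        "Comp C' (FAr \<gamma> v) (Id C' (FOb \<beta> (FOb \<alpha> a))) = Comp C' \<nu> (FAr \<beta> u)"
      by (auto simp: K_Ob triple_cat_hom)
    have "u \<in> isos B (FOb \<alpha> a) b" "v \<in> isos C (FOb \<delta> a) c"
      using triple_cat_isosD x xuv by (auto simp: K_Ob)
    \<comment> \<open>\<open>square_Ob\<close> identifies the object of the identity in
      \<open>uv(3)\<close> with the source of \<open>FAr \<gamma> v\<close>, so the identity is
      absorbed.\<close>
    moreover have "FAr \<gamma> v = Comp C' \<nu> (FAr \<beta> u)"
      using uv(3) functor_hom[OF \<gamma> uv(2)] square_Ob[OF a] C'.comp_id by simp
    ultimately show "\<exists>a\<in>Ob A. \<exists>u\<in>isos B (FOb \<alpha> a) b. \<exists>v\<in>isos C (FOb \<delta> a) c.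
        FAr \<gamma> v = Comp C' \<nu> (FAr \<beta> u)"
      using a by blast
  next
    fix a a' u v
    assume a: "a \<in> Ob A" "a' \<in> Ob A" and u: "u \<in> hom B (FOb \<alpha> a) (FOb \<alpha> a')"
      and v: "v \<in> hom C (FOb \<delta> a) (FOb \<delta> a')" and uv: "FAr \<gamma> v = FAr \<beta> u"
    have "(FOb ?K a, FOb ?K a', u, v) \<in> hom ?T (FOb ?K a) (FOb ?K a')"
      using a u v uv functor_hom[OF \<gamma> v] functor_hom[OF \<beta> u] square_Ob[OF a(1)] square_Ob[OF a(2)]
        C'.isos_id[OF \<beta>\<alpha>[OF a(1)]] C'.isos_id[OF \<beta>\<alpha>[OF a(2)]] functor_Ob[OF \<alpha>] functor_Ob[OF \<delta>]
      by (simp add: K_Ob triple_cat_hom triple_cat_Ob C'.comp_id C'.id_comp)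
    then have "\<exists>!t. t \<in> hom A a a' \<and> FAr ?K t = (FOb ?K a, FOb ?K a', u, v)"
      by (rule weak_equivalence_ex1[OF w a])
    then show "\<exists>!t. t \<in> hom A a a' \<and> FAr \<alpha> t = u \<and> FAr \<delta> t = v"
      by (simp add: K_Ar cong: conj_cong)
  qed
qed

text \<open>\<alpha> supplies \<open>a\<close> and \<open>u\<close>; then \<nu> after
  \<open>FAr \<beta> u\<close> is an isomorphism between objects in the image of \<gamma> and lifts
  to the required \<open>v\<close>. For arrows, \<alpha> alone determines the filler, and
  faithfulness of \<gamma> forces its second component.\<close>

lemma weak_equivalences_imp_two_pullback:
  assumes "weak_equivalence A B \<alpha>" and "weak_equivalence C C' \<gamma>"
  shows "two_pullback A B C C' \<alpha> \<beta> \<delta> \<gamma>"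
  unfolding two_pullback_def
proof (intro conjI ballI impI)
  fix b c \<nu> assume "b \<in> Ob B" "c \<in> Ob C" and \<nu>: "\<nu> \<in> isos C' (FOb \<beta> b) (FOb \<gamma> c)"
  then obtain a u where a: "a \<in> Ob A" and u: "u \<in> isos B (FOb \<alpha> a) b"
    using assms(1) unfolding weak_equivalence_def isomorphic_def by blast
  have "FAr \<beta> u \<in> isos C' (FOb \<gamma> (FOb \<delta> a)) (FOb \<beta> b)"
    using functor_isos[OF \<beta> B.category_axioms C'.category_axioms u] square_Ob[OF a] by simp
  then have iso: "Comp C' \<nu> (FAr \<beta> u) \<in> isos C' (FOb \<gamma> (FOb \<delta> a)) (FOb \<gamma> c)"
    using \<nu> by (rule C'.isos_comp)
  then obtain v where v: "v \<in> hom C (FOb \<delta> a) c" "FAr \<gamma> v = Comp C' \<nu> (FAr \<beta> u)"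
    using weak_equivalence_ex1[OF assms(2) functor_Ob[OF \<delta> a] \<open>c \<in> Ob C\<close> C'.isos_hom[OF iso]]
    by blast
  have "v \<in> isos C (FOb \<delta> a) c"
    using weak_equivalence_reflects_isos[OF C.category_axioms C'.category_axioms \<gamma> assms(2) v(1)]
      v(2) iso by simp
  then show "\<exists>a\<in>Ob A. \<exists>u\<in>isos B (FOb \<alpha> a) b. \<exists>v\<in>isos C (FOb \<delta> a) c. FAr \<gamma> v = Comp C' \<nu> (FAr \<beta> u)"
    using a u v by blast
next
  fix a a' u v
  assume a: "a \<in> Ob A" "a' \<in> Ob A" and u: "u \<in> hom B (FOb \<alpha> a) (FOb \<alpha> a')"
    and v: "v \<in> hom C (FOb \<delta> a) (FOb \<delta> a')" and uv: "FAr \<gamma> v = FAr \<beta> u"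
  have ex: "\<exists>!t. t \<in> hom A a a' \<and> FAr \<alpha> t = u"
    by (rule weak_equivalence_ex1[OF assms(1) a u])
  have "FAr \<delta> t = v" if t: "t \<in> hom A a a'" "FAr \<alpha> t = u" for t
  proof -
    have "FAr \<gamma> (FAr \<delta> t) = FAr \<gamma> v"
      using square_Ar[of t] t uv by (auto simp: hom_def)
    moreover have "\<exists>!w. w \<in> hom C (FOb \<delta> a) (FOb \<delta> a') \<and> FAr \<gamma> w = FAr \<gamma> v"
      by (rule weak_equivalence_ex1[OF assms(2) functor_Ob[OF \<delta> a(1)] functor_Ob[OF \<delta> a(2)]
            functor_hom[OF \<gamma> v]])
    ultimately show ?thesis using v functor_hom[OF \<delta> t(1)] by blast
  qed
  then show "\<exists>!t. t \<in> hom A a a' \<and> FAr \<alpha> t = u \<and> FAr \<delta> t = v" using ex by blast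
qed

text \<open>With \<open>C\<close> and \<open>C'\<close> terminal there is exactly one possible
  \<open>c\<close>, \<nu> and \<open>v\<close>, so the condition on the square becomes a condition
  on \<alpha> alone.\<close>

lemma two_pullback_terminal_imp_weak_equivalence:
  assumes "two_pullback A B C C' \<alpha> \<beta> \<delta> \<gamma>"
    and "Ob C = {c}" "Ar C = {Id C c}" "Ob C' = {c'}" "Ar C' = {Id C' c'}"
  shows "weak_equivalence A B \<alpha>"
  unfolding weak_equivalence_def
proof (intro conjI ballI)
  fix b assume b: "b \<in> Ob B"
  have c: "c \<in> Ob C" using assms(2) by simp
  have "Id C' c' \<in> isos C' (FOb \<beta> b) (FOb \<gamma> c)"
    using functor_Ob[OF \<beta> b] functor_Ob[OF \<gamma> c] C'.isos_id assms(4) by simp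
  then obtain a u where "a \<in> Ob A" "u \<in> isos B (FOb \<alpha> a) b"
    using two_pullback_surj[OF assms(1) b c] by metis
  then show "\<exists>a\<in>Ob A. isomorphic B (FOb \<alpha> a) b"
    by (auto simp: isomorphic_def)
next
  fix a a' u assume a: "a \<in> Ob A" "a' \<in> Ob A" and u: "u \<in> hom B (FOb \<alpha> a) (FOb \<alpha> a')"
  have "FOb \<delta> a = c" "FOb \<delta> a' = c" using functor_Ob[OF \<delta>] a assms(2) by auto
  then have v: "Id C c \<in> hom C (FOb \<delta> a) (FOb \<delta> a')" using C.id_hom assms(2) by simp
  have "FAr \<gamma> (Id C c) \<in> Ar C'" "FAr \<beta> u \<in> Ar C'"
    using functor_hom[OF \<gamma> v] functor_hom[OF \<beta> u] by (auto simp: hom_def)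
  then have "\<exists>!t. t \<in> hom A a a' \<and> FAr \<alpha> t = u \<and> FAr \<delta> t = Id C c"
    using two_pullback_ex1[OF assms(1) a u v] assms(5) by simp
  moreover have "FAr \<delta> t = Id C c" if "t \<in> hom A a a'" for t
    using functor_hom[OF \<delta> that] assms(3) by (auto simp: hom_def)
  ultimately show "\<exists>!t. t \<in> hom A a a' \<and> FAr \<alpha> t = u" by blast
qed

text \<open>Lifting the isomorphism \<open>\<delta> a \<cong> c\<close> along the isofibration \<open>\<delta>\<close> strictifies \<open>\<delta> a\<close> to \<open>c\<close>.\<close>

lemma two_pullback_surj_strict:
  assumes "two_pullback A B C C' \<alpha> \<beta> \<delta> \<gamma>"
    and lift: "\<And>a v. a \<in> Ob A \<Longrightarrow> v \<in> isos C c (FOb \<delta> a) \<Longrightarrow> \<exists>a'. \<exists>u \<in> isos A a' a. FOb \<delta> a' = c \<and> FAr \<delta> u = v"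
    and "b \<in> Ob B" "c \<in> Ob C" "\<nu> \<in> isos C' (FOb \<gamma> c) (FOb \<beta> b)"
  obtains a u where "a \<in> Ob A" "FOb \<delta> a = c" "u \<in> isos B (FOb \<alpha> a) b" "FAr \<beta> u = \<nu>"
proof -
  \<comment> \<open>The given \<nu> runs against the direction used in \<open>two_pullback\<close>,
    so its inverse is fed in and cancelled again in the computation below.\<close>
  obtain \<nu>' where \<nu>': "\<nu>' \<in> isos C' (FOb \<beta> b) (FOb \<gamma> c)" "Comp C' \<nu> \<nu>' = Id C' (FOb \<beta> b)"
    using C'.isosE[OF assms(5)] by metis
  obtain a u v where a: "a \<in> Ob A" and u: "u \<in> isos B (FOb \<alpha> a) b" and v: "v \<in> isos C (FOb \<delta> a) c"
    and uv: "FAr \<gamma> v = Comp C' \<nu>' (FAr \<beta> u)"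
    using two_pullback_surj[OF assms(1,3,4) \<nu>'(1)] .
  \<comment> \<open>\<open>lift\<close> prescribes the codomain of the lift, so the arrow to be
    lifted is the inverse of \<open>v\<close>.\<close>
  obtain v' where v': "v' \<in> isos C c (FOb \<delta> a)" "Comp C v v' = Id C c"
    using C.isosE[OF v] by metis
  obtain a' w where w: "w \<in> isos A a' a" "FOb \<delta> a' = c" "FAr \<delta> w = v'"
    using lift[OF a v'(1)] by blast
  note hw = A.isos_hom[OF w(1)]
  have a': "a' \<in> Ob A" using A.hom_Ob[OF hw] by simp
  note \<alpha>w = functor_isos[OF \<alpha> A.category_axioms B.category_axioms w(1)]
  note h = B.isos_hom[OF u] B.isos_hom[OF \<alpha>w] C'.isos_hom[OF assms(5)] C'.isos_hom[OF \<nu>'(1)]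
    C.isos_hom[OF v] C.isos_hom[OF v'(1)]
  have \<beta>u: "FAr \<beta> u \<in> hom C' (FOb \<gamma> (FOb \<delta> a)) (FOb \<beta> b)"
    using functor_hom[OF \<beta> h(1)] square_Ob[OF a] by simp
  have "FAr \<beta> (Comp B u (FAr \<alpha> w)) = Comp C' (FAr \<beta> u) (FAr \<gamma> v')"
    using functor_Comp[OF \<beta> h(2,1)] square_Ar[of w] hw w(3) by (simp add: hom_def)
  also have "\<dots> = Comp C' (Comp C' (Comp C' \<nu> \<nu>') (FAr \<beta> u)) (FAr \<gamma> v')"
    using \<nu>'(2) C'.id_comp[OF \<beta>u] by simp
  also have "\<dots> = Comp C' \<nu> (Comp C' (Comp C' \<nu>' (FAr \<beta> u)) (FAr \<gamma> v'))"
    using h(3,4) \<beta>u functor_hom[OF \<gamma> h(6)] by (metis C'.comp_assoc C'.comp_hom)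
  also have "\<dots> = \<nu>"
    using uv functor_Comp[OF \<gamma> h(6,5)] functor_Id[OF \<gamma> assms(4)] v'(2) C'.comp_id[OF h(3)] by simp
  finally show ?thesis
    using that[OF a' w(2) B.isos_comp[OF \<alpha>w u]] by simp
qed

end

text \<open>The squares stand side by side, \<open>A \<rightarrow> B \<rightarrow> B'\<close> above
  \<open>C \<rightarrow> D \<rightarrow> D'\<close>. The isomorphism that the right square returns
  in the middle category \<open>D\<close> serves as the comparison isomorphism for the left
  square.\<close>

lemma two_pullback_paste:
  assumes "functor_square A B C D \<alpha> \<beta> \<delta> \<gamma>" and "functor_square B B' D D' \<alpha>' \<beta>' \<beta> \<gamma>'"
    and "two_pullback A B C D \<alpha> \<beta> \<delta> \<gamma>" and "two_pullback B B' D D' \<alpha>' \<beta>' \<beta> \<gamma>'"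
  shows "two_pullback A B' C D' (comp_functor \<alpha>' \<alpha>) \<beta>' \<delta> (comp_functor \<gamma>' \<gamma>)"
proof -
  interpret l: functor_square A B C D \<alpha> \<beta> \<delta> \<gamma> by fact
  interpret r: functor_square B B' D D' \<alpha>' \<beta>' \<beta> \<gamma>' by fact
  show ?thesis
    unfolding two_pullback_def comp_functor_def functor_data.simps o_apply
  proof (intro conjI ballI impI)
    fix b c \<nu> assume b: "b \<in> Ob B'" and c: "c \<in> Ob C"
      and \<nu>: "\<nu> \<in> isos D' (FOb \<beta>' b) (FOb \<gamma>' (FOb \<gamma> c))"
    obtain a1 u1 v1 where a1: "a1 \<in> Ob B" and u1: "u1 \<in> isos B' (FOb \<alpha>' a1) b"
        and v1: "v1 \<in> isos D (FOb \<beta> a1) (FOb \<gamma> c)" and uv1: "FAr \<gamma>' v1 = Comp D' \<nu> (FAr \<beta>' u1)"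
      using two_pullback_surj[OF assms(4) b functor_Ob[OF l.\<gamma> c] \<nu>] .
    obtain a u v where a: "a \<in> Ob A" and u: "u \<in> isos B (FOb \<alpha> a) a1"
        and v: "v \<in> isos C (FOb \<delta> a) c" and uv: "FAr \<gamma> v = Comp D v1 (FAr \<beta> u)"
      using two_pullback_surj[OF assms(3) a1 c v1] .
    note h = l.B.isos_hom[OF u] r.B.isos_hom[OF u1] l.C'.isos_hom[OF v1] r.C'.isos_hom[OF \<nu>]
    note \<alpha>'u = functor_isos[OF r.\<alpha> l.B.category_axioms r.B.category_axioms u]
    have "FAr \<gamma>' (FAr \<gamma> v) = Comp D' (FAr \<gamma>' v1) (FAr \<gamma>' (FAr \<beta> u))"
      using uv functor_Comp[OF r.\<gamma> functor_hom[OF r.\<delta> h(1)] h(3)] by simp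
    also have "\<dots> = Comp D' (Comp D' \<nu> (FAr \<beta>' u1)) (FAr \<beta>' (FAr \<alpha>' u))"
      using uv1 r.square_Ar[of u] h(1) by (simp add: hom_def)
    also have "\<dots> = Comp D' \<nu> (FAr \<beta>' (Comp B' u1 (FAr \<alpha>' u)))"
      using functor_Comp[OF r.\<beta> r.B.isos_hom[OF \<alpha>'u] h(2)] functor_hom[OF r.\<beta> h(2)] h(4)
        functor_hom[OF r.\<beta> r.B.isos_hom[OF \<alpha>'u]] by (simp add: r.C'.comp_assoc)
    finally show "\<exists>a\<in>Ob A. \<exists>u\<in>isos B' (FOb \<alpha>' (FOb \<alpha> a)) b. \<exists>v\<in>isos C (FOb \<delta> a) c.
        FAr \<gamma>' (FAr \<gamma> v) = Comp D' \<nu> (FAr \<beta>' u)"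
      using a v r.B.isos_comp[OF \<alpha>'u u1] by blast
  next
    fix a a' u v
    assume a: "a \<in> Ob A" "a' \<in> Ob A"
      and u: "u \<in> hom B' (FOb \<alpha>' (FOb \<alpha> a)) (FOb \<alpha>' (FOb \<alpha> a'))"
      and v: "v \<in> hom C (FOb \<delta> a) (FOb \<delta> a')" and uv: "FAr \<gamma>' (FAr \<gamma> v) = FAr \<beta>' u"
    \<comment> \<open>The right square is filled first, with \<open>FAr \<gamma> v\<close> as its
      component in \<open>D\<close>; its filler \<open>t1\<close> is then the component in
      \<open>B\<close> for the left square.\<close>
    have \<gamma>v: "FAr \<gamma> v \<in> hom D (FOb \<beta> (FOb \<alpha> a)) (FOb \<beta> (FOb \<alpha> a'))"
      using functor_hom[OF l.\<gamma> v] a l.square_Ob by simp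
    have ex: "\<exists>!t. t \<in> hom B (FOb \<alpha> a) (FOb \<alpha> a') \<and> FAr \<alpha>' t = u \<and> FAr \<beta> t = FAr \<gamma> v"
      using two_pullback_ex1[OF assms(4) _ _ u \<gamma>v uv] functor_Ob[OF l.\<alpha>] a by blast
    then obtain t1 where t1: "t1 \<in> hom B (FOb \<alpha> a) (FOb \<alpha> a')" "FAr \<alpha>' t1 = u" "FAr \<beta> t1 = FAr \<gamma> v"
      by blast
    have ex': "\<exists>!t. t \<in> hom A a a' \<and> FAr \<alpha> t = t1 \<and> FAr \<delta> t = v"
      using two_pullback_ex1[OF assms(3) a t1(1) v] t1(3) by simp
    \<comment> \<open>\<alpha> sends any competitor to a filler of the right square, hence to
      \<open>t1\<close>, so uniqueness in the left square applies.\<close>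
    have "FAr \<alpha> t = t1" if "t \<in> hom A a a'" "FAr \<alpha>' (FAr \<alpha> t) = u" "FAr \<delta> t = v" for t
      using ex t1 functor_hom[OF l.\<alpha> that(1)] l.square_Ar[of t] that by (auto simp: hom_def[of A])
    then show "\<exists>!t. t \<in> hom A a a' \<and> FAr \<alpha>' (FAr \<alpha> t) = u \<and> FAr \<delta> t = v"
      using ex' t1(2) by metis
  qed
qed

text \<open>Functors are records of total functions. Insertion of a composite and the composite of
  two insertions agree only on actual objects and arrows, where associativity is available; that
  agreement suffices.\<close>

lemma two_pullback_cong:
  assumes "two_pullback A B C C' \<alpha> \<beta> \<delta> \<gamma>"
    and "\<And>a. a \<in> Ob A \<Longrightarrow> FOb \<alpha> a = FOb \<alpha>' a" "\<And>t. t \<in> Ar A \<Longrightarrow> FAr \<alpha> t = FAr \<alpha>' t"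
    and "\<And>c. c \<in> Ob C \<Longrightarrow> FOb \<gamma> c = FOb \<gamma>' c" "\<And>v. v \<in> Ar C \<Longrightarrow> FAr \<gamma> v = FAr \<gamma>' v"
  shows "two_pullback A B C C' \<alpha>' \<beta> \<delta> \<gamma>'"
proof -
  have A: "FAr \<alpha> t = FAr \<alpha>' t" if "t \<in> hom A a a'" for t a a'
    using that assms(3) by (simp add: hom_def)
  have C: "FAr \<gamma> v = FAr \<gamma>' v" if "v \<in> hom C c c'" for v c c'
    using that assms(5) by (simp add: hom_def)
  show ?thesis
    unfolding two_pullback_def
  proof (intro conjI ballI impI)
    fix b c \<nu> assume *: "b \<in> Ob B" "c \<in> Ob C" "\<nu> \<in> isos C' (FOb \<beta> b) (FOb \<gamma>' c)"
    then have \<nu>: "\<nu> \<in> isos C' (FOb \<beta> b) (FOb \<gamma> c)" using assms(4) by simp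
    obtain a u v where a: "a \<in> Ob A" and u: "u \<in> isos B (FOb \<alpha> a) b"
        and v: "v \<in> isos C (FOb \<delta> a) c" and uv: "FAr \<gamma> v = Comp C' \<nu> (FAr \<beta> u)"
      using two_pullback_surj[OF assms(1) *(1,2) \<nu>] .
    have "FAr \<gamma> v = FAr \<gamma>' v" using v C unfolding isos_def by blast
    then show "\<exists>a\<in>Ob A. \<exists>u\<in>isos B (FOb \<alpha>' a) b. \<exists>v\<in>isos C (FOb \<delta> a) c.
        FAr \<gamma>' v = Comp C' \<nu> (FAr \<beta> u)"
      using a u v uv assms(2)[OF a] by (intro bexI[of _ a] bexI[of _ u] bexI[of _ v]) simp_all
  next
    fix a a' u v
    assume *: "a \<in> Ob A" "a' \<in> Ob A" "u \<in> hom B (FOb \<alpha>' a) (FOb \<alpha>' a')"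
      "v \<in> hom C (FOb \<delta> a) (FOb \<delta> a')" "FAr \<gamma>' v = FAr \<beta> u"
    have "\<exists>!t. t \<in> hom A a a' \<and> FAr \<alpha> t = u \<and> FAr \<delta> t = v"
      using * assms(2) C[OF *(4)] by (intro two_pullback_ex1[OF assms(1)]) simp_all
    then show "\<exists>!t. t \<in> hom A a a' \<and> FAr \<alpha>' t = u \<and> FAr \<delta> t = v"
      by (simp add: A cong: conj_cong)
  qed
qed

section \<open>Hom categories and composition\<close>

lemma Hom_Ob: "f \<in> Ob (Hom M Xs Y) \<longleftrightarrow> f \<in> Mor M \<and> src M f = Xs \<and> tgt M f = Y"
  by (simp add: Hom_def)

lemma Hom_Ar: "\<mu> \<in> Ar (Hom M Xs Y) \<longleftrightarrow>
    \<mu> \<in> Cell M \<and> src M (dom2 M \<mu>) = Xs \<and> tgt M (dom2 M \<mu>) = Y"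
  by (simp add: Hom_def)

lemma Hom_hom: "\<mu> \<in> hom (Hom M Xs Y) f g \<longleftrightarrow>
    \<mu> \<in> Cell M \<and> dom2 M \<mu> = f \<and> cod2 M \<mu> = g \<and> src M f = Xs \<and> tgt M f = Y"
  by (auto simp: Hom_def hom_def)

lemma Hom_simps [simp]:
  "Dom (Hom M Xs Y) = dom2 M" "Cod (Hom M Xs Y) = cod2 M"
  "Id (Hom M Xs Y) = id2 M" "Comp (Hom M Xs Y) = vcomp M"
  by (simp_all add: Hom_def)

lemma map_subst_slot: "map h (subst_slot i Xs Ys) = subst_slot i (map h Xs) (map h Ys)"
  by (simp add: subst_slot_def take_map drop_map)

lemma subst_slot_singleton: "i < length Ys \<Longrightarrow> subst_slot i [X] Ys = Ys[i := X]"
  by (simp add: subst_slot_def upd_conv_take_nth_drop)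

lemma subst_slot_in_singleton: "subst_slot 0 Xs [Y] = Xs"
  by (simp add: subst_slot_def)

lemma set_subst_slot_subset: "set (subst_slot i Xs Ys) \<subseteq> set Xs \<union> set Ys"
  by (auto simp: subst_slot_def dest: in_set_takeD in_set_dropD)

lemma functor_data_simps [simp]:
  "FOb (precomp M i f) g = comp1 M i g f" "FAr (precomp M i f) \<nu> = comp2 M i \<nu> (id2 M f)"
  "FOb (postcomp M i g) f = comp1 M i g f" "FAr (postcomp M i g) \<mu> = comp2 M i (id2 M g) \<mu>"
  "FOb (hom_functor p) = on_mor p" "FAr (hom_functor p) = on_cell p"
  by (simp_all add: precomp_def postcomp_def hom_functor_def)

context two_multicategory
begin

lemma Mor_Ob: "f \<in> Mor M \<Longrightarrow> f \<in> Ob (Hom_of M f)"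
  by (simp add: Hom_Ob)

lemma Hom_of_category: "f \<in> Ob (Hom M Xs Y) \<Longrightarrow> category (Hom M Xs Y)"
  using mor Hom_category by (auto simp: Hom_Ob)

lemma id2_hom: "f \<in> Ob (Hom M Xs Y) \<Longrightarrow> id2 M f \<in> hom (Hom M Xs Y) f f"
  using category.id_hom[OF Hom_of_category, of f Xs Y f] by simp

lemma Hom_hom_Ob:
  assumes "\<mu> \<in> hom (Hom M Xs Y) f g"
  shows "f \<in> Ob (Hom M Xs Y)" "g \<in> Ob (Hom M Xs Y)"
  using assms cell by (auto simp: Hom_hom Hom_Ob)

lemma comp1_Ob:
  assumes "i < length Ys" "f \<in> Ob (Hom M Xs (Ys ! i))" "g \<in> Ob (Hom M Ys Z)"
  shows "comp1 M i g f \<in> Ob (Hom M (subst_slot i Xs Ys) Z)"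
  using src_comp1[of i g f] assms by (auto simp: Hom_Ob composable_def arity_def)

lemma comp_functor_at:
  assumes "i < length Ys" "f \<in> Ob (Hom M Xs (Ys ! i))" "g \<in> Ob (Hom M Ys Z)"
  shows "is_functor (prod_cat (Hom M Xs (Ys ! i)) (Hom M Ys Z)) (Hom M (subst_slot i Xs Ys) Z)
        \<lparr>FOb = (\<lambda>(f, g). comp1 M i g f), FAr = (\<lambda>(\<mu>, \<nu>). comp2 M i \<nu> \<mu>)\<rparr>"
  using assms mor[of f] mor[of g] by (intro comp_functor) (auto simp: Hom_Ob)

lemma comp2_hom:
  assumes "i < length Ys" "\<mu> \<in> hom (Hom M Xs (Ys ! i)) f f'" "\<nu> \<in> hom (Hom M Ys Z) g g'"
  shows "comp2 M i \<nu> \<mu> \<in> hom (Hom M (subst_slot i Xs Ys) Z) (comp1 M i g f) (comp1 M i g' f')"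
  using functor_hom[OF comp_functor_at[OF assms(1) Hom_hom_Ob(1)[OF assms(2)] Hom_hom_Ob(1)[OF assms(3)]],
      of "(\<mu>, \<nu>)" "(f, g)" "(f', g')"] assms(2,3)
  by (simp add: prod_cat_def hom_def)

lemma comp2_id:
  assumes "i < length Ys" "f \<in> Ob (Hom M Xs (Ys ! i))" "g \<in> Ob (Hom M Ys Z)"
  shows "comp2 M i (id2 M g) (id2 M f) = id2 M (comp1 M i g f)"
  using functor_Id[OF comp_functor_at[OF assms], of "(f, g)"] assms(2,3)
  by (simp add: prod_cat_def)

lemma interchange:
  assumes "i < length Ys" "\<mu> \<in> hom (Hom M Xs (Ys ! i)) f f'" "\<mu>' \<in> hom (Hom M Xs (Ys ! i)) f' f''"
    and "\<nu> \<in> hom (Hom M Ys Z) g g'" "\<nu>' \<in> hom (Hom M Ys Z) g' g''"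
  shows "comp2 M i (vcomp M \<nu>' \<nu>) (vcomp M \<mu>' \<mu>) = vcomp M (comp2 M i \<nu>' \<mu>') (comp2 M i \<nu> \<mu>)"
  using functor_Comp[OF comp_functor_at[OF assms(1) Hom_hom_Ob(1)[OF assms(2)] Hom_hom_Ob(1)[OF assms(4)]],
      of "(\<mu>, \<nu>)" "(f, g)" "(f', g')" "(\<mu>', \<nu>')" "(f'', g'')"] assms(2-5)
  by (simp add: prod_cat_def hom_def)

lemma vcomp_id:
  assumes "\<mu> \<in> hom (Hom M Xs Y) f g"
  shows "vcomp M \<mu> (id2 M f) = \<mu>" "vcomp M (id2 M g) \<mu> = \<mu>"
  using category.comp_id[OF Hom_of_category[OF Hom_hom_Ob(1)[OF assms]] assms]
    category.id_comp[OF Hom_of_category[OF Hom_hom_Ob(1)[OF assms]] assms] by simp_all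

lemma vcomp_hom:
  assumes "\<mu> \<in> hom (Hom M Xs Y) f g" "\<nu> \<in> hom (Hom M Xs Y) g h"
  shows "vcomp M \<nu> \<mu> \<in> hom (Hom M Xs Y) f h"
  using category.comp_hom[OF Hom_of_category[OF Hom_hom_Ob(1)[OF assms(1)]] assms] by simp

text \<open>Whiskering is functorial by interchange, because \<open>id2 M f\<close> is its own
  vertical square.\<close>

lemma precomp_functor:
  assumes "i < length Ys" "f \<in> Ob (Hom M Xs (Ys ! i))"
  shows "is_functor (Hom M Ys Z) (Hom M (subst_slot i Xs Ys) Z) (precomp M i f)"
  unfolding is_functor_def functor_data_simps Hom_simps
proof (intro conjI ballI impI)
  fix \<mu> \<nu> assume *: "\<mu> \<in> Ar (Hom M Ys Z)" "\<nu> \<in> Ar (Hom M Ys Z)" "cod2 M \<mu> = dom2 M \<nu>"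
  then show "comp2 M i (vcomp M \<nu> \<mu>) (id2 M f) =
      vcomp M (comp2 M i \<nu> (id2 M f)) (comp2 M i \<mu> (id2 M f))"
    using interchange[OF assms(1) id2_hom[OF assms(2)] id2_hom[OF assms(2)], of \<mu> Z "dom2 M \<mu>" "cod2 M \<mu>" \<nu> "cod2 M \<nu>"]
      vcomp_id(1)[OF id2_hom[OF assms(2)]]
    by (simp add: Hom_hom Hom_Ar)
next
  fix \<mu> assume "\<mu> \<in> Ar (Hom M Ys Z)"
  then show "comp2 M i \<mu> (id2 M f) \<in> hom (Hom M (subst_slot i Xs Ys) Z)
      (comp1 M i (dom2 M \<mu>) f) (comp1 M i (cod2 M \<mu>) f)"
    by (intro comp2_hom[OF assms(1) id2_hom[OF assms(2)]]) (simp add: Hom_hom Hom_Ar)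
qed (use comp1_Ob[OF assms] comp2_id[OF assms] in auto)

lemma postcomp_functor:
  assumes "i < length Ys" "g \<in> Ob (Hom M Ys Z)"
  shows "is_functor (Hom M Xs (Ys ! i)) (Hom M (subst_slot i Xs Ys) Z) (postcomp M i g)"
  unfolding is_functor_def functor_data_simps Hom_simps
proof (intro conjI ballI impI)
  fix \<mu> \<nu> assume *: "\<mu> \<in> Ar (Hom M Xs (Ys ! i))" "\<nu> \<in> Ar (Hom M Xs (Ys ! i))" "cod2 M \<mu> = dom2 M \<nu>"
  then show "comp2 M i (id2 M g) (vcomp M \<nu> \<mu>) =
      vcomp M (comp2 M i (id2 M g) \<nu>) (comp2 M i (id2 M g) \<mu>)"
    using interchange[OF assms(1) _ _ id2_hom[OF assms(2)] id2_hom[OF assms(2)], of \<mu> Xs "dom2 M \<mu>" "cod2 M \<mu>" \<nu> "cod2 M \<nu>"]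
      vcomp_id(1)[OF id2_hom[OF assms(2)]]
    by (simp add: Hom_hom Hom_Ar)
next
  fix \<mu> assume "\<mu> \<in> Ar (Hom M Xs (Ys ! i))"
  then show "comp2 M i (id2 M g) \<mu> \<in> hom (Hom M (subst_slot i Xs Ys) Z)
      (comp1 M i g (dom2 M \<mu>)) (comp1 M i g (cod2 M \<mu>))"
    by (intro comp2_hom[OF assms(1) _ id2_hom[OF assms(2)]]) (simp add: Hom_hom Hom_Ar)
qed (use comp1_Ob[OF assms(1) _ assms(2)] comp2_id[OF assms(1) _ assms(2)] in auto)

end

section \<open>Squares attached to a 1-morphism over a base\<close>

locale two_multicategory_over = D: two_multicategory D + S: two_multicategory S + p: strict_functor D S p
  for D :: "('o, 'm, 'c, 'x) two_multicat_scheme"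
    and S :: "('o1, 'm1, 'c1, 'y) two_multicat_scheme"
    and p :: "('o, 'm, 'c, 'o1, 'm1, 'c1) mfunctor_data"
begin

lemma functor_at: "f \<in> Ob (Hom D Xs Y) \<Longrightarrow>
    is_functor (Hom D Xs Y) (Hom S (map (on_obj p) Xs) (on_obj p Y)) (hom_functor p)"
  using D.mor[of f] by (intro p.hom) (auto simp: Hom_Ob)

lemma on_mor_Ob: "f \<in> Ob (Hom D Xs Y) \<Longrightarrow>
    on_mor p f \<in> Ob (Hom S (map (on_obj p) Xs) (on_obj p Y))"
  using functor_Ob[OF functor_at] by fastforce

lemma on_cell_hom: "\<mu> \<in> hom (Hom D Xs Y) f g \<Longrightarrow>
    on_cell p \<mu> \<in> hom (Hom S (map (on_obj p) Xs) (on_obj p Y)) (on_mor p f) (on_mor p g)"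
  using functor_hom[OF functor_at] D.Hom_hom_Ob by fastforce

lemma on_cell_id2: "f \<in> Mor D \<Longrightarrow> on_cell p (id2 D f) = id2 S (on_mor p f)"
  using functor_Id[OF functor_at[OF D.Mor_Ob], of f f] D.Mor_Ob[of f] by simp

lemma on_cell_vcomp: "\<mu> \<in> hom (Hom D Xs Y) f g \<Longrightarrow> \<nu> \<in> hom (Hom D Xs Y) g h \<Longrightarrow>
    on_cell p (vcomp D \<nu> \<mu>) = vcomp S (on_cell p \<nu>) (on_cell p \<mu>)"
  using functor_Comp[OF functor_at] D.Hom_hom_Ob by fastforce

text \<open>Commutativity holds on the nose because \<open>p\<close> strictly preserves composition
  in a slot and identity 2-morphisms.\<close>

lemma precomp_square:
  assumes "\<xi> \<in> Mor D" "set Fs \<subseteq> Obj D" "G \<in> Obj D" "i < length Fs" "Fs ! i = tgt D \<xi>"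
  shows "functor_square (Hom D Fs G) (Hom D (subst_slot i (src D \<xi>) Fs) G)
    (Hom S (map (on_obj p) Fs) (on_obj p G))
    (Hom S (map (on_obj p) (subst_slot i (src D \<xi>) Fs)) (on_obj p G))
    (precomp D i \<xi>) (hom_functor p) (hom_functor p) (precomp S i (on_mor p \<xi>))"
proof -
  have \<xi>: "\<xi> \<in> Ob (Hom D (src D \<xi>) (Fs ! i))" using assms by (simp add: Hom_Ob)
  have ob: "set (subst_slot i (src D \<xi>) Fs) \<subseteq> Obj D"
    using D.mor[OF assms(1)] assms(2) set_subst_slot_subset by fast
  have obS: "set (map (on_obj p) Xs) \<subseteq> Obj S" if "set Xs \<subseteq> Obj D" for Xs
    using that p.obj by auto
  have f: "composable D i f \<xi>" if "f \<in> Ob (Hom D Fs G)" for f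
    using that assms by (simp add: Hom_Ob composable_def arity_def)
  show ?thesis
  proof (intro functor_square.intro functor_square_axioms.intro)
    show "is_functor (Hom S (map (on_obj p) Fs) (on_obj p G))
        (Hom S (map (on_obj p) (subst_slot i (src D \<xi>) Fs)) (on_obj p G)) (precomp S i (on_mor p \<xi>))"
      using S.precomp_functor[of i "map (on_obj p) Fs"] on_mor_Ob[OF \<xi>] assms(4)
      by (simp add: map_subst_slot)
    fix t assume t: "t \<in> Ar (Hom D Fs G)"
    then have "t \<in> hom (Hom D Fs G) (dom2 D t) (cod2 D t)" by (simp add: hom_def)
    from f[OF D.Hom_hom_Ob(1)[OF this]] have "composable2 D i t (id2 D \<xi>)"
      using t D.id2_hom[OF \<xi>] by (simp add: composable2_def Hom_hom Hom_Ar)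
    then show "FAr (hom_functor p) (FAr (precomp D i \<xi>) t) =
        FAr (precomp S i (on_mor p \<xi>)) (FAr (hom_functor p) t)"
      using p.comp2 on_cell_id2[OF assms(1)] by simp
  qed (use D.precomp_functor[OF assms(4) \<xi>] D.Hom_category S.Hom_category p.hom p.comp1[OF f] p.obj
      obS ob assms(2,3) in simp_all)
qed

lemma postcomp_square:
  assumes "\<xi> \<in> Mor D" "i < arity D \<xi>" "set Gs \<subseteq> Obj D"
  shows "functor_square (Hom D Gs (src D \<xi> ! i)) (Hom D (subst_slot i Gs (src D \<xi>)) (tgt D \<xi>))
    (Hom S (map (on_obj p) Gs) (on_obj p (src D \<xi> ! i)))
    (Hom S (map (on_obj p) (subst_slot i Gs (src D \<xi>))) (on_obj p (tgt D \<xi>)))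
    (postcomp D i \<xi>) (hom_functor p) (hom_functor p) (postcomp S i (on_mor p \<xi>))"
proof -
  have \<xi>: "\<xi> \<in> Ob (Hom D (src D \<xi>) (tgt D \<xi>))" using assms by (simp add: Hom_Ob)
  have i: "i < length (src D \<xi>)" using assms(2) by (simp add: arity_def)
  have ob: "set (subst_slot i Gs (src D \<xi>)) \<subseteq> Obj D"
    using D.mor[OF assms(1)] assms(3) set_subst_slot_subset by fast
  have obS: "set (map (on_obj p) Xs) \<subseteq> Obj S" if "set Xs \<subseteq> Obj D" for Xs
    using that p.obj by auto
  have f: "composable D i \<xi> f" if "f \<in> Ob (Hom D Gs (src D \<xi> ! i))" for f
    using that assms by (simp add: Hom_Ob composable_def arity_def)
  have obi: "src D \<xi> ! i \<in> Obj D" "tgt D \<xi> \<in> Obj D"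
    using D.mor[OF assms(1)] i nth_mem by blast+
  show ?thesis
  proof (intro functor_square.intro functor_square_axioms.intro)
    show "is_functor (Hom S (map (on_obj p) Gs) (on_obj p (src D \<xi> ! i)))
        (Hom S (map (on_obj p) (subst_slot i Gs (src D \<xi>))) (on_obj p (tgt D \<xi>))) (postcomp S i (on_mor p \<xi>))"
      using S.postcomp_functor[of i "map (on_obj p) (src D \<xi>)"] on_mor_Ob[OF \<xi>] i
      by (simp add: map_subst_slot)
    fix t assume t: "t \<in> Ar (Hom D Gs (src D \<xi> ! i))"
    then have "t \<in> hom (Hom D Gs (src D \<xi> ! i)) (dom2 D t) (cod2 D t)" by (simp add: hom_def)
    from f[OF D.Hom_hom_Ob(1)[OF this]] have "composable2 D i (id2 D \<xi>) t"
      using t D.id2_hom[OF \<xi>] by (simp add: composable2_def Hom_hom Hom_Ar)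
    then show "FAr (hom_functor p) (FAr (postcomp D i \<xi>) t) =
        FAr (postcomp S i (on_mor p \<xi>)) (FAr (hom_functor p) t)"
      using p.comp2 on_cell_id2[OF assms(1)] by simp
  qed (use D.postcomp_functor[OF i \<xi>] D.Hom_category S.Hom_category p.hom p.comp1[OF f] p.obj
      obS ob assms(3) obi in simp_all)
qed

lemma cocartesian_two_pullback:
  assumes "cocartesian D S p \<xi>" "set Fs \<subseteq> Obj D" "G \<in> Obj D" "i < length Fs" "Fs ! i = tgt D \<xi>"
  shows "two_pullback (Hom D Fs G) (Hom D (subst_slot i (src D \<xi>) Fs) G)
    (Hom S (map (on_obj p) Fs) (on_obj p G))
    (Hom S (map (on_obj p) (subst_slot i (src D \<xi>) Fs)) (on_obj p G))
    (precomp D i \<xi>) (hom_functor p) (hom_functor p) (precomp S i (on_mor p \<xi>))"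
  using functor_square.two_cartesian_imp_two_pullback[OF precomp_square] assms
  unfolding cocartesian_def by blast

lemma cartesian_two_pullback:
  assumes "cartesian D S p i \<xi>" "set Gs \<subseteq> Obj D"
  shows "two_pullback (Hom D Gs (src D \<xi> ! i)) (Hom D (subst_slot i Gs (src D \<xi>)) (tgt D \<xi>))
    (Hom S (map (on_obj p) Gs) (on_obj p (src D \<xi> ! i)))
    (Hom S (map (on_obj p) (subst_slot i Gs (src D \<xi>))) (on_obj p (tgt D \<xi>)))
    (postcomp D i \<xi>) (hom_functor p) (hom_functor p) (postcomp S i (on_mor p \<xi>))"
  using functor_square.two_cartesian_imp_two_pullback[OF postcomp_square] assms
  unfolding cartesian_def by blast

end

section \<open>The final 2-multicategory as base\<close>

lemma Hom_point: "Ob (Hom point Xs Y) = {length Xs}"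
  "Ar (Hom point Xs Y) = {Id (Hom point Xs Y) (length Xs)}"
  \<comment> \<open>A list of units is determined by its length, so each Hom category of
    \<open>point\<close> has one object and one arrow.\<close>
  by (auto simp: Hom_def point_def list_eq_iff_nth_eq)

context two_multicategory
begin

lemma over_point: "two_multicategory_over M point (to_point M)"
  by (intro two_multicategory_over.intro two_multicategory_axioms two_multicategory_point
      strict_functor_to_point)

text \<open>Since the base categories are terminal, the relative property turns into the absolute
  universal property of a tensor product: insertion of \<xi> is fully faithful and essentially
  surjective.\<close>

lemma cocartesian_over_point:
  assumes "cocartesian M point (to_point M) \<xi>" "set Fs \<subseteq> Obj M" "G \<in> Obj M" "i < length Fs"
    "Fs ! i = tgt M \<xi>"
  shows "weak_equivalence (Hom M Fs G) (Hom M (subst_slot i (src M \<xi>) Fs) G) (precomp M i \<xi>)"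
proof -
  have "\<xi> \<in> Mor M" using assms(1) by (simp add: cocartesian_def)
  then show ?thesis
    using functor_square.two_pullback_terminal_imp_weak_equivalence[OF
        two_multicategory_over.precomp_square[OF over_point]
        two_multicategory_over.cocartesian_two_pullback[OF over_point assms(1)]
        Hom_point Hom_point] assms(2-5) by blast
qed

text \<open>The closed counterpart: composing with \<xi> in slot \<open>i\<close> is the currying
  equivalence that characterises an internal hom.\<close>

lemma cartesian_over_point:
  assumes "cartesian M point (to_point M) i \<xi>" "set Gs \<subseteq> Obj M"
  shows "weak_equivalence (Hom M Gs (src M \<xi> ! i)) (Hom M (subst_slot i Gs (src M \<xi>)) (tgt M \<xi>))
    (postcomp M i \<xi>)"
proof -
  have "\<xi> \<in> Mor M" "i < arity M \<xi>" using assms(1) by (simp_all add: cartesian_def)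
  then show ?thesis
    using functor_square.two_pullback_terminal_imp_weak_equivalence[OF
        two_multicategory_over.postcomp_square[OF over_point]
        two_multicategory_over.cartesian_two_pullback[OF over_point assms(1)]
        Hom_point Hom_point] assms(2) by blast
qed

end

section \<open>Comparison of Cartesian 1-morphisms\<close>

context two_multicategory_over
begin

text \<open>The universal properties are only needed for unary 1-morphisms: these already determine the
  target (resp. source) up to equivalence.\<close>

definition unary_cocartesian :: "'m \<Rightarrow> bool" where
  "unary_cocartesian \<xi> \<longleftrightarrow> \<xi> \<in> Mor D \<and>
    (\<forall>G \<in> Obj D. two_pullback (Hom D [tgt D \<xi>] G) (Hom D (src D \<xi>) G)
      (Hom S [on_obj p (tgt D \<xi>)] (on_obj p G)) (Hom S (map (on_obj p) (src D \<xi>)) (on_obj p G))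
      (precomp D 0 \<xi>) (hom_functor p) (hom_functor p) (precomp S 0 (on_mor p \<xi>)))"

definition unary_cartesian :: "nat \<Rightarrow> 'm \<Rightarrow> bool" where
  "unary_cartesian i \<xi> \<longleftrightarrow> \<xi> \<in> Mor D \<and> i < length (src D \<xi>) \<and>
    (\<forall>G \<in> Obj D. two_pullback (Hom D [G] (src D \<xi> ! i)) (Hom D ((src D \<xi>)[i := G]) (tgt D \<xi>))
      (Hom S [on_obj p G] (on_obj p (src D \<xi> ! i)))
      (Hom S (map (on_obj p) ((src D \<xi>)[i := G])) (on_obj p (tgt D \<xi>)))
      (postcomp D i \<xi>) (hom_functor p) (hom_functor p) (postcomp S i (on_mor p \<xi>)))"

lemma unary_cocartesianD:
  assumes "unary_cocartesian \<xi>" "G \<in> Obj D"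
  shows "two_pullback (Hom D [tgt D \<xi>] G) (Hom D (src D \<xi>) G)
      (Hom S [on_obj p (tgt D \<xi>)] (on_obj p G)) (Hom S (map (on_obj p) (src D \<xi>)) (on_obj p G))
      (precomp D 0 \<xi>) (hom_functor p) (hom_functor p) (precomp S 0 (on_mor p \<xi>))"
  using assms by (simp add: unary_cocartesian_def)

lemma unary_cartesianD:
  assumes "unary_cartesian i \<xi>" "G \<in> Obj D"
  shows "two_pullback (Hom D [G] (src D \<xi> ! i)) (Hom D ((src D \<xi>)[i := G]) (tgt D \<xi>))
      (Hom S [on_obj p G] (on_obj p (src D \<xi> ! i)))
      (Hom S (map (on_obj p) ((src D \<xi>)[i := G])) (on_obj p (tgt D \<xi>)))
      (postcomp D i \<xi>) (hom_functor p) (hom_functor p) (postcomp S i (on_mor p \<xi>))"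
  using assms by (simp add: unary_cartesian_def)

lemma unary_precomp_square:
  assumes "\<xi> \<in> Mor D" "G \<in> Obj D"
  shows "functor_square (Hom D [tgt D \<xi>] G) (Hom D (src D \<xi>) G)
      (Hom S [on_obj p (tgt D \<xi>)] (on_obj p G)) (Hom S (map (on_obj p) (src D \<xi>)) (on_obj p G))
      (precomp D 0 \<xi>) (hom_functor p) (hom_functor p) (precomp S 0 (on_mor p \<xi>))"
  using precomp_square[of \<xi> "[tgt D \<xi>]" G 0] assms D.mor by (simp add: subst_slot_in_singleton)

lemma unary_postcomp_square:
  assumes "\<xi> \<in> Mor D" "i < length (src D \<xi>)" "G \<in> Obj D"
  shows "functor_square (Hom D [G] (src D \<xi> ! i)) (Hom D ((src D \<xi>)[i := G]) (tgt D \<xi>))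
      (Hom S [on_obj p G] (on_obj p (src D \<xi> ! i)))
      (Hom S (map (on_obj p) ((src D \<xi>)[i := G])) (on_obj p (tgt D \<xi>)))
      (postcomp D i \<xi>) (hom_functor p) (hom_functor p) (postcomp S i (on_mor p \<xi>))"
  using postcomp_square[of \<xi> i "[G]"] assms by (simp add: subst_slot_singleton arity_def)

lemma cocartesian_imp_unary:
  assumes "cocartesian D S p \<xi>"
  shows "unary_cocartesian \<xi>"
  using cocartesian_two_pullback[OF assms, of "[tgt D \<xi>]" _ 0] assms D.mor[of \<xi>]
  by (auto simp: unary_cocartesian_def subst_slot_in_singleton cocartesian_def)

lemma cartesian_imp_unary:
  assumes "cartesian D S p i \<xi>"
  shows "unary_cartesian i \<xi>"
  using cartesian_two_pullback[OF assms, of "[_]"] assms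
  by (auto simp: unary_cartesian_def subst_slot_singleton cartesian_def arity_def)

lemma unary_cocartesian_over_point:
  assumes "cocartesian D point (to_point D) \<xi>" "cocartesian S point (to_point S) (on_mor p \<xi>)"
  shows "unary_cocartesian \<xi>"
  unfolding unary_cocartesian_def
proof (intro conjI ballI)
  show \<xi>: "\<xi> \<in> Mor D" using assms(1) by (simp add: cocartesian_def)
  fix G assume G: "G \<in> Obj D"
  have s: "src S (on_mor p \<xi>) = map (on_obj p) (src D \<xi>)" "tgt S (on_mor p \<xi>) = on_obj p (tgt D \<xi>)"
    using on_mor_Ob[OF D.Mor_Ob[OF \<xi>]] by (simp_all add: Hom_Ob)
  show "two_pullback (Hom D [tgt D \<xi>] G) (Hom D (src D \<xi>) G)
      (Hom S [on_obj p (tgt D \<xi>)] (on_obj p G)) (Hom S (map (on_obj p) (src D \<xi>)) (on_obj p G))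
      (precomp D 0 \<xi>) (hom_functor p) (hom_functor p) (precomp S 0 (on_mor p \<xi>))"
    using D.cocartesian_over_point[OF assms(1), of "[tgt D \<xi>]" G 0] D.mor[OF \<xi>] G
      S.cocartesian_over_point[OF assms(2), of "[on_obj p (tgt D \<xi>)]" "on_obj p G" 0]
    by (intro functor_square.weak_equivalences_imp_two_pullback[OF unary_precomp_square[OF \<xi> G]])
      (simp_all add: subst_slot_in_singleton s p.obj)
qed

lemma unary_cartesian_over_point:
  assumes "cartesian D point (to_point D) i \<xi>" "cartesian S point (to_point S) i (on_mor p \<xi>)"
  shows "unary_cartesian i \<xi>"
  unfolding unary_cartesian_def
proof (intro conjI ballI)
  show \<xi>: "\<xi> \<in> Mor D" and i: "i < length (src D \<xi>)"
    using assms(1) by (simp_all add: cartesian_def arity_def)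
  fix G assume G: "G \<in> Obj D"
  have s: "src S (on_mor p \<xi>) = map (on_obj p) (src D \<xi>)" "tgt S (on_mor p \<xi>) = on_obj p (tgt D \<xi>)"
    using on_mor_Ob[OF D.Mor_Ob[OF \<xi>]] by (simp_all add: Hom_Ob)
  show "two_pullback (Hom D [G] (src D \<xi> ! i)) (Hom D ((src D \<xi>)[i := G]) (tgt D \<xi>))
      (Hom S [on_obj p G] (on_obj p (src D \<xi> ! i)))
      (Hom S (map (on_obj p) ((src D \<xi>)[i := G])) (on_obj p (tgt D \<xi>)))
      (postcomp D i \<xi>) (hom_functor p) (hom_functor p) (postcomp S i (on_mor p \<xi>))"
    using D.cartesian_over_point[OF assms(1), of "[G]"] G i
      S.cartesian_over_point[OF assms(2), of "[on_obj p G]"]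
    by (intro functor_square.weak_equivalences_imp_two_pullback[OF unary_postcomp_square[OF \<xi> i G]])
      (simp_all add: subst_slot_singleton s p.obj map_update)
qed

text \<open>By associativity, inserting the composite amounts to inserting \<zeta> and then \<xi>,
  both in \<open>D\<close> and in \<open>S\<close>. The square of the composite is thus the square
  of \<zeta> followed horizontally by the square of \<xi>.\<close>

lemma unary_cocartesian_comp:
  assumes "unary_cocartesian \<xi>" "unary_cocartesian \<zeta>" "src D \<zeta> = [tgt D \<xi>]"
  shows "unary_cocartesian (comp1 D 0 \<zeta> \<xi>)"
proof -
  have \<xi>: "\<xi> \<in> Mor D" and \<zeta>: "\<zeta> \<in> Mor D" using assms by (simp_all add: unary_cocartesian_def)
  then have c: "composable D 0 \<zeta> \<xi>" using assms(3) by (simp add: composable_def arity_def)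
  note s = D.src_comp1[OF c, unfolded assms(3) subst_slot_in_singleton]
  have id: "id2 D (comp1 D 0 \<zeta> \<xi>) = comp2 D 0 (id2 D \<zeta>) (id2 D \<xi>)"
    using D.comp2_id[of 0 "src D \<zeta>" \<xi> "src D \<xi>" \<zeta> "tgt D \<zeta>"] \<xi> \<zeta> assms(3) by (simp add: Hom_Ob)
  have p\<xi>: "on_mor p \<xi> \<in> Mor S" "src S (on_mor p \<xi>) = map (on_obj p) (src D \<xi>)"
      "tgt S (on_mor p \<xi>) = on_obj p (tgt D \<xi>)"
    and p\<zeta>: "on_mor p \<zeta> \<in> Mor S" "src S (on_mor p \<zeta>) = [on_obj p (tgt D \<xi>)]"
      "tgt S (on_mor p \<zeta>) = on_obj p (tgt D \<zeta>)"
    using on_mor_Ob[OF D.Mor_Ob[OF \<xi>]] on_mor_Ob[OF D.Mor_Ob[OF \<zeta>]] assms(3)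
    by (simp_all add: Hom_Ob)
  have cS: "composable S 0 (on_mor p \<zeta>) (on_mor p \<xi>)"
    using p\<xi> p\<zeta> by (simp add: composable_def arity_def)
  have idS: "id2 S (comp1 S 0 (on_mor p \<zeta>) (on_mor p \<xi>)) = comp2 S 0 (id2 S (on_mor p \<zeta>)) (id2 S (on_mor p \<xi>))"
    using S.comp2_id[of 0 "src S (on_mor p \<zeta>)" "on_mor p \<xi>" "src S (on_mor p \<xi>)" "on_mor p \<zeta>" "tgt S (on_mor p \<zeta>)"] p\<xi> p\<zeta>
    by (simp add: Hom_Ob)
  show ?thesis
    unfolding unary_cocartesian_def s
  proof (intro conjI ballI)
    show "comp1 D 0 \<zeta> \<xi> \<in> Mor D" by (rule s(3))
    fix G assume G: "G \<in> Obj D"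
    show "two_pullback (Hom D [tgt D \<zeta>] G) (Hom D (src D \<xi>) G)
      (Hom S [on_obj p (tgt D \<zeta>)] (on_obj p G)) (Hom S (map (on_obj p) (src D \<xi>)) (on_obj p G))
      (precomp D 0 (comp1 D 0 \<zeta> \<xi>)) (hom_functor p) (hom_functor p)
      (precomp S 0 (on_mor p (comp1 D 0 \<zeta> \<xi>)))"
    proof (rule two_pullback_cong[OF two_pullback_paste[OF
            unary_precomp_square[OF \<zeta> G, unfolded assms(3), simplified] unary_precomp_square[OF \<xi> G]]])
      show "two_pullback (Hom D [tgt D \<zeta>] G) (Hom D [tgt D \<xi>] G)
          (Hom S [on_obj p (tgt D \<zeta>)] (on_obj p G)) (Hom S [on_obj p (tgt D \<xi>)] (on_obj p G))
          (precomp D 0 \<zeta>) (hom_functor p) (hom_functor p) (precomp S 0 (on_mor p \<zeta>))"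
        using assms(2) G by (simp add: unary_cocartesian_def assms(3))
      show "two_pullback (Hom D [tgt D \<xi>] G) (Hom D (src D \<xi>) G)
          (Hom S [on_obj p (tgt D \<xi>)] (on_obj p G)) (Hom S (map (on_obj p) (src D \<xi>)) (on_obj p G))
          (precomp D 0 \<xi>) (hom_functor p) (hom_functor p) (precomp S 0 (on_mor p \<xi>))"
        using assms(1) G by (simp add: unary_cocartesian_def)
    next
      fix a assume "a \<in> Ob (Hom D [tgt D \<zeta>] G)"
      then have "composable D 0 a \<zeta>" using \<zeta> by (simp add: Hom_Ob composable_def arity_def)
      then show "FOb (comp_functor (precomp D 0 \<xi>) (precomp D 0 \<zeta>)) a = FOb (precomp D 0 (comp1 D 0 \<zeta> \<xi>)) a"
        using D.assoc1[OF _ c] by (simp add: comp_functor_def)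
    next
      fix t assume "t \<in> Ar (Hom D [tgt D \<zeta>] G)"
      then have "composable2 D 0 t (id2 D \<zeta>)" "composable2 D 0 (id2 D \<zeta>) (id2 D \<xi>)"
        using \<zeta> \<xi> c D.cell[of t] D.id2_hom[OF D.Mor_Ob[OF \<zeta>]] D.id2_hom[OF D.Mor_Ob[OF \<xi>]]
        by (simp_all add: Hom_hom Hom_Ar composable2_def composable_def arity_def)
      then show "FAr (comp_functor (precomp D 0 \<xi>) (precomp D 0 \<zeta>)) t = FAr (precomp D 0 (comp1 D 0 \<zeta> \<xi>)) t"
        using D.assoc2 id by (simp add: comp_functor_def)
    next
      fix a assume "a \<in> Ob (Hom S [on_obj p (tgt D \<zeta>)] (on_obj p G))"
      then have "composable S 0 a (on_mor p \<zeta>)" using p\<zeta> by (simp add: Hom_Ob composable_def arity_def)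
      then show "FOb (comp_functor (precomp S 0 (on_mor p \<xi>)) (precomp S 0 (on_mor p \<zeta>))) a =
          FOb (precomp S 0 (on_mor p (comp1 D 0 \<zeta> \<xi>))) a"
        using S.assoc1[OF _ cS] p.comp1[OF c] by (simp add: comp_functor_def)
    next
      fix t assume "t \<in> Ar (Hom S [on_obj p (tgt D \<zeta>)] (on_obj p G))"
      then have "composable2 S 0 t (id2 S (on_mor p \<zeta>))" "composable2 S 0 (id2 S (on_mor p \<zeta>)) (id2 S (on_mor p \<xi>))"
        using p\<zeta> p\<xi> cS S.cell[of t] S.id2_hom[OF S.Mor_Ob[OF p\<zeta>(1)]] S.id2_hom[OF S.Mor_Ob[OF p\<xi>(1)]]
        by (simp_all add: Hom_hom Hom_Ar composable2_def composable_def arity_def)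
      then show "FAr (comp_functor (precomp S 0 (on_mor p \<xi>)) (precomp S 0 (on_mor p \<zeta>))) t =
          FAr (precomp S 0 (on_mor p (comp1 D 0 \<zeta> \<xi>))) t"
        using S.assoc2 idS p.comp1[OF c] by (simp add: comp_functor_def)
    qed
  qed
qed

text \<open>Post-composition works in the opposite order: the square of \<zeta> in slot 0 comes
  first, then that of \<xi> in slot \<open>i\<close>. Associativity places the result in slot
  \<open>i + 0\<close>, so the composite is again tested in slot \<open>i\<close>.\<close>

lemma unary_cartesian_comp:
  assumes "unary_cartesian i \<xi>" "unary_cartesian 0 \<zeta>" "src D \<zeta> = [Q]" "tgt D \<zeta> = src D \<xi> ! i"
  shows "unary_cartesian i (comp1 D i \<xi> \<zeta>)"
proof -
  have \<xi>: "\<xi> \<in> Mor D" and \<zeta>: "\<zeta> \<in> Mor D" and i: "i < length (src D \<xi>)"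
    using assms by (simp_all add: unary_cartesian_def)
  then have c: "composable D i \<xi> \<zeta>" using assms(4) by (simp add: composable_def arity_def)
  note s = D.src_comp1[OF c, unfolded assms(3) subst_slot_singleton[OF i]]
  have id: "id2 D (comp1 D i \<xi> \<zeta>) = comp2 D i (id2 D \<xi>) (id2 D \<zeta>)"
    using D.comp2_id[of i "src D \<xi>" \<zeta> "src D \<zeta>" \<xi> "tgt D \<xi>"] \<xi> \<zeta> assms(4) i by (simp add: Hom_Ob)
  have p\<xi>: "on_mor p \<xi> \<in> Mor S" "src S (on_mor p \<xi>) = map (on_obj p) (src D \<xi>)"
      "tgt S (on_mor p \<xi>) = on_obj p (tgt D \<xi>)"
    and p\<zeta>: "on_mor p \<zeta> \<in> Mor S" "src S (on_mor p \<zeta>) = [on_obj p Q]"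
      "tgt S (on_mor p \<zeta>) = on_obj p (src D \<xi> ! i)"
    using on_mor_Ob[OF D.Mor_Ob[OF \<xi>]] on_mor_Ob[OF D.Mor_Ob[OF \<zeta>]] assms(3,4)
    by (simp_all add: Hom_Ob)
  have cS: "composable S i (on_mor p \<xi>) (on_mor p \<zeta>)"
    using p\<xi> p\<zeta> i by (simp add: composable_def arity_def)
  have idS: "id2 S (comp1 S i (on_mor p \<xi>) (on_mor p \<zeta>)) = comp2 S i (id2 S (on_mor p \<xi>)) (id2 S (on_mor p \<zeta>))"
    using S.comp2_id[of i "src S (on_mor p \<xi>)" "on_mor p \<zeta>" "src S (on_mor p \<zeta>)" "on_mor p \<xi>" "tgt S (on_mor p \<xi>)"] p\<xi> p\<zeta> i
    by (simp add: Hom_Ob)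
  show ?thesis
    unfolding unary_cartesian_def s
  proof (intro conjI ballI)
    show "comp1 D i \<xi> \<zeta> \<in> Mor D" by (rule s(3))
    show "i < length ((src D \<xi>)[i := Q])" using i by simp
    fix G assume G: "G \<in> Obj D"
    show "two_pullback (Hom D [G] ((src D \<xi>)[i := Q] ! i)) (Hom D ((src D \<xi>)[i := Q, i := G]) (tgt D \<xi>))
      (Hom S [on_obj p G] (on_obj p ((src D \<xi>)[i := Q] ! i)))
      (Hom S (map (on_obj p) ((src D \<xi>)[i := Q, i := G])) (on_obj p (tgt D \<xi>)))
      (postcomp D i (comp1 D i \<xi> \<zeta>)) (hom_functor p) (hom_functor p)
      (postcomp S i (on_mor p (comp1 D i \<xi> \<zeta>)))"
      \<comment> \<open>The composite has \<open>Q\<close> as its \<open>i\<close>-th source, and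
        overwriting \<open>Q\<close> by \<open>G\<close> gives the same list as overwriting the
        original source of \<xi>; this matches the outer corners of the pasted square.\<close>
      unfolding nth_list_update_eq[OF i] list_update_overwrite
    proof (rule two_pullback_cong[OF two_pullback_paste[OF
            unary_postcomp_square[OF \<zeta> _ G, of 0, unfolded assms(3,4), simplified] unary_postcomp_square[OF \<xi> i G]]])
      show "two_pullback (Hom D [G] Q) (Hom D [G] (src D \<xi> ! i))
          (Hom S [on_obj p G] (on_obj p Q)) (Hom S [on_obj p G] (on_obj p (src D \<xi> ! i)))
          (postcomp D 0 \<zeta>) (hom_functor p) (hom_functor p) (postcomp S 0 (on_mor p \<zeta>))"
        using assms(2) G by (simp add: unary_cartesian_def assms(3,4))
      show "two_pullback (Hom D [G] (src D \<xi> ! i)) (Hom D ((src D \<xi>)[i := G]) (tgt D \<xi>))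
          (Hom S [on_obj p G] (on_obj p (src D \<xi> ! i)))
          (Hom S (map (on_obj p) ((src D \<xi>)[i := G])) (on_obj p (tgt D \<xi>)))
          (postcomp D i \<xi>) (hom_functor p) (hom_functor p) (postcomp S i (on_mor p \<xi>))"
        using assms(1) G by (simp add: unary_cartesian_def)
    next
      fix a assume "a \<in> Ob (Hom D [G] Q)"
      then have "composable D 0 \<zeta> a" using \<zeta> assms(3) by (simp add: Hom_Ob composable_def arity_def)
      then show "FOb (comp_functor (postcomp D i \<xi>) (postcomp D 0 \<zeta>)) a = FOb (postcomp D i (comp1 D i \<xi> \<zeta>)) a"
        using D.assoc1[OF c] by (simp add: comp_functor_def)
    next
      fix t assume "t \<in> Ar (Hom D [G] Q)"
      then have "composable2 D 0 (id2 D \<zeta>) t" "composable2 D i (id2 D \<xi>) (id2 D \<zeta>)"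
        using \<zeta> \<xi> c assms(3) D.cell[of t] D.id2_hom[OF D.Mor_Ob[OF \<zeta>]] D.id2_hom[OF D.Mor_Ob[OF \<xi>]]
        by (simp_all add: Hom_hom Hom_Ar composable2_def composable_def arity_def)
      then show "FAr (comp_functor (postcomp D i \<xi>) (postcomp D 0 \<zeta>)) t = FAr (postcomp D i (comp1 D i \<xi> \<zeta>)) t"
        using D.assoc2[of i "id2 D \<xi>" "id2 D \<zeta>" 0 t] id by (simp add: comp_functor_def)
    next
      fix a assume "a \<in> Ob (Hom S [on_obj p G] (on_obj p Q))"
      then have "composable S 0 (on_mor p \<zeta>) a" using p\<zeta> by (simp add: Hom_Ob composable_def arity_def)
      then show "FOb (comp_functor (postcomp S i (on_mor p \<xi>)) (postcomp S 0 (on_mor p \<zeta>))) a =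
          FOb (postcomp S i (on_mor p (comp1 D i \<xi> \<zeta>))) a"
        using S.assoc1[OF cS] p.comp1[OF c] by (simp add: comp_functor_def)
    next
      fix t assume "t \<in> Ar (Hom S [on_obj p G] (on_obj p Q))"
      then have "composable2 S 0 (id2 S (on_mor p \<zeta>)) t" "composable2 S i (id2 S (on_mor p \<xi>)) (id2 S (on_mor p \<zeta>))"
        using p\<zeta> p\<xi> cS S.cell[of t] S.id2_hom[OF S.Mor_Ob[OF p\<zeta>(1)]] S.id2_hom[OF S.Mor_Ob[OF p\<xi>(1)]]
        by (simp_all add: Hom_hom Hom_Ar composable2_def composable_def arity_def)
      then show "FAr (comp_functor (postcomp S i (on_mor p \<xi>)) (postcomp S 0 (on_mor p \<zeta>))) t =
          FAr (postcomp S i (on_mor p (comp1 D i \<xi> \<zeta>))) t"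
        using S.assoc2[of i "id2 S (on_mor p \<xi>)" "id2 S (on_mor p \<zeta>)" 0 t] idS p.comp1[OF c]
        by (simp add: comp_functor_def)
    qed
  qed
qed

end

section \<open>Equivalences in the fiber from coCartesian 1-morphisms\<close>

lemma core_eq: "all_cells_invertible M \<Longrightarrow> core M = M"
proof -
  assume "all_cells_invertible M"
  then have "{\<mu> \<in> Cell M. is_iso (Hom_of M (dom2 M \<mu>)) \<mu>} = Cell M"
    by (auto simp: all_cells_invertible_def)
  then show ?thesis by (simp add: core_def)
qed

lemma invertible_isos:
  assumes "all_cells_invertible M" "\<mu> \<in> hom (Hom M Xs Y) f g"
  shows "\<mu> \<in> isos (Hom M Xs Y) f g"
  using assms by (auto simp: all_cells_invertible_def isos_def Hom_hom)

locale isofibered_groupoidal = two_multicategory_over D S p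
  for D :: "('o, 'm, 'c, 'x) two_multicat_scheme"
    and S :: "('o1, 'm1, 'c1, 'y) two_multicat_scheme"
    and p :: "('o, 'm, 'c, 'o1, 'm1, 'c1) mfunctor_data" +
  assumes inv_D: "all_cells_invertible D" and inv_S: "all_cells_invertible S"
    and isofibered: "two_isofibered D S p"
begin

lemma lift_cell:
  assumes "f \<in> Ob (Hom D Xs Y)" "\<nu> \<in> hom (Hom S (map (on_obj p) Xs) (on_obj p Y)) g (on_mor p f)"
  shows "\<exists>f'. \<exists>\<mu> \<in> isos (Hom D Xs Y) f' f. on_mor p f' = g \<and> on_cell p \<mu> = \<nu>"
proof -
  \<comment> \<open>\<open>two_isofibered\<close> speaks about cores; as all 2-morphisms are
    invertible, it gives a fibration of the full Hom categories.\<close>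
  have "fibration (Hom D Xs Y) (Hom S (map (on_obj p) Xs) (on_obj p Y)) (hom_functor p)"
    using isofibered D.mor[of f] assms(1) core_eq[OF inv_D] core_eq[OF inv_S]
    by (auto simp: two_isofibered_def two_fibered_def Hom_Ob)
  then obtain \<mu> where "\<mu> \<in> Ar (Hom D Xs Y)" "cod2 D \<mu> = f" and \<nu>: "on_cell p \<mu> = \<nu>"
    using assms unfolding fibration_def cartesian_arrow_def by (auto simp: hom_def)
  then have \<mu>: "\<mu> \<in> hom (Hom D Xs Y) (dom2 D \<mu>) f" by (simp add: hom_def)
  then have "on_mor p (dom2 D \<mu>) = g" using on_cell_hom[OF \<mu>] assms(2) \<nu> by (simp add: Hom_hom)
  then show ?thesis using invertible_isos[OF inv_D \<mu>] \<nu> by blast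
qed

text \<open>The point is that an inverse \<open>t'\<close> found in \<open>D\<close> stays in the
  fiber: as \<open>p t\<close> is an identity, \<open>p t'\<close> equals \<open>p t'\<close> after
  \<open>p t\<close>, which is the image of an identity 2-morphism.\<close>

lemma fiber_isomorphic:
  assumes "t \<in> hom (Hom D [X] Y) f g" "on_cell p t = id2 S (id1 S S0)" "S0 \<in> Obj S"
  shows "isomorphic (Hom (fiber D S p S0) [X] Y) f g"
proof -
  interpret H: category "Hom D [X] Y" by (rule D.Hom_of_category[OF D.Hom_hom_Ob(1)[OF assms(1)]])
  obtain t' where t': "t' \<in> isos (Hom D [X] Y) g f" "vcomp D t' t = id2 D f" "vcomp D t t' = id2 D g"
    using H.isosE[OF invertible_isos[OF inv_D assms(1)]] by auto
  note ht' = H.isos_hom[OF t'(1)]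
  have f: "f \<in> Mor D" using D.Hom_hom_Ob(1)[OF assms(1)] by (simp add: Hom_Ob)
  note pt = on_cell_hom[OF assms(1), unfolded assms(2)]
  have id: "id2 S (id1 S S0) \<in> hom (Hom_of S (id1 S S0)) (id1 S S0) (id1 S S0)"
    using S.id2_hom S.Mor_Ob S.id1[OF assms(3)] by blast
  have pf: "on_mor p f = id1 S S0" "on_mor p g = id1 S S0"
    using pt id by (simp_all add: Hom_hom)
  have "on_cell p t' = vcomp S (on_cell p t') (on_cell p t)"
    using S.vcomp_id(1)[OF on_cell_hom[OF ht']] assms(2) pf by simp
  also have "\<dots> = id2 S (id1 S S0)"
    using on_cell_vcomp[OF assms(1) ht'] t'(2) on_cell_id2[OF f] pf by simp
  finally have "on_cell p t' = id2 S (id1 S S0)" .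
  then have "t \<in> isos (Hom (fiber D S p S0) [X] Y) f g"
    using assms(1,2) ht' t'(2,3)
    by (auto simp: isos_def is_iso_def Hom_hom fiber_def Hom_Ar arity2_def arity_def)
  then show ?thesis by (auto simp: isomorphic_def)
qed

text \<open>\<open>fiber\<close> restricts the carriers and keeps the operations, so the round trips
  may be formed in \<open>D\<close>.\<close>

lemma fiber_equivalentI:
  assumes "X \<in> Obj D" "Y \<in> Obj D" "on_obj p X = S0" "on_obj p Y = S0"
    and "e \<in> Ob (Hom D [X] Y)" "on_mor p e = id1 S S0"
    and "e' \<in> Ob (Hom D [Y] X)" "on_mor p e' = id1 S S0"
    and "isomorphic (Hom (fiber D S p S0) [X] X) (comp1 D 0 e' e) (id1 D X)"
    and "isomorphic (Hom (fiber D S p S0) [Y] Y) (comp1 D 0 e e') (id1 D Y)"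
  shows "equivalent (fiber D S p S0) X Y"
proof -
  let ?F = "fiber D S p S0"
  have "X \<in> Obj ?F" "Y \<in> Obj ?F" "e \<in> Ob (Hom ?F [X] Y)" "e' \<in> Ob (Hom ?F [Y] X)"
    and "comp1 ?F = comp1 D" "id1 ?F = id1 D"
    using assms(1-8) by (simp_all add: Hom_Ob fiber_def arity_def)
  then show ?thesis unfolding equivalent_def using assms(9,10) by auto
qed

text \<open>The universal property of \<phi> is applied to \<psi> with the identity of
  \<open>S0\<close> as the factor in the base. The strict form of essential surjectivity makes
  \<open>e\<close> lie exactly over that identity, hence in the fiber.\<close>

lemma unary_cocartesian_factor:
  assumes "unary_cocartesian \<phi>" "\<psi> \<in> Mor D" "src D \<psi> = src D \<phi>"
    and "on_obj p (tgt D \<phi>) = S0" "on_obj p (tgt D \<psi>) = S0"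
    and "\<nu> \<in> hom (Hom S (map (on_obj p) (src D \<phi>)) S0) (on_mor p \<phi>) (on_mor p \<psi>)"
  obtains e x where "e \<in> Ob (Hom D [tgt D \<phi>] (tgt D \<psi>))" "on_mor p e = id1 S S0"
    "x \<in> hom (Hom D (src D \<phi>) (tgt D \<psi>)) (comp1 D 0 e \<phi>) \<psi>" "on_cell p x = \<nu>"
proof -
  have \<phi>: "\<phi> \<in> Mor D" using assms(1) by (simp add: unary_cocartesian_def)
  have G: "tgt D \<psi> \<in> Obj D" using D.mor[OF assms(2)] by simp
  have S0: "S0 \<in> Obj S" using p.obj[OF G] assms(5) by simp
  interpret sq: functor_square "Hom D [tgt D \<phi>] (tgt D \<psi>)" "Hom D (src D \<phi>) (tgt D \<psi>)"
      "Hom S [S0] S0" "Hom S (map (on_obj p) (src D \<phi>)) S0"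
      "precomp D 0 \<phi>" "hom_functor p" "hom_functor p" "precomp S 0 (on_mor p \<phi>)"
    using unary_precomp_square[OF \<phi> G] assms(4,5) by simp
  have unit: "comp1 S 0 (id1 S S0) (on_mor p \<phi>) = on_mor p \<phi>"
    using S.left_unit1[of "on_mor p \<phi>"] on_mor_Ob[OF D.Mor_Ob[OF \<phi>]] assms(4) by (simp add: Hom_Ob)
  \<comment> \<open>By the left unit law the identity composed with \<open>on_mor p \<phi>\<close>
    is \<open>on_mor p \<phi>\<close> itself, so \<nu> has the endpoints which the square of \<phi>
    asks for.\<close>
  have \<nu>: "\<nu> \<in> isos (Hom S (map (on_obj p) (src D \<phi>)) S0)
      (FOb (precomp S 0 (on_mor p \<phi>)) (id1 S S0)) (FOb (hom_functor p) \<psi>)"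
    using invertible_isos[OF inv_S assms(6)] by (simp add: unit)
  have tp: "two_pullback (Hom D [tgt D \<phi>] (tgt D \<psi>)) (Hom D (src D \<phi>) (tgt D \<psi>))
      (Hom S [S0] S0) (Hom S (map (on_obj p) (src D \<phi>)) S0)
      (precomp D 0 \<phi>) (hom_functor p) (hom_functor p) (precomp S 0 (on_mor p \<phi>))"
    using unary_cocartesianD[OF assms(1) G] assms(4,5) by simp
  obtain e x where "e \<in> Ob (Hom D [tgt D \<phi>] (tgt D \<psi>))" "FOb (hom_functor p) e = id1 S S0"
      "x \<in> isos (Hom D (src D \<phi>) (tgt D \<psi>)) (FOb (precomp D 0 \<phi>) e) \<psi>" "FAr (hom_functor p) x = \<nu>"
  proof (rule sq.two_pullback_surj_strict[OF tp _ _ _ \<nu>])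
    show "\<exists>a'. \<exists>u\<in>isos (Hom D [tgt D \<phi>] (tgt D \<psi>)) a' a.
        FOb (hom_functor p) a' = id1 S S0 \<and> FAr (hom_functor p) u = v"
      if "a \<in> Ob (Hom D [tgt D \<phi>] (tgt D \<psi>))" "v \<in> isos (Hom S [S0] S0) (id1 S S0) (FOb (hom_functor p) a)" for a v
      using lift_cell[OF that(1)] that(2) assms(4,5) by (simp add: isos_def)
    show "\<psi> \<in> Ob (Hom D (src D \<phi>) (tgt D \<psi>))" using assms(2,3) by (simp add: Hom_Ob)
    show "id1 S S0 \<in> Ob (Hom S [S0] S0)" using S.id1[OF S0] by (simp add: Hom_Ob)
  qed
  then show ?thesis using that by (auto simp: isos_def)
qed

text \<open>Whiskering \<open>x\<close> with \<open>e'\<close> and continuing with \<open>y\<close>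
  gives a 2-morphism from \<open>e' e \<phi>\<close> to \<phi>. It lies over an identity because the
  images of \<open>x\<close> and \<open>y\<close> cancel, so full faithfulness of the square of
  \<phi> descends it to a 2-morphism from \<open>e' e\<close> to the identity, inside the
  fiber.\<close>

lemma unary_cocartesian_retract:
  assumes "unary_cocartesian \<phi>" "\<psi> \<in> Mor D" "src D \<psi> = src D \<phi>"
    and "on_obj p (tgt D \<phi>) = S0" "on_obj p (tgt D \<psi>) = S0"
    and e: "e \<in> Ob (Hom D [tgt D \<phi>] (tgt D \<psi>))" "on_mor p e = id1 S S0"
      "x \<in> hom (Hom D (src D \<phi>) (tgt D \<psi>)) (comp1 D 0 e \<phi>) \<psi>"
    and e': "e' \<in> Ob (Hom D [tgt D \<psi>] (tgt D \<phi>))" "on_mor p e' = id1 S S0"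
      "y \<in> hom (Hom D (src D \<phi>) (tgt D \<phi>)) (comp1 D 0 e' \<psi>) \<phi>"
    and inverse: "vcomp S (on_cell p y) (on_cell p x) = id2 S (on_mor p \<phi>)"
  shows "isomorphic (Hom (fiber D S p S0) [tgt D \<phi>] (tgt D \<phi>)) (comp1 D 0 e' e) (id1 D (tgt D \<phi>))"
proof -
  let ?T = "tgt D \<phi>"
  have \<phi>: "\<phi> \<in> Mor D" using assms(1) by (simp add: unary_cocartesian_def)
  have T: "?T \<in> Obj D" using D.mor[OF \<phi>] by simp
  have S0: "S0 \<in> Obj S" using p.obj[OF T] assms(4) by simp
  have id1: "id1 S S0 \<in> Mor S" "src S (id1 S S0) = [S0]" "tgt S (id1 S S0) = S0"
    using S.id1[OF S0] by auto
  have c: "composable D 0 e' e" "composable D 0 e \<phi>"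
    using e(1) e'(1) \<phi> by (simp_all add: Hom_Ob composable_def arity_def)
  have p\<phi>: "on_mor p \<phi> \<in> Mor S" "tgt S (on_mor p \<phi>) = S0"
    using on_mor_Ob[OF D.Mor_Ob[OF \<phi>]] assms(4) by (simp_all add: Hom_Ob)
  have id2p\<phi>: "id2 S (on_mor p \<phi>) \<in> hom (Hom_of S (on_mor p \<phi>)) (on_mor p \<phi>) (on_mor p \<phi>)"
    by (rule S.id2_hom[OF S.Mor_Ob[OF p\<phi>(1)]])
  have unit: "comp2 S 0 (id2 S (id1 S S0)) \<mu> = \<mu>" if "\<mu> \<in> hom (Hom S Xs S0) f g" for \<mu> Xs f g
    using S.left_unit2[of \<mu>] that by (simp add: Hom_hom)
  have e'x: "comp2 D 0 (id2 D e') x \<in> hom (Hom D (src D \<phi>) ?T) (comp1 D 0 (comp1 D 0 e' e) \<phi>) (comp1 D 0 e' \<psi>)"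
    using D.comp2_hom[of 0 "[tgt D \<psi>]" x "src D \<phi>" "comp1 D 0 e \<phi>" \<psi>, OF _ _ D.id2_hom[OF e'(1)]] e(3) D.assoc1[OF c]
    by (simp add: subst_slot_in_singleton)
  have "composable2 D 0 (id2 D e') x"
    using D.id2_hom[OF e'(1)] e(3) c(1) e(1) e'(1) D.Hom_hom_Ob(1)[OF e(3)]
    by (simp add: composable2_def composable_def Hom_hom Hom_Ob arity_def)
  \<comment> \<open>\<open>e'\<close> lies over the identity of \<open>S0\<close>, so whiskering
    with it is invisible after \<open>p\<close>.\<close>
  then have p_e'x: "on_cell p (comp2 D 0 (id2 D e') x) = on_cell p x"
    using p.comp2 on_cell_id2[of e'] e'(1,2) unit[OF on_cell_hom[OF e(3), unfolded assms(5)]] by (simp add: Hom_Ob)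
  let ?z = "vcomp D y (comp2 D 0 (id2 D e') x)"
  have z: "?z \<in> hom (Hom D (src D \<phi>) ?T) (comp1 D 0 (comp1 D 0 e' e) \<phi>) \<phi>"
    by (rule D.vcomp_hom[OF e'x e'(3)])
  have pz: "on_cell p ?z = id2 S (on_mor p \<phi>)"
    using on_cell_vcomp[OF e'x e'(3)] p_e'x inverse by simp
  have "on_mor p (comp1 D 0 e' e) = comp1 S 0 (id1 S S0) (id1 S S0)"
    using p.comp1[OF c(1)] e(2) e'(2) by simp
  then have pe'e: "on_mor p (comp1 D 0 e' e) = id1 S S0"
    using S.left_unit1[OF id1(1)] id1 by simp
  \<comment> \<open>\<open>?z\<close> is paired with the identity 2-morphism of
    \<open>id1 S S0\<close>; the two agree in the base by \<open>pz\<close> and the unit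
    law.\<close>
  have "\<exists>!t. t \<in> hom (Hom D [?T] ?T) (comp1 D 0 e' e) (id1 D ?T) \<and> FAr (precomp D 0 \<phi>) t = ?z \<and>
      FAr (hom_functor p) t = id2 S (id1 S S0)"
  proof (rule two_pullback_ex1)
    show "two_pullback (Hom D [?T] ?T) (Hom D (src D \<phi>) ?T)
      (Hom S [S0] S0) (Hom S (map (on_obj p) (src D \<phi>)) S0)
      (precomp D 0 \<phi>) (hom_functor p) (hom_functor p) (precomp S 0 (on_mor p \<phi>))"
      using unary_cocartesianD[OF assms(1) T] assms(4) by simp
    show "comp1 D 0 e' e \<in> Ob (Hom D [?T] ?T)"
      using D.comp1_Ob[of 0 "[tgt D \<psi>]" e "[?T]" e' ?T] e(1) e'(1) by (simp add: subst_slot_in_singleton)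
    show "id1 D ?T \<in> Ob (Hom D [?T] ?T)" using D.id1[OF T] by (simp add: Hom_Ob)
    show "?z \<in> hom (Hom D (src D \<phi>) ?T) (FOb (precomp D 0 \<phi>) (comp1 D 0 e' e)) (FOb (precomp D 0 \<phi>) (id1 D ?T))"
      using z D.left_unit1[OF \<phi>] by simp
    show "id2 S (id1 S S0) \<in> hom (Hom S [S0] S0) (FOb (hom_functor p) (comp1 D 0 e' e)) (FOb (hom_functor p) (id1 D ?T))"
      using S.id2_hom[of "id1 S S0" "[S0]" S0] id1 p.id[OF T] assms(4) pe'e by (simp add: Hom_Ob)
    show "FAr (precomp S 0 (on_mor p \<phi>)) (id2 S (id1 S S0)) = FAr (hom_functor p) ?z"
      using pz unit[OF id2p\<phi>[unfolded p\<phi>(2)]] by simp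
  qed
  then obtain t where "t \<in> hom (Hom D [?T] ?T) (comp1 D 0 e' e) (id1 D ?T)"
      "FAr (hom_functor p) t = id2 S (id1 S S0)" by (elim ex1E conjE)
  then show ?thesis by (intro fiber_isomorphic[OF _ _ S0]) simp_all
qed

text \<open>The hypotheses are symmetric in \<phi> and \<psi>: each factors through the other, over
  \<nu> and over its inverse, and \<open>unary_cocartesian_retract\<close> is used once in each
  direction.\<close>

lemma unary_cocartesian_equivalent:
  assumes "unary_cocartesian \<phi>" "unary_cocartesian \<psi>" "src D \<psi> = src D \<phi>"
    and "on_obj p (tgt D \<phi>) = S0" "on_obj p (tgt D \<psi>) = S0"
    and "isomorphic (Hom S (map (on_obj p) (src D \<phi>)) S0) (on_mor p \<phi>) (on_mor p \<psi>)"
  shows "equivalent (fiber D S p S0) (tgt D \<phi>) (tgt D \<psi>)"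
proof -
  have \<phi>: "\<phi> \<in> Mor D" and \<psi>: "\<psi> \<in> Mor D" using assms(1,2) by (simp_all add: unary_cocartesian_def)
  have p\<phi>: "on_mor p \<phi> \<in> Ob (Hom S (map (on_obj p) (src D \<phi>)) S0)"
    using on_mor_Ob[OF D.Mor_Ob[OF \<phi>]] assms(4) by simp
  interpret H: category "Hom S (map (on_obj p) (src D \<phi>)) S0" by (rule S.Hom_of_category[OF p\<phi>])
  obtain \<nu> where \<nu>: "\<nu> \<in> isos (Hom S (map (on_obj p) (src D \<phi>)) S0) (on_mor p \<phi>) (on_mor p \<psi>)"
    using assms(6) by (auto simp: isomorphic_def)
  obtain \<nu>' where \<nu>': "\<nu>' \<in> isos (Hom S (map (on_obj p) (src D \<phi>)) S0) (on_mor p \<psi>) (on_mor p \<phi>)"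
      "vcomp S \<nu>' \<nu> = id2 S (on_mor p \<phi>)" "vcomp S \<nu> \<nu>' = id2 S (on_mor p \<psi>)"
    using H.isosE[OF \<nu>] by auto
  obtain e x where e: "e \<in> Ob (Hom D [tgt D \<phi>] (tgt D \<psi>))" "on_mor p e = id1 S S0"
    "x \<in> hom (Hom D (src D \<phi>) (tgt D \<psi>)) (comp1 D 0 e \<phi>) \<psi>" "on_cell p x = \<nu>"
    using unary_cocartesian_factor[OF assms(1) \<psi> assms(3,4,5) H.isos_hom[OF \<nu>]] .
  obtain e' y where e': "e' \<in> Ob (Hom D [tgt D \<psi>] (tgt D \<phi>))" "on_mor p e' = id1 S S0"
    "y \<in> hom (Hom D (src D \<phi>) (tgt D \<phi>)) (comp1 D 0 e' \<psi>) \<phi>" "on_cell p y = \<nu>'"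
    using unary_cocartesian_factor[OF assms(2) \<phi> assms(3)[symmetric] assms(5,4), unfolded assms(3),
        OF H.isos_hom[OF \<nu>'(1)]] .
  have "isomorphic (Hom (fiber D S p S0) [tgt D \<phi>] (tgt D \<phi>)) (comp1 D 0 e' e) (id1 D (tgt D \<phi>))"
    using unary_cocartesian_retract[OF assms(1) \<psi> assms(3-5) e(1-3) e'(1-3)] e(4) e'(4) \<nu>'(2) by simp
  moreover have "isomorphic (Hom (fiber D S p S0) [tgt D \<psi>] (tgt D \<psi>)) (comp1 D 0 e e') (id1 D (tgt D \<psi>))"
    using unary_cocartesian_retract[OF assms(2) \<phi> assms(3)[symmetric] assms(5,4),
        unfolded assms(3), OF e'(1-3) e(1-3)] e(4) e'(4) \<nu>'(3) by simp
  ultimately show ?thesis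
    using fiber_equivalentI[OF _ _ assms(4,5) e(1,2) e'(1,2)] D.mor[OF \<phi>] D.mor[OF \<psi>] by simp
qed

section \<open>Equivalences in the fiber from Cartesian 1-morphisms\<close>

lemma unary_cartesian_factor:
  assumes "unary_cartesian i \<phi>" "\<psi> \<in> Mor D" "src D \<psi> = (src D \<phi>)[i := Q]" "tgt D \<psi> = tgt D \<phi>"
    and "on_obj p (src D \<phi> ! i) = S0" "on_obj p Q = S0"
    and "\<nu> \<in> hom (Hom S (map (on_obj p) (src D \<phi>)) (on_obj p (tgt D \<phi>))) (on_mor p \<phi>) (on_mor p \<psi>)"
  obtains e x where "e \<in> Ob (Hom D [Q] (src D \<phi> ! i))" "on_mor p e = id1 S S0"
    "x \<in> hom (Hom D (src D \<psi>) (tgt D \<phi>)) (comp1 D i \<phi> e) \<psi>" "on_cell p x = \<nu>"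
proof -
  have \<phi>: "\<phi> \<in> Mor D" and i: "i < length (src D \<phi>)" using assms(1) by (simp_all add: unary_cartesian_def)
  have G: "Q \<in> Obj D" using D.mor[OF assms(2)] assms(3) set_update_memI[OF i, of Q] by auto
  have S0: "S0 \<in> Obj S" using p.obj[OF G] assms(6) by simp
  \<comment> \<open>Old and new entry of slot \<open>i\<close> both lie over \<open>S0\<close>, so
    \<phi> and \<psi> have images in the same Hom category of \<open>S\<close> and can be compared
    by \<nu>.\<close>
  have src: "map (on_obj p) ((src D \<phi>)[i := Q]) = map (on_obj p) (src D \<phi>)"
    using assms(5,6) i by (metis list_update_id map_update nth_map)
  interpret sq: functor_square "Hom D [Q] (src D \<phi> ! i)" "Hom D (src D \<psi>) (tgt D \<phi>)"
      "Hom S [S0] S0" "Hom S (map (on_obj p) (src D \<phi>)) (on_obj p (tgt D \<phi>))"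
      "postcomp D i \<phi>" "hom_functor p" "hom_functor p" "postcomp S i (on_mor p \<phi>)"
    using unary_postcomp_square[OF \<phi> i G] assms(3,5,6) src by simp
  \<comment> \<open>The factor now stands on the source side, so the right unit law in slot
    \<open>i\<close> takes over the part of the left unit law.\<close>
  have unit: "comp1 S i (on_mor p \<phi>) (id1 S S0) = on_mor p \<phi>"
    using S.right_unit1[of "on_mor p \<phi>" i] on_mor_Ob[OF D.Mor_Ob[OF \<phi>]] assms(5) i
    by (simp add: Hom_Ob arity_def)
  have \<nu>: "\<nu> \<in> isos (Hom S (map (on_obj p) (src D \<phi>)) (on_obj p (tgt D \<phi>)))
      (FOb (postcomp S i (on_mor p \<phi>)) (id1 S S0)) (FOb (hom_functor p) \<psi>)"
    using invertible_isos[OF inv_S assms(7)] by (simp add: unit)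
  have tp: "two_pullback (Hom D [Q] (src D \<phi> ! i)) (Hom D (src D \<psi>) (tgt D \<phi>))
      (Hom S [S0] S0) (Hom S (map (on_obj p) (src D \<phi>)) (on_obj p (tgt D \<phi>)))
      (postcomp D i \<phi>) (hom_functor p) (hom_functor p) (postcomp S i (on_mor p \<phi>))"
    using unary_cartesianD[OF assms(1) G] assms(3,5,6) src by simp
  obtain e x where "e \<in> Ob (Hom D [Q] (src D \<phi> ! i))" "FOb (hom_functor p) e = id1 S S0"
      "x \<in> isos (Hom D (src D \<psi>) (tgt D \<phi>)) (FOb (postcomp D i \<phi>) e) \<psi>" "FAr (hom_functor p) x = \<nu>"
  proof (rule sq.two_pullback_surj_strict[OF tp _ _ _ \<nu>])
    show "\<exists>a'. \<exists>u\<in>isos (Hom D [Q] (src D \<phi> ! i)) a' a.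
        FOb (hom_functor p) a' = id1 S S0 \<and> FAr (hom_functor p) u = v"
      if "a \<in> Ob (Hom D [Q] (src D \<phi> ! i))" "v \<in> isos (Hom S [S0] S0) (id1 S S0) (FOb (hom_functor p) a)" for a v
      using lift_cell[OF that(1)] that(2) assms(5,6) by (simp add: isos_def)
    show "\<psi> \<in> Ob (Hom D (src D \<psi>) (tgt D \<phi>))" using assms(2,4) by (simp add: Hom_Ob)
    show "id1 S S0 \<in> Ob (Hom S [S0] S0)" using S.id1[OF S0] by (simp add: Hom_Ob)
  qed
  then show ?thesis using that by (auto simp: isos_def)
qed

text \<open>Here \<open>x\<close> is whiskered with \<open>e'\<close> on the source side: \<phi>
  after \<open>e e'\<close> is isomorphic to \<psi> after \<open>e'\<close> and then to \<phi>. The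
  square of \<phi> in slot \<open>i\<close> cancels \<phi> from the composite 2-morphism.\<close>

lemma unary_cartesian_retract:
  assumes "unary_cartesian i \<phi>" "\<psi> \<in> Mor D" "src D \<psi> = (src D \<phi>)[i := Q]" "tgt D \<psi> = tgt D \<phi>"
    and "on_obj p (src D \<phi> ! i) = S0" "on_obj p Q = S0"
    and e: "e \<in> Ob (Hom D [Q] (src D \<phi> ! i))" "on_mor p e = id1 S S0"
      "x \<in> hom (Hom D (src D \<psi>) (tgt D \<phi>)) (comp1 D i \<phi> e) \<psi>"
    and e': "e' \<in> Ob (Hom D [src D \<phi> ! i] Q)" "on_mor p e' = id1 S S0"
      "y \<in> hom (Hom D (src D \<phi>) (tgt D \<phi>)) (comp1 D i \<psi> e') \<phi>"
    and inverse: "vcomp S (on_cell p y) (on_cell p x) = id2 S (on_mor p \<phi>)"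
  shows "isomorphic (Hom (fiber D S p S0) [src D \<phi> ! i] (src D \<phi> ! i)) (comp1 D 0 e e') (id1 D (src D \<phi> ! i))"
proof -
  let ?T = "src D \<phi> ! i"
  have \<phi>: "\<phi> \<in> Mor D" and i: "i < length (src D \<phi>)" using assms(1) by (simp_all add: unary_cartesian_def)
  have T: "?T \<in> Obj D" using D.mor[OF \<phi>] i nth_mem by blast
  have S0: "S0 \<in> Obj S" using p.obj[OF T] assms(5) by simp
  have id1: "id1 S S0 \<in> Mor S" "src S (id1 S S0) = [S0]" "tgt S (id1 S S0) = S0"
    using S.id1[OF S0] by auto
  have c: "composable D i \<phi> e" "composable D 0 e e'"
    using e(1) e'(1) \<phi> i by (simp_all add: Hom_Ob composable_def arity_def)
  have p\<phi>: "on_mor p \<phi> \<in> Mor S" "src S (on_mor p \<phi>) = map (on_obj p) (src D \<phi>)"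
    using on_mor_Ob[OF D.Mor_Ob[OF \<phi>]] by (simp_all add: Hom_Ob)
  have id2p\<phi>: "id2 S (on_mor p \<phi>) \<in> hom (Hom S (map (on_obj p) (src D \<phi>)) (tgt S (on_mor p \<phi>))) (on_mor p \<phi>) (on_mor p \<phi>)"
    using S.id2_hom[OF S.Mor_Ob[OF p\<phi>(1)]] p\<phi>(2) by simp
  have unit: "comp2 S i \<mu> (id2 S (id1 S S0)) = \<mu>"
    if "\<mu> \<in> hom (Hom S Xs Y) f g" "i < length Xs" "Xs ! i = S0" for \<mu> Xs Y f g
    using S.right_unit2[of \<mu> i] that by (simp add: Hom_hom arity2_def arity_def)
  \<comment> \<open>Putting the original entry back into slot \<open>i\<close> of \<psi> recovers
    the sources of \<phi>; therefore \<psi> after \<open>e'\<close> is parallel to \<phi>.\<close>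
  have i\<psi>: "i < length (src D \<psi>)" "src D \<psi> ! i = Q" "(src D \<psi>)[i := ?T] = src D \<phi>"
    using assms(3) i by simp_all
  have xe': "comp2 D i x (id2 D e') \<in> hom (Hom D (src D \<phi>) (tgt D \<phi>)) (comp1 D i \<phi> (comp1 D 0 e e')) (comp1 D i \<psi> e')"
    using D.comp2_hom[OF i\<psi>(1), of "id2 D e'" "[?T]" e' e', OF _ e(3)] D.id2_hom[OF e'(1)] D.assoc1[OF c] i\<psi>
    by (simp add: subst_slot_singleton)
  have "composable2 D i x (id2 D e')"
    using D.id2_hom[OF e'(1)] e(3) e'(1) i\<psi> D.Hom_hom_Ob(1)[OF e(3)]
    by (simp add: composable2_def composable_def Hom_hom Hom_Ob arity_def)
  then have p_xe': "on_cell p (comp2 D i x (id2 D e')) = on_cell p x"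
    using p.comp2 on_cell_id2[of e'] e'(1,2) unit[OF on_cell_hom[OF e(3)]] i\<psi> assms(6) by (simp add: Hom_Ob)
  let ?z = "vcomp D y (comp2 D i x (id2 D e'))"
  have z: "?z \<in> hom (Hom D (src D \<phi>) (tgt D \<phi>)) (comp1 D i \<phi> (comp1 D 0 e e')) \<phi>"
    by (rule D.vcomp_hom[OF xe' e'(3)])
  have pz: "on_cell p ?z = id2 S (on_mor p \<phi>)"
    using on_cell_vcomp[OF xe' e'(3)] p_xe' inverse by simp
  have "on_mor p (comp1 D 0 e e') = comp1 S 0 (id1 S S0) (id1 S S0)"
    using p.comp1[OF c(2)] e(2) e'(2) by simp
  then have pee': "on_mor p (comp1 D 0 e e') = id1 S S0"
    using S.left_unit1[OF id1(1)] id1 by simp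
  have "\<exists>!t. t \<in> hom (Hom D [?T] ?T) (comp1 D 0 e e') (id1 D ?T) \<and> FAr (postcomp D i \<phi>) t = ?z \<and>
      FAr (hom_functor p) t = id2 S (id1 S S0)"
  proof (rule two_pullback_ex1)
    show "two_pullback (Hom D [?T] ?T) (Hom D (src D \<phi>) (tgt D \<phi>))
      (Hom S [S0] S0) (Hom S (map (on_obj p) (src D \<phi>)) (on_obj p (tgt D \<phi>)))
      (postcomp D i \<phi>) (hom_functor p) (hom_functor p) (postcomp S i (on_mor p \<phi>))"
      using unary_cartesianD[OF assms(1) T] assms(5) by simp
    show "comp1 D 0 e e' \<in> Ob (Hom D [?T] ?T)"
      using D.comp1_Ob[of 0 "[Q]" e' "[?T]" e ?T] e(1) e'(1) by (simp add: subst_slot_in_singleton)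
    show "id1 D ?T \<in> Ob (Hom D [?T] ?T)" using D.id1[OF T] by (simp add: Hom_Ob)
    show "?z \<in> hom (Hom D (src D \<phi>) (tgt D \<phi>)) (FOb (postcomp D i \<phi>) (comp1 D 0 e e')) (FOb (postcomp D i \<phi>) (id1 D ?T))"
      using z D.right_unit1[OF \<phi>] i by (simp add: arity_def)
    show "id2 S (id1 S S0) \<in> hom (Hom S [S0] S0) (FOb (hom_functor p) (comp1 D 0 e e')) (FOb (hom_functor p) (id1 D ?T))"
      using S.id2_hom[of "id1 S S0" "[S0]" S0] id1 p.id[OF T] assms(5) pee' by (simp add: Hom_Ob)
    show "FAr (postcomp S i (on_mor p \<phi>)) (id2 S (id1 S S0)) = FAr (hom_functor p) ?z"
      using pz unit[OF id2p\<phi>] i assms(5) by simp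
  qed
  then obtain t where "t \<in> hom (Hom D [?T] ?T) (comp1 D 0 e e') (id1 D ?T)"
      "FAr (hom_functor p) t = id2 S (id1 S S0)" by (elim ex1E conjE)
  then show ?thesis by (intro fiber_isomorphic[OF _ _ S0]) simp_all
qed

lemma unary_cartesian_equivalent:
  assumes "unary_cartesian i \<phi>" "unary_cartesian i \<psi>" "src D \<psi> = (src D \<phi>)[i := Q]" "tgt D \<psi> = tgt D \<phi>"
    and "on_obj p (src D \<phi> ! i) = S0" "on_obj p Q = S0"
    and "isomorphic (Hom S (map (on_obj p) (src D \<phi>)) (on_obj p (tgt D \<phi>))) (on_mor p \<phi>) (on_mor p \<psi>)"
  shows "equivalent (fiber D S p S0) (src D \<phi> ! i) Q"
proof -
  have \<phi>: "\<phi> \<in> Mor D" and \<psi>: "\<psi> \<in> Mor D" and i: "i < length (src D \<phi>)"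
    using assms(1,2) by (simp_all add: unary_cartesian_def)
  have src: "map (on_obj p) (src D \<psi>) = map (on_obj p) (src D \<phi>)"
    using assms(3,5,6) i by (metis list_update_id map_update nth_map)
  have i\<psi>: "src D \<psi> ! i = Q" "src D \<phi> = (src D \<psi>)[i := src D \<phi> ! i]"
    using assms(3) i by simp_all
  have p\<phi>: "on_mor p \<phi> \<in> Ob (Hom S (map (on_obj p) (src D \<phi>)) (on_obj p (tgt D \<phi>)))"
    using on_mor_Ob[OF D.Mor_Ob[OF \<phi>]] by simp
  interpret H: category "Hom S (map (on_obj p) (src D \<phi>)) (on_obj p (tgt D \<phi>))"
    by (rule S.Hom_of_category[OF p\<phi>])
  obtain \<nu> where \<nu>: "\<nu> \<in> isos (Hom S (map (on_obj p) (src D \<phi>)) (on_obj p (tgt D \<phi>))) (on_mor p \<phi>) (on_mor p \<psi>)"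
    using assms(7) by (auto simp: isomorphic_def)
  obtain \<nu>' where \<nu>': "\<nu>' \<in> isos (Hom S (map (on_obj p) (src D \<phi>)) (on_obj p (tgt D \<phi>))) (on_mor p \<psi>) (on_mor p \<phi>)"
      "vcomp S \<nu>' \<nu> = id2 S (on_mor p \<phi>)" "vcomp S \<nu> \<nu>' = id2 S (on_mor p \<psi>)"
    using H.isosE[OF \<nu>] by auto
  obtain e x where e: "e \<in> Ob (Hom D [Q] (src D \<phi> ! i))" "on_mor p e = id1 S S0"
    "x \<in> hom (Hom D (src D \<psi>) (tgt D \<phi>)) (comp1 D i \<phi> e) \<psi>" "on_cell p x = \<nu>"
    using unary_cartesian_factor[OF assms(1) \<psi> assms(3-6) H.isos_hom[OF \<nu>]] .
  obtain e' y where e': "e' \<in> Ob (Hom D [src D \<phi> ! i] Q)" "on_mor p e' = id1 S S0"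
    "y \<in> hom (Hom D (src D \<phi>) (tgt D \<phi>)) (comp1 D i \<psi> e') \<phi>" "on_cell p y = \<nu>'"
    using unary_cartesian_factor[OF assms(2) \<phi> i\<psi>(2) assms(4)[symmetric], unfolded i\<psi>(1) src assms(4),
        OF assms(6,5) H.isos_hom[OF \<nu>'(1)]] .
  have "isomorphic (Hom (fiber D S p S0) [src D \<phi> ! i] (src D \<phi> ! i)) (comp1 D 0 e e') (id1 D (src D \<phi> ! i))"
    using unary_cartesian_retract[OF assms(1) \<psi> assms(3-6) e(1-3) e'(1-3)] e(4) e'(4) \<nu>'(2) by simp
  moreover have "isomorphic (Hom (fiber D S p S0) [Q] Q) (comp1 D 0 e' e) (id1 D Q)"
    using unary_cartesian_retract[OF assms(2) \<phi> i\<psi>(2) assms(4)[symmetric], unfolded i\<psi>(1) src assms(4),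
        OF assms(6,5) e'(1-3) e(1-3)] e(4) e'(4) \<nu>'(3) by simp
  moreover have "Q \<in> Obj D" "src D \<phi> ! i \<in> Obj D"
    using D.mor[OF \<psi>] D.mor[OF \<phi>] assms(3) i set_update_memI[OF i, of Q] nth_mem[OF i] by auto
  \<comment> \<open>Factorizations through Cartesian 1-morphisms reverse direction:
    \<open>e'\<close> leads from the source of \<phi> to \<open>Q\<close>, so it is the first
    1-morphism of the equivalence.\<close>
  ultimately show ?thesis
    using fiber_equivalentI[OF _ _ assms(5,6) e'(1,2) e(1,2)] by simp
qed

end

section \<open>Internal versus external product and hom\<close>

theorem corollary7p3:
  fixes D :: "('o, 'm, 'c) sym_two_multicat"
    and S :: "('o1, 'm1, 'c1) sym_two_multicat"
    and p :: "('o, 'm, 'c, 'o1, 'm1, 'c1) mfunctor_data"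
    and s :: "(unit, nat, nat, 'o1, 'm1, 'c1) pseudo_functor_data"
    and S0 :: 'o1 and E F :: 'o
  assumes "symmetric_two_multicategory D" and "symmetric_two_multicategory S"
    and "all_cells_invertible D" and "all_cells_invertible S"
    and "symmetric_strict_functor D S p"
    and "one_bifibered D S p" and "two_isofibered D S p"
    and "one_bifibered S point (to_point S)"
    and "pseudo_functor point S s" and "on_obj s () = S0"
    and "E \<in> Obj (fiber D S p S0)" and "F \<in> Obj (fiber D S p S0)"
  shows
    \<comment> \<open>\<open>\<tau> : (S0, S0) \<rightarrow> S0 \<otimes> S0\<close> and \<open>\<xi> : (E, F) \<rightarrow> E \<boxtimes> F\<close> over it are coCartesian over \<open>{\<cdot>}\<close>;
      \<open>T = E \<otimes> F\<close> and \<open>P = \<Delta>\<^sub>\<bullet>(E \<boxtimes> F)\<close>\<close>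
    "(\<forall>\<tau> \<Delta> \<xi> T P.
        cocartesian_lift S point (to_point S) 2 [S0, S0] \<tau> \<and>
        \<Delta> \<in> Ob (Hom S [tgt S \<tau>] S0) \<and>
        isomorphic (Hom S [S0, S0] S0) (comp1 S 0 \<Delta> \<tau>) (on_mor s 2) \<and>
        cocartesian_lift D point (to_point D) 2 [E, F] \<xi> \<and> on_mor p \<xi> = \<tau> \<and>
        is_pushforward D S p (on_mor s 2) [E, F] T \<and>
        is_pushforward D S p \<Delta> [tgt D \<xi>] P \<longrightarrow>
        equivalent (fiber D S p S0) T P) \<and>
     (\<forall>i < 2. \<forall>\<tau> \<Delta>' \<xi> H Q.
        cartesian_lift S point (to_point S) i 2 (\<lambda>_. S0) S0 \<tau> \<and>
        \<Delta>' \<in> Ob (Hom S [S0] (src S \<tau> ! i)) \<and>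
        isomorphic (Hom S [S0, S0] S0) (comp1 S i \<tau> \<Delta>') (on_mor s 2) \<and>
        cartesian_lift D point (to_point D) i 2 (\<lambda>_. E) F \<xi> \<and> on_mor p \<xi> = \<tau> \<and>
        is_pullback D S p i (on_mor s 2) (\<lambda>_. E) F H \<and>
        is_pullback D S p 0 \<Delta>' (\<lambda>_. E) (src D \<xi> ! i) Q \<longrightarrow>
        equivalent (fiber D S p S0) H Q)"
proof -
  interpret D: symmetric_two_multicategory D by fact
  interpret S: symmetric_two_multicategory S by fact
  interpret p: symmetric_strict_functor D S p by fact
  interpret s: pseudo_functor point S s by fact
  interpret isofibered_groupoidal D S p
    by unfold_locales (use assms in simp_all)
  have EF: "E \<in> Obj D" "F \<in> Obj D" "on_obj p E = S0" "on_obj p F = S0"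
    using assms(11,12) by (simp_all add: fiber_def)
  let ?m = "on_mor s 2"
  \<comment> \<open>The binary 1-morphism of \<open>point\<close> is represented by the number 2, so
    \<open>?m\<close> is the distinguished element of Hom(S,S;S) chosen by the
    pseudo-functor.\<close>
  have "is_functor (Hom point [(), ()] ()) (Hom S [S0, S0] S0) (hom_functor s)"
    using s.hom[of "[(), ()]" "()"] assms(10) by (simp add: point_def)
  from functor_Ob[OF this, of 2] have m: "?m \<in> Ob (Hom S [S0, S0] S0)"
    by (simp add: Hom_point)
  interpret H: category "Hom S [S0, S0] S0" by (rule S.Hom_of_category[OF m])
  \<comment> \<open>The hypotheses give 2-isomorphisms towards \<open>?m\<close>, while the
    comparison lemmas start from the 1-morphism \<phi> lying over \<open>?m\<close>.\<close>
  have iso_sym: "isomorphic (Hom S [S0, S0] S0) g f" if "isomorphic (Hom S [S0, S0] S0) f g" for f g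
    using that H.isosE unfolding isomorphic_def by (metis all_not_in_conv)
  have src_p: "src S (on_mor p f) = map (on_obj p) (src D f)" "tgt S (on_mor p f) = on_obj p (tgt D f)"
    if "f \<in> Mor D" for f
    using on_mor_Ob[OF D.Mor_Ob[OF that]] by (simp_all add: Hom_Ob)
  show ?thesis
  proof (rule conjI; intro allI impI)
    fix \<tau> \<Delta> \<xi> T P
    assume A: "cocartesian_lift S point (to_point S) 2 [S0, S0] \<tau> \<and>
        \<Delta> \<in> Ob (Hom S [tgt S \<tau>] S0) \<and>
        isomorphic (Hom S [S0, S0] S0) (comp1 S 0 \<Delta> \<tau>) ?m \<and>
        cocartesian_lift D point (to_point D) 2 [E, F] \<xi> \<and> on_mor p \<xi> = \<tau> \<and>
        is_pushforward D S p ?m [E, F] T \<and> is_pushforward D S p \<Delta> [tgt D \<xi>] P"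
    then obtain \<phi> \<zeta> where \<phi>: "cocartesian D S p \<phi>" "on_mor p \<phi> = ?m" "src D \<phi> = [E, F]" "tgt D \<phi> = T"
      and \<zeta>: "cocartesian D S p \<zeta>" "on_mor p \<zeta> = \<Delta>" "src D \<zeta> = [tgt D \<xi>]" "tgt D \<zeta> = P"
      by (auto simp: is_pushforward_def cocartesian_lift_def)
    have \<xi>: "unary_cocartesian \<xi>" "src D \<xi> = [E, F]"
      using A unary_cocartesian_over_point by (auto simp: cocartesian_lift_def)
    have Mor: "\<phi> \<in> Mor D" "\<zeta> \<in> Mor D" "\<xi> \<in> Mor D"
      using \<phi>(1) \<zeta>(1) \<xi>(1) by (simp_all add: cocartesian_def unary_cocartesian_def)
    have c: "composable D 0 \<zeta> \<xi>" using Mor \<zeta>(3) by (simp add: composable_def arity_def)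
    note \<psi> = D.src_comp1[OF c, unfolded \<zeta>(3,4) \<xi>(2) subst_slot_in_singleton]
    have "equivalent (fiber D S p S0) (tgt D \<phi>) (tgt D (comp1 D 0 \<zeta> \<xi>))"
    proof (rule unary_cocartesian_equivalent)
      show "unary_cocartesian \<phi>" by (rule cocartesian_imp_unary[OF \<phi>(1)])
      show "unary_cocartesian (comp1 D 0 \<zeta> \<xi>)"
        by (rule unary_cocartesian_comp[OF \<xi>(1) cocartesian_imp_unary[OF \<zeta>(1)] \<zeta>(3)])
      show "src D (comp1 D 0 \<zeta> \<xi>) = src D \<phi>" using \<psi> \<phi>(3) by simp
      show "on_obj p (tgt D \<phi>) = S0" using src_p(2)[OF Mor(1)] \<phi>(2) m by (simp add: Hom_Ob)
      show "on_obj p (tgt D (comp1 D 0 \<zeta> \<xi>)) = S0"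
        using src_p(2)[OF Mor(2)] \<zeta>(2,4) A \<psi> by (simp add: Hom_Ob)
      \<comment> \<open>Strictness of \<open>p\<close> puts the composite exactly over \<Delta>
        after \<tau>, where the hypothesis on \<Delta> applies.\<close>
      show "isomorphic (Hom S (map (on_obj p) (src D \<phi>)) S0) (on_mor p \<phi>) (on_mor p (comp1 D 0 \<zeta> \<xi>))"
        using A iso_sym p.comp1[OF c] \<phi>(2,3) \<zeta>(2) EF by simp
    qed
    then show "equivalent (fiber D S p S0) T P" using \<phi>(4) \<psi> by simp
  next
    fix i :: nat and \<tau> \<Delta>' \<xi> H Q
    assume i: "i < 2"
    assume A: "cartesian_lift S point (to_point S) i 2 (\<lambda>_. S0) S0 \<tau> \<and>
        \<Delta>' \<in> Ob (Hom S [S0] (src S \<tau> ! i)) \<and>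
        isomorphic (Hom S [S0, S0] S0) (comp1 S i \<tau> \<Delta>') ?m \<and>
        cartesian_lift D point (to_point D) i 2 (\<lambda>_. E) F \<xi> \<and> on_mor p \<xi> = \<tau> \<and>
        is_pullback D S p i ?m (\<lambda>_. E) F H \<and> is_pullback D S p 0 \<Delta>' (\<lambda>_. E) (src D \<xi> ! i) Q"
    then obtain \<phi> \<zeta> where \<phi>: "cartesian D S p i \<phi>" "on_mor p \<phi> = ?m" "tgt D \<phi> = F" "src D \<phi> ! i = H"
        "\<And>j. j < arity D \<phi> \<Longrightarrow> j \<noteq> i \<Longrightarrow> src D \<phi> ! j = E"
      and \<zeta>: "cartesian D S p 0 \<zeta>" "on_mor p \<zeta> = \<Delta>'" "tgt D \<zeta> = src D \<xi> ! i" "src D \<zeta> ! 0 = Q"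
      by (auto simp: is_pullback_def cartesian_lift_def)
    \<comment> \<open>A Cartesian lift prescribes sources only outside slot \<open>i\<close>; the
      arity of \<xi> is read off from its lying over 2 in \<open>point\<close>.\<close>
    have \<xi>: "unary_cartesian i \<xi>" "length (src D \<xi>) = 2" "tgt D \<xi> = F"
        "\<And>j. j < arity D \<xi> \<Longrightarrow> j \<noteq> i \<Longrightarrow> src D \<xi> ! j = E"
      using A unary_cartesian_over_point by (auto simp: cartesian_lift_def to_point_def arity_def)
    have Mor: "\<phi> \<in> Mor D" "\<zeta> \<in> Mor D" "\<xi> \<in> Mor D"
      using \<phi>(1) \<zeta>(1) \<xi>(1) by (simp_all add: cartesian_def unary_cartesian_def)
    \<comment> \<open>Likewise the arity of \<phi>, and the fact that all its sources lie over
      \<open>S0\<close>, come from \<open>?m\<close> being in Hom(S,S;S).\<close>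
    have src_\<phi>: "map (on_obj p) (src D \<phi>) = [S0, S0]"
      using src_p(1)[OF Mor(1)] \<phi>(2) m by (simp add: Hom_Ob)
    then have len_\<phi>: "length (src D \<phi>) = 2" by (metis length_map length_Cons list.size(3) numeral_2_eq_2)
    have p\<zeta>: "map (on_obj p) (src D \<zeta>) = [S0]"
      using src_p(1)[OF Mor(2)] \<zeta>(2) A by (simp add: Hom_Ob)
    then have src_\<zeta>: "src D \<zeta> = [Q]" "on_obj p Q = S0" using \<zeta>(4) by auto
    have c: "composable D i \<xi> \<zeta>" using Mor \<zeta>(3) \<xi>(2) i by (simp add: composable_def arity_def)
    note \<psi> = D.src_comp1[OF c, unfolded src_\<zeta> \<xi>(3) subst_slot_singleton[OF i[folded \<xi>(2)]]]
    have "equivalent (fiber D S p S0) (src D \<phi> ! i) Q"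
    proof (rule unary_cartesian_equivalent)
      show "unary_cartesian i \<phi>" by (rule cartesian_imp_unary[OF \<phi>(1)])
      show "unary_cartesian i (comp1 D i \<xi> \<zeta>)"
        by (rule unary_cartesian_comp[OF \<xi>(1) cartesian_imp_unary[OF \<zeta>(1)] src_\<zeta>(1) \<zeta>(3)])
      show "src D (comp1 D i \<xi> \<zeta>) = (src D \<phi>)[i := Q]"
        \<comment> \<open>Entrywise: slot \<open>i\<close> holds \<open>Q\<close> on both sides, and
          the other slot holds \<open>E\<close> because both lifts prescribe it there.\<close>
        unfolding \<psi>(1) using \<phi>(5) \<xi>(2,4) len_\<phi> i
        by (intro nth_equalityI) (auto simp: nth_list_update arity_def)
      show "tgt D (comp1 D i \<xi> \<zeta>) = tgt D \<phi>" using \<psi> \<phi>(3) by simp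
      show "on_obj p (src D \<phi> ! i) = S0"
        using src_\<phi> len_\<phi> i by (metis nth_map less_2_cases nth_Cons_0 nth_Cons_Suc One_nat_def)
      show "on_obj p Q = S0" by (rule src_\<zeta>(2))
      show "isomorphic (Hom S (map (on_obj p) (src D \<phi>)) (on_obj p (tgt D \<phi>))) (on_mor p \<phi>) (on_mor p (comp1 D i \<xi> \<zeta>))"
        using A iso_sym p.comp1[OF c] \<phi>(2,3) \<zeta>(2) EF src_\<phi> by simp
    qed
    then show "equivalent (fiber D S p S0) H Q" using \<phi>(4) by simp
  qed
qed

end
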